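(* Let $n\ge 6$. Define $g:\mathbf{S}(n)\to\{0,1\}$ as follows. For $\alpha=a_1a_2\cdots a_n\in\mathbf{S}(n)$ let $\beta_1=0^{n-i}1a_2\cdots a_i$ where $i$ is the largest index with $a_i=1$; $\beta_2=a_2a_3\cdots a_n1$; $\beta_3=a_ja_{j+1}\cdots a_n0\,1^{j-2}$ where $j$ is the smallest index with $j>1$ and $a_j=0$. Set $g(\alpha)=\overline{a_1}$ (the complement of $a_1$) if (i) $\beta_1$ and $\mathrm{FirstOne}(\beta_1)$ are in $\mathbf{A}(n)$; or (ii) $\beta_2$ and $\mathrm{LastOne}(\beta_2)$ are in $\mathbf{A}(n)$ and $\mathrm{FirstOne}(\beta_2)\notin\mathbf{A}(n)$; or (iii) $\beta_3$ and $\mathrm{LastZero}(\beta_3)$ are in $\mathbf{A}(n)$ and neither $\mathrm{FirstOne}(\beta_3)$ nor $\mathrm{LastOne}(\beta_3)$ is in $\mathbf{A}(n)$; and $g(\alpha)=a_1$ otherwise. Then $g$ is a successor rule of a universal cycle for $\mathbf{S}(n)$; this universal cycle is an orientable sequence of order $n$ of length $L_n$, and each bit can be computed (i.e. $g(\alpha)$ evaluated) in $O(n)$ time using $O(n)$ space.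
   Context: Binary strings are compared lexicographically with $0<1$ (a proper prefix is smaller). For $\alpha=a_1\cdots a_n$, $\alpha^R=a_n\cdots a_1$. $[\alpha]$ is the set of rotations of $\alpha$; $\alpha$ is a necklace if it is lexicographically smallest in $[\alpha]$, and a bracelet if lexicographically smallest in $[\alpha]\cup[\alpha^R]$. A necklace $\alpha$ is symmetric if $\alpha^R\in[\alpha]$, otherwise asymmetric. $\mathbf{A}(n)$ is the set of length-$n$ asymmetric bracelets. $\mathbf{S}(n)=\bigcup_{\alpha\in\mathbf{A}(n)}[\alpha]$. The aperiodic prefix $\mathrm{ap}(\alpha)$ is the shortest string $\gamma$ with $\alpha=\gamma^t$ for some $t\ge1$, and $L_n=\sum_{\alpha\in\mathbf{A}(n)}|\mathrm{ap}(\alpha)|$. For $\alpha=a_1\cdots a_n\in\mathbf{A}(n)$: $\mathrm{FirstOne}(\alpha)$ is $\alpha$ with its first $1$ flipped to $0$; $\mathrm{LastOne}(\alpha)$ is the necklace (lexicographically smallest rotation) of $a_1\cdots a_{n-1}0$; $\mathrm{LastZero}(\alpha)$ is $\alpha$ with its last $0$ flipped to $1$. A universal cycle for a set $\mathbf{S}$ of length-$n$ strings is a cyclic sequence of length $|\mathbf{S}|$ whose cyclic length-$n$ substrings are exactly the elements of $\mathbf{S}$, each once; a function $f:\mathbf{S}\to\{0,1\}$ is a successor rule for it if for each $\alpha\in\mathbf{S}$, $f(\alpha)$ is the bit following $\alpha$ in the cycle (so repeatedly mapping $a_1\cdots a_n\mapsto a_2\cdots a_nf(a_1\cdots a_n)$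 from any element of $\mathbf{S}$ traverses the cycle). An orientable sequence of order $n$ is a cyclic binary sequence $s_1\cdots s_m$ such that each length-$n$ string appears at most once among all its cyclic length-$n$ substrings read in either direction, i.e. the $m$ cyclic windows of $s_1\cdots s_m$ and the $m$ cyclic windows of $s_m\cdots s_1$ are $2m$ pairwise distinct strings; its length is $m$. *)

theory Defs
  imports Complex_Main "HOL-Library.List_Lexorder" "HOL-Library.Landau_Symbols"
begin

section \<open>Necklaces, bracelets and the three bit-flipping operations\<close>

text \<open>
  Binary strings are values of type \<^typ>\<open>bool list\<close> with \<^term>\<open>False\<close> as 0 and
  \<^term>\<open>True\<close> as 1. The order \<open>\<le>\<close> on them is the lexicographic one of
  \<^theory>\<open>HOL-Library.List_Lexorder\<close>, in which a proper prefix is smaller.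
\<close>

definition rotations :: "bool list \<Rightarrow> bool list set" where
  "rotations \<alpha> = {rotate k \<alpha> | k. True}"

definition is_necklace :: "bool list \<Rightarrow> bool" where
  "is_necklace \<alpha> \<longleftrightarrow> (\<forall>\<beta> \<in> rotations \<alpha>. \<alpha> \<le> \<beta>)"

definition is_bracelet :: "bool list \<Rightarrow> bool" where
  "is_bracelet \<alpha> \<longleftrightarrow> (\<forall>\<beta> \<in> rotations \<alpha> \<union> rotations (rev \<alpha>). \<alpha> \<le> \<beta>)"

definition is_symmetric :: "bool list \<Rightarrow> bool" where
  "is_symmetric \<alpha> \<longleftrightarrow> rev \<alpha> \<in> rotations \<alpha>"

definition asym_bracelets :: "nat \<Rightarrow> bool list set" where
  "asym_bracelets n = {\<alpha>. length \<alpha> = n \<and> is_necklace \<alpha> \<and> is_bracelet \<alpha> \<and> \<not> is_symmetric \<alpha>}"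

definition asym_strings :: "nat \<Rightarrow> bool list set" where
  "asym_strings n = (\<Union>\<alpha> \<in> asym_bracelets n. rotations \<alpha>)"

definition aperiodic_prefix :: "bool list \<Rightarrow> bool list" where
  "aperiodic_prefix \<alpha> = (ARG_MIN length \<gamma>. \<exists>t\<ge>1. \<alpha> = concat (replicate t \<gamma>))"

definition cycle_length :: "nat \<Rightarrow> nat" where
  "cycle_length n = (\<Sum>\<alpha> \<in> asym_bracelets n. length (aperiodic_prefix \<alpha>))"

definition necklace_of :: "bool list \<Rightarrow> bool list" where
  "necklace_of \<alpha> = Min (rotations \<alpha>)"

definition first_one :: "bool list \<Rightarrow> bool list" where
  "first_one \<alpha> = \<alpha>[(LEAST i. i < length \<alpha> \<and> \<alpha> ! i) := False]"

definition last_one :: "bool list \<Rightarrow> bool list" where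
  "last_one \<alpha> = necklace_of (butlast \<alpha> @ [False])"

definition last_zero :: "bool list \<Rightarrow> bool list" where
  "last_zero \<alpha> = \<alpha>[(GREATEST i. i < length \<alpha> \<and> \<not> \<alpha> ! i) := True]"


section \<open>The function \<open>g\<close>\<close>

text \<open>
  The indices \<open>i\<close> and \<open>j\<close> below are 1-based: \<open>a\<^sub>k\<close> is \<open>\<alpha> ! (k - 1)\<close>. They exist for every
  string in \<^term>\<open>asym_strings n\<close>, since strings with at most one 1, or with at most one 0,
  are rotations of their reversals.
\<close>

definition beta1 :: "bool list \<Rightarrow> bool list" where
  "beta1 \<alpha> =
     (let n = length \<alpha>; i = (GREATEST i. 1 \<le> i \<and> i \<le> n \<and> \<alpha> ! (i - 1))
      in replicate (n - i) False @ [True] @ drop 1 (take i \<alpha>))"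

definition beta2 :: "bool list \<Rightarrow> bool list" where
  "beta2 \<alpha> = drop 1 \<alpha> @ [True]"

definition beta3 :: "bool list \<Rightarrow> bool list" where
  "beta3 \<alpha> =
     (let n = length \<alpha>; j = (LEAST j. 1 < j \<and> j \<le> n \<and> \<not> \<alpha> ! (j - 1))
      in drop (j - 1) \<alpha> @ [False] @ replicate (j - 2) True)"

definition g :: "nat \<Rightarrow> bool list \<Rightarrow> bool" where
  "g n \<alpha> =
     (let A = asym_bracelets n; \<beta>1 = beta1 \<alpha>; \<beta>2 = beta2 \<alpha>; \<beta>3 = beta3 \<alpha>
      in if (\<beta>1 \<in> A \<and> first_one \<beta>1 \<in> A)
          \<or> (\<beta>2 \<in> A \<and> last_one \<beta>2 \<in> A \<and> first_one \<beta>2 \<notin> A)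
          \<or> (\<beta>3 \<in> A \<and> last_zero \<beta>3 \<in> A \<and> first_one \<beta>3 \<notin> A \<and> last_one \<beta>3 \<notin> A)
         then \<not> hd \<alpha> else hd \<alpha>)"


section \<open>Universal cycles, successor rules and orientable sequences\<close>

text \<open>
  A cyclic sequence is given by one of its linear representatives. The windows are taken
  cyclically, so they also make sense when the sequence is shorter than \<open>n\<close>.
\<close>

definition window :: "nat \<Rightarrow> bool list \<Rightarrow> nat \<Rightarrow> bool list" where
  "window n s i = map (\<lambda>k. s ! ((i + k) mod length s)) [0..<n]"

definition universal_cycle :: "nat \<Rightarrow> bool list set \<Rightarrow> bool list \<Rightarrow> bool" where
  "universal_cycle n X s \<longleftrightarrow>
     length s = card X \<and> bij_betw (window n s) {..<length s} X"

definition successor_rule :: "nat \<Rightarrow> bool list set \<Rightarrow> bool list \<Rightarrow> (bool list \<Rightarrow> bool) \<Rightarrow> bool" where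
  "successor_rule n X s f \<longleftrightarrow>
     (\<forall>\<alpha> \<in> X. \<forall>i < length s. window n s i = \<alpha> \<longrightarrow> f \<alpha> = s ! ((i + n) mod length s))"

definition orientable_sequence :: "nat \<Rightarrow> bool list \<Rightarrow> bool" where
  "orientable_sequence n s \<longleftrightarrow>
     distinct (map (window n s) [0..<length s] @ map (window n (rev s)) [0..<length s])"


section \<open>Unit-cost random access machine\<close>

text \<open>
  Time and space are measured on a RAM that is programmed in structured form. A state consists
  of registers and a memory. A program mentions only finitely many registers. The machine has
  \<open>m\<close> memory cells with addresses \<open>0, \<dots>, m - 1\<close>, and every word it handles is less than \<open>m\<close>,
  so that words have \<open>O(log m)\<close> bits and unit cost per instruction is justified. An execution
  that leaves these bounds is stuck. Subtraction is truncated at 0.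
\<close>

type_synonym reg = nat

type_synonym state = "(reg \<Rightarrow> nat) \<times> (nat \<Rightarrow> nat)"

datatype cond = Equal reg reg | Less reg reg

datatype com =
    Skip
  | Const reg nat
  | Move reg reg
  | Add reg reg reg
  | Sub reg reg reg
  | Load reg reg
  | Store reg reg
  | Seq com com
  | Cond cond com com
  | While cond com

fun holds :: "cond \<Rightarrow> (reg \<Rightarrow> nat) \<Rightarrow> bool" where
  "holds (Equal x y) R \<longleftrightarrow> R x = R y"
| "holds (Less x y) R \<longleftrightarrow> R x < R y"

text \<open>
  \<open>exec m c \<sigma> t \<tau>\<close>: on the machine with \<open>m\<close> cells, program \<open>c\<close> started in state \<open>\<sigma>\<close> halts in
  state \<open>\<tau>\<close> after exactly \<open>t\<close> steps.
\<close>

inductive exec :: "nat \<Rightarrow> com \<Rightarrow> state \<Rightarrow> nat \<Rightarrow> state \<Rightarrow> bool" for m :: nat where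
  Skip: "exec m Skip \<sigma> 1 \<sigma>"
| Const: "k < m \<Longrightarrow> exec m (Const x k) (R, M) 1 (R(x := k), M)"
| Move: "exec m (Move x y) (R, M) 1 (R(x := R y), M)"
| Add: "R y + R z < m \<Longrightarrow> exec m (Add x y z) (R, M) 1 (R(x := R y + R z), M)"
| Sub: "exec m (Sub x y z) (R, M) 1 (R(x := R y - R z), M)"
| Load: "R y < m \<Longrightarrow> exec m (Load x y) (R, M) 1 (R(x := M (R y)), M)"
| Store: "R x < m \<Longrightarrow> exec m (Store x y) (R, M) 1 (R, M(R x := R y))"
| Seq: "exec m c \<sigma> t \<sigma>' \<Longrightarrow> exec m d \<sigma>' u \<sigma>'' \<Longrightarrow> exec m (Seq c d) \<sigma> (t + u) \<sigma>''"
| CondTrue: "holds b (fst \<sigma>) \<Longrightarrow> exec m c \<sigma> t \<sigma>' \<Longrightarrow> exec m (Cond b c d) \<sigma> (1 + t) \<sigma>'"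
| CondFalse: "\<not> holds b (fst \<sigma>) \<Longrightarrow> exec m d \<sigma> t \<sigma>' \<Longrightarrow> exec m (Cond b c d) \<sigma> (1 + t) \<sigma>'"
| WhileTrue: "holds b (fst \<sigma>) \<Longrightarrow> exec m c \<sigma> t \<sigma>' \<Longrightarrow> exec m (While b c) \<sigma>' u \<sigma>''
    \<Longrightarrow> exec m (While b c) \<sigma> (1 + t + u) \<sigma>''"
| WhileFalse: "\<not> holds b (fst \<sigma>) \<Longrightarrow> exec m (While b c) \<sigma> 1 \<sigma>"

text \<open>
  The input string occupies the first cells of the memory, its length is in register 0, and
  everything else is 0 initially. The resulting bit is left in register 0.
\<close>

definition input_state :: "bool list \<Rightarrow> state" where
  "input_state \<alpha> =
     ((\<lambda>x. if x = 0 then length \<alpha> else 0),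
      (\<lambda>a. if a < length \<alpha> then of_bool (\<alpha> ! a) else 0))"

definition computes_bit_within :: "com \<Rightarrow> bool list \<Rightarrow> bool \<Rightarrow> nat \<Rightarrow> nat \<Rightarrow> bool" where
  "computes_bit_within c \<alpha> b time space \<longleftrightarrow>
     length \<alpha> < space \<and>
     (\<exists>t R M. exec space c (input_state \<alpha>) t (R, M) \<and> t \<le> time \<and> R 0 = of_bool b)"

end

theory Submission
  imports Defs
begin

text \<open>
  Write an asymmetric bracelet as \<open>0\<^sup>s y\<close>, where \<open>y\<close> starts and ends with 1 and has no run of more than \<open>s\<close>
  zeros. The first-one and last-one operations produce strings \<open>0\<^sup>z v\<close> with a unique longest run of
  zeros, and such a string is an asymmetric bracelet iff \<open>v\<close> is smaller than its reversal. If both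
  operations leave the set of asymmetric bracelets, comparing \<open>y\<close> with its reversal forces \<open>y\<close> to end in
  \<open>01\<close> or \<open>011\<close>, and then, except for the root \<open>0\<^sup>n\<^sup>-\<^sup>4 1011\<close>, the last-zero operation stays inside the set and
  can be followed by a last-one operation. The first two operations lengthen the initial run of zeros
  and the third keeps it, so iterating the parent map always reaches the root.

  Hence the rotation classes form a tree. The rule \<open>g\<close> is the pure cycling register with the successors
  of \<open>0\<gamma>\<close> and \<open>1\<gamma>\<close> exchanged for exactly one \<open>\<gamma>\<close> per edge; adding the edges one at a time from
  the root, every exchange merges two different cycles, so that a single cycle remains. A reversed window
  is a rotation of the reversal of an asymmetric bracelet and thus never a window.

  For linear time, membership is decided by comparing a string with its rotations and those of its
  reversal; after a mismatch at offset \<open>k\<close>, \<open>k + 1\<close> rotations can be skipped.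
\<close>

section \<open>Rotations and asymmetric bracelets\<close>

text \<open>Write y = 1 0^p x 0^q 1 with x starting and ending in 1. Erasing the first 1 leaves the
  block x 0^q 1, erasing the last one leaves 1 0^p x. From y < rev y follows q <= p, and p = q would
  close a circle of inequalities with the two failed comparisons. So q < p: for q > 0 the string
  ends in 01, and for q = 0 the failed last-one comparison leaves only 011. The delicate operation
  is last-zero. Raising a 0 keeps weak inequalities against all rotations, but a strict one against
  a rotation of the reversal may become an equality; that rotation then differs from the string only
  in the place of its last 0. With the ending 01 it would end in 0 and thus prolong the run of
  zeros. With the ending 011 there remain, besides this, the strings W 1011 with a palindrome W. If
  W has a 1, the failed comparisons contradict minimality among rotations; if W is all zeros, the
  string is the root. The bound n >= 6 fits this: for n = 5 the string 01011 is symmetric.\<close>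

abbreviation zeros :: "nat \<Rightarrow> bool list" where "zeros k \<equiv> replicate k False"
abbreviation ones :: "nat \<Rightarrow> bool list" where "ones k \<equiv> replicate k True"

lemma lex_append_less:
  fixes a b x y :: "bool list"
  assumes "length a = length b"
  shows "a @ x < b @ y \<longleftrightarrow> a < b \<or> (a = b \<and> x < y)"
  using assms by (induction a b rule: list_induct2) auto

lemma lex_append_le:
  fixes a b x y :: "bool list"
  assumes "length a = length b"
  shows "a @ x \<le> b @ y \<longleftrightarrow> a < b \<or> (a = b \<and> x \<le> y)"
  using assms by (induction a b rule: list_induct2) auto

lemma zeros_le: "zeros (length x) \<le> (x :: bool list)"
  by (induction x) auto

lemma zeros_append_less:
  assumes "take z w \<noteq> zeros z" "length w \<ge> z"
  shows "zeros z @ v < w"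
proof -
  have "zeros z \<le> take z w" using zeros_le[of "take z w"] assms by simp
  then have "zeros z < take z w" using assms(1) by simp
  then have "zeros z @ v < take z w @ drop z w" using assms by (subst lex_append_less) auto
  then show ?thesis by simp
qed

lemma zeros_less_zeros_append:
  assumes "k < l" shows "zeros l @ v < zeros k @ True # w"
proof -
  have "zeros l = zeros k @ False # zeros (l - k - 1)"
    using assms by (metis Suc_diff_Suc add_diff_inverse_nat diff_diff_left less_or_eq_imp_le linorder_not_less plus_1_eq_Suc replicate_Suc replicate_add add.commute)
  then show ?thesis by (simp add: lex_append_less)
qed

lemma rotations_iff: "\<beta> \<in> rotations \<alpha> \<longleftrightarrow> (\<exists>k. \<beta> = rotate k \<alpha>)"
  by (auto simp: rotations_def)

lemma rotations_image: "\<alpha> \<noteq> [] \<Longrightarrow> rotations \<alpha> = (\<lambda>k. rotate k \<alpha>) ` {..<length \<alpha>}"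
  unfolding rotations_def
  by (auto simp: image_iff) (metis length_greater_0_conv lessThan_iff mod_less_divisor rotate_conv_mod)

lemma finite_rotations: "finite (rotations \<alpha>)"
proof (cases "\<alpha> = []")
  case True then show ?thesis by (simp add: rotations_def)
next
  case False then show ?thesis by (simp add: rotations_image)
qed

lemma rotations_self: "\<alpha> \<in> rotations \<alpha>"
  unfolding rotations_iff by (rule exI[of _ 0]) simp

lemma rotations_length: "\<beta> \<in> rotations \<alpha> \<Longrightarrow> length \<beta> = length \<alpha>"
  by (auto simp: rotations_def)

lemma rotate_undo:
  "k \<le> length \<alpha> \<Longrightarrow> rotate (length \<alpha> - k) (rotate k \<alpha>) = \<alpha>"
  by (simp add: rotate_rotate)

lemma rotations_sym: "\<beta> \<in> rotations \<alpha> \<Longrightarrow> \<alpha> \<in> rotations \<beta>"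
proof -
  assume "\<beta> \<in> rotations \<alpha>"
  then obtain k where k: "\<beta> = rotate k \<alpha>" by (auto simp: rotations_iff)
  show ?thesis
  proof (cases "\<alpha> = []")
    case True then show ?thesis using k by (simp add: rotations_self)
  next
    case False
    then have "k mod length \<alpha> \<le> length \<alpha>" by (simp add: less_imp_le)
    then have "rotate (length \<alpha> - k mod length \<alpha>) \<beta> = \<alpha>"
      using k rotate_undo[of "k mod length \<alpha>" \<alpha>] by (simp add: rotate_conv_mod[of k \<alpha>])
    then show ?thesis unfolding rotations_iff by metis
  qed
qed

lemma rotations_trans: "\<beta> \<in> rotations \<alpha> \<Longrightarrow> \<gamma> \<in> rotations \<beta> \<Longrightarrow> \<gamma> \<in> rotations \<alpha>"
  by (auto simp: rotations_iff rotate_rotate)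

lemma rotations_eq: "\<beta> \<in> rotations \<alpha> \<Longrightarrow> rotations \<beta> = rotations \<alpha>"
  using rotations_sym rotations_trans by blast

lemma append_rotations: "b @ a \<in> rotations (a @ b)"
  unfolding rotations_iff by (metis rotate_append)

lemma rotations_obtain:
  assumes "\<beta> \<in> rotations \<alpha>"
  obtains a b where "\<alpha> = a @ b" "\<beta> = b @ a"
  using assms unfolding rotations_iff by (metis append_take_drop_id rotate_drop_take)

lemma rev_rotations: "\<beta> \<in> rotations \<alpha> \<longleftrightarrow> rev \<beta> \<in> rotations (rev \<alpha>)"
proof -
  have *: "rev \<beta> \<in> rotations (rev \<alpha>)" if "\<beta> \<in> rotations \<alpha>" for \<alpha> \<beta> :: "bool list"
    using that append_rotations by (elim rotations_obtain) auto
  show ?thesis using *[of \<beta> \<alpha>] *[of "rev \<beta>" "rev \<alpha>"] by auto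
qed

text \<open>Being symmetric amounts to being a rotation of one's own reversal, so asymmetry and the
  bracelet condition together are a strict inequality against the rotations of the reversal.
  Membership is proved in this form below.\<close>

lemma asym_bracelets_iff:
  "\<alpha> \<in> asym_bracelets n \<longleftrightarrow>
     length \<alpha> = n \<and> (\<forall>\<beta>\<in>rotations \<alpha>. \<alpha> \<le> \<beta>) \<and> (\<forall>\<beta>\<in>rotations (rev \<alpha>). \<alpha> < \<beta>)"
proof -
  have "is_symmetric \<alpha> \<longleftrightarrow> \<alpha> \<in> rotations (rev \<alpha>)"
    unfolding is_symmetric_def using rev_rotations[of \<alpha> "rev \<alpha>"] rev_rotations[of "rev \<alpha>" \<alpha>]
    by (auto intro: rotations_sym)
  then show ?thesis
    unfolding asym_bracelets_def is_bracelet_def is_necklace_def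
    by (auto simp: order_less_le)
qed

lemma necklace_of_eq:
  assumes "\<beta> \<in> rotations \<alpha>" "\<forall>\<gamma>\<in>rotations \<alpha>. \<beta> \<le> \<gamma>"
  shows "necklace_of \<alpha> = \<beta>"
  unfolding necklace_of_def using assms by (intro Min_eqI) (auto simp: finite_rotations)

section \<open>Strings whose longest run of zeros is at the front\<close>

definition no_run :: "nat \<Rightarrow> bool list \<Rightarrow> bool" where
  "no_run z v \<longleftrightarrow> (\<nexists>a b. v = a @ zeros z @ b)"

lemma no_run_mono: "no_run z v \<Longrightarrow> z \<le> z' \<Longrightarrow> no_run z' v"
  unfolding no_run_def by (metis append.assoc le_add_diff_inverse replicate_add)

lemma no_run_infix: "no_run z (a @ v @ b) \<Longrightarrow> no_run z v"
  unfolding no_run_def by (metis append.assoc)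

lemma no_run_rev: "no_run z (rev v) \<longleftrightarrow> no_run z v"
proof -
  have *: "no_run z (rev v)" if "no_run z v" for v
    unfolding no_run_def
  proof (intro notI, elim exE)
    fix a b assume "rev v = a @ zeros z @ b"
    then have "v = rev b @ zeros z @ rev a" by (metis rev_append rev_replicate rev_swap append.assoc)
    then show False using that unfolding no_run_def by blast
  qed
  show ?thesis using *[of v] *[of "rev v"] by auto
qed

definition one_ended :: "bool list \<Rightarrow> bool" where
  "one_ended v \<longleftrightarrow> v \<noteq> [] \<and> hd v \<and> last v"

lemma one_ended_rev: "one_ended (rev v) \<longleftrightarrow> one_ended v"
  by (auto simp: one_ended_def hd_rev last_rev)

text \<open>A cut inside the zeros leaves fewer of them at the front. After a cut inside
  \<open>v\<close>, \<open>z\<close> leading zeros would need either a run inside \<open>v\<close>,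
  which is excluded, or a run across the end of \<open>v\<close>, which is a 1.\<close>

lemma block_necklace:
  assumes v: "one_ended v" and r: "no_run z v" and w: "w \<in> rotations (zeros z @ v)"
  shows "zeros z @ v \<le> w"
proof -
  obtain a b where ab: "zeros z @ v = a @ b" "w = b @ a" using w by (rule rotations_obtain)
  have len: "length w = z + length v" using rotations_length[OF w] by simp
  consider (empty) "a = [] \<or> b = []" | (short) k where "0 < k" "k \<le> z" "a = zeros k" "b = zeros (z - k) @ v"
    | (long) c where "v = c @ b" "c \<noteq> []" "b \<noteq> []" "a = zeros z @ c"
  proof (cases "length a \<le> z")
    case True
    then have "a = zeros (length a)" using ab(1)
      by (metis append_eq_append_conv_if length_replicate take_replicate min.absorb1)
    moreover have "b = zeros (z - length a) @ v" using ab(1) True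
      by (metis append_eq_append_conv_if drop_replicate length_replicate)
    ultimately show ?thesis using that(1,2) True by (metis gr_zeroI length_0_conv)
  next
    case False
    then obtain c where "a = zeros z @ c" "v = c @ b" using ab(1)
      by (auto simp: append_eq_append_conv2 dest: arg_cong[of _ _ length])
    then show ?thesis using that(1,3) False by auto
  qed
  then show ?thesis
  proof cases
    case empty then show ?thesis using ab by auto
  next
    case short
    obtain v' where "v = True # v'" using v by (cases v) (auto simp: one_ended_def)
    then have "w = zeros (z - k) @ True # v' @ a" using short ab by simp
    then show ?thesis using zeros_less_zeros_append[of "z - k" z v] short by (simp add: less_imp_le)
  next
    case long
    have "take z w \<noteq> zeros z"
    proof
      assume t: "take z w = zeros z"
      show False
      proof (cases "length b \<ge> z")
        case True
        then have "take z b = zeros z" using t ab by simp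
        then have "v = c @ zeros z @ drop z b" using long by (metis append_take_drop_id)
        then show False using r by (auto simp: no_run_def)
      next
        case False
        then have "set b \<subseteq> set (take z w)" using ab by auto
        moreover have "last b" using v long unfolding one_ended_def by simp
        then have "True \<in> set b" using last_in_set[OF long(3)] by simp
        ultimately show False using t by auto
      qed
    qed
    then show ?thesis using zeros_append_less len by (simp add: less_imp_le)
  qed
qed

text \<open>By the same argument the least rotation of the reversal is
  \<open>zeros z @ rev v\<close>, so only the two blocks remain to be compared.\<close>

lemma block_in_asym_bracelets:
  assumes v: "one_ended v" and r: "no_run z v"
  shows "zeros z @ v \<in> asym_bracelets n \<longleftrightarrow> n = z + length v \<and> v < rev v"
proof -
  have rot: "zeros z @ rev v \<in> rotations (rev (zeros z @ v))"
    using append_rotations[of "zeros z" "rev v"] by simp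
  have *: "zeros z @ rev v \<le> w" if "w \<in> rotations (rev (zeros z @ v))" for w
    using that block_necklace[of "rev v" z w] v r rotations_eq[OF rot]
    by (simp add: one_ended_rev no_run_rev)
  have "zeros z @ v < zeros z @ rev v \<longleftrightarrow> v < rev v" by (simp add: lex_append_less)
  then show ?thesis unfolding asym_bracelets_iff
    using block_necklace[OF v r] * rot by (auto intro: order_less_le_trans)
qed

lemma necklace_of_block:
  assumes "one_ended v" "no_run z v" "w \<in> rotations (zeros z @ v)"
  shows "necklace_of w = zeros z @ v"
  using assms block_necklace rotations_eq[OF assms(3)]
  by (intro necklace_of_eq) (auto intro: rotations_sym)

section \<open>The shape of an asymmetric bracelet\<close>

lemma leading_zeros_decomp:
  assumes "True \<in> set \<alpha>"
  obtains s y where "\<alpha> = zeros s @ True # y"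
  using split_list_first[OF assms] by (metis (full_types) replicate_length_same)

lemma trailing_zeros_decomp:
  assumes "True \<in> set \<alpha>"
  obtains s y where "\<alpha> = y @ True # zeros s"
  using split_list_last[OF assms] by (metis (full_types) replicate_length_same)

lemma trailing_ones_decomp:
  assumes "False \<in> set \<alpha>"
  obtains s y where "\<alpha> = y @ False # ones s"
  using split_list_last[OF assms] by (metis (full_types) replicate_length_same)

lemma leading_ones_decomp:
  assumes "False \<in> set \<alpha>"
  obtains s y where "\<alpha> = ones s @ False # y"
  using split_list_first[OF assms] by (metis (full_types) replicate_length_same)

lemma asym_bracelet_not_constant:
  assumes "\<alpha> \<in> asym_bracelets n" shows "True \<in> set \<alpha>" "False \<in> set \<alpha>"
proof -
  have *: "rev \<alpha> \<noteq> \<alpha>" using assms rotations_self unfolding asym_bracelets_iff by force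
  show "True \<in> set \<alpha>" using * by (metis (full_types) replicate_length_same rev_replicate)
  show "False \<in> set \<alpha>" using * by (metis (full_types) replicate_length_same rev_replicate)
qed

lemma necklace_no_run:
  assumes "\<forall>\<beta>\<in>rotations (zeros s @ True # u). zeros s @ True # u \<le> \<beta>"
  shows "no_run (Suc s) (True # u)"
  unfolding no_run_def
proof (intro notI, elim exE)
  fix a b assume "True # u = a @ zeros (Suc s) @ b"
  then have "zeros (Suc s) @ b @ zeros s @ a \<in> rotations (zeros s @ True # u)"
    using append_rotations[of "zeros (Suc s) @ b" "zeros s @ a"] by simp
  then show False using assms zeros_less_zeros_append[of s "Suc s" "b @ zeros s @ a" u] by force
qed

text \<open>Each claim comes from one rotation: one that starts with a 0, one that moves a final 0
  to the front, one that moves a longer run to the front, and, for \<open>y < rev y\<close>, the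
  rotation of the reversal that starts with the same zeros. A run of exactly \<open>s\<close> zeros
  may recur inside \<open>y\<close>.\<close>

lemma asym_bracelet_decomp:
  assumes "\<alpha> \<in> asym_bracelets n"
  obtains s y where "\<alpha> = zeros s @ y" "s \<ge> 1" "one_ended y" "no_run (Suc s) y" "y < rev y"
    "n = s + length y"
proof -
  have nk: "\<And>\<beta>. \<beta>\<in>rotations \<alpha> \<Longrightarrow> \<alpha> \<le> \<beta>" and br: "\<And>\<beta>. \<beta>\<in>rotations (rev \<alpha>) \<Longrightarrow> \<alpha> < \<beta>"
    using assms by (auto simp: asym_bracelets_iff)
  obtain s u where a: "\<alpha> = zeros s @ True # u" using asym_bracelet_not_constant(1)[OF assms] by (rule leading_zeros_decomp)
  have s: "s \<ge> 1"
  proof (rule ccontr)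
    assume "\<not> s \<ge> 1"
    then have a0: "\<alpha> = True # u" using a by (cases s) auto
    obtain p q where "\<alpha> = p @ False # q" using asym_bracelet_not_constant(2)[OF assms] by (meson split_list)
    then have "False # q @ p \<in> rotations \<alpha>" using append_rotations[of "False # q" p] by simp
    then show False using nk[of "False # q @ p"] a0 by simp
  qed
  have l: "last (True # u)"
  proof (rule ccontr)
    assume "\<not> last (True # u)"
    then have "True # u = butlast (True # u) @ [False]"
      by (metis append_butlast_last_id list.distinct(1))
    then have "\<alpha> = (zeros s @ butlast (True # u)) @ [False]" using a by simp
    then have "[False] @ zeros s @ butlast (True # u) \<in> rotations \<alpha>" by (metis append_rotations)
    then have "zeros (Suc s) @ butlast (True # u) \<in> rotations \<alpha>" by simp
    then show False using nk zeros_less_zeros_append[of s "Suc s" "butlast (True # u)" u] a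
      using linorder_not_less by blast
  qed
  have r: "no_run (Suc s) (True # u)" using necklace_no_run nk a by auto
  have "zeros s @ rev (True # u) \<in> rotations (rev \<alpha>)"
    using append_rotations[of "zeros s" "rev (True # u)"] a by simp
  then have "True # u < rev (True # u)" using br[of "zeros s @ rev (True # u)"] a by (simp add: lex_append_less)
  then show ?thesis using that[of s "True # u"] a s l r assms by (auto simp: one_ended_def asym_bracelets_iff)
qed

lemma first_one_eq: "first_one (zeros s @ True # u) = zeros (Suc s) @ u"
proof -
  have "(LEAST i. i < length (zeros s @ True # u) \<and> (zeros s @ True # u) ! i) = s"
    by (rule Least_equality) (auto simp: nth_append split: if_splits)
  then show ?thesis unfolding first_one_def
    by (simp add: list_update_append replicate_app_Cons_same)
qed

lemma last_zero_eq: "last_zero (x @ False # ones t) = x @ True # ones t"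
proof -
  have "(GREATEST i. i < length (x @ False # ones t) \<and> \<not> (x @ False # ones t) ! i) = length x"
  proof (rule Greatest_equality)
    fix y assume "y < length (x @ False # ones t) \<and> \<not> (x @ False # ones t) ! y"
    then show "y \<le> length x"
      by (cases "y \<le> length x") (auto simp: nth_append nth_Cons')
  qed auto
  then show ?thesis unfolding last_zero_def by simp
qed

section \<open>The parent of an asymmetric bracelet\<close>

text \<open>\<open>p\<close> and \<open>q\<close> count the zeros that join the initial run when the
  first or the last 1 is erased. Without an inner 1 the string would be a palindrome, so
  \<open>x\<close> exists.\<close>

lemma one_ended_inner:
  assumes "one_ended y" "y < rev y"
  obtains p q x where "y = True # zeros p @ x @ zeros q @ [True]" "one_ended x"
proof -
  obtain y' where y': "y = True # y'" using assms(1) by (cases y) (auto simp: one_ended_def)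
  have "y' \<noteq> []" using y' assms(2) by auto
  then obtain u where u: "y = True # u @ [True]" using assms(1) y'
    by (cases y' rule: rev_cases) (auto simp: one_ended_def)
  have "True \<in> set u"
  proof (rule ccontr)
    assume "True \<notin> set u"
    then have "u = zeros (length u)" by (metis (full_types) replicate_length_same)
    then have "rev u = u" by (metis rev_replicate)
    then show False using assms(2) u by simp
  qed
  then obtain p w where w: "u = zeros p @ True # w" by (rule leading_zeros_decomp)
  have "True \<in> set (True # w)" by simp
  then obtain q x where x: "True # w = x @ True # zeros q" by (rule trailing_zeros_decomp)
  have "one_ended (x @ [True])" using x by (cases x) (auto simp: one_ended_def)
  moreover have "y = True # zeros p @ (x @ [True]) @ zeros q @ [True]" using u w x by simp
  ultimately show ?thesis using that by blast
qed

text \<open>Erasing the 1 creates a run of \<open>Suc (s + p)\<close> zeros, while \<open>v\<close>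
  keeps runs of at most \<open>s\<close>. The run is therefore the unique longest one and membership
  is decided by the block alone.\<close>

lemma first_one_block:
  assumes "one_ended v" "no_run (Suc s) (True # zeros p @ v)"
  shows "first_one (zeros s @ True # zeros p @ v) = zeros (Suc (s + p)) @ v"
    and "zeros (Suc (s + p)) @ v \<in> asym_bracelets n \<longleftrightarrow> n = Suc (s + p) + length v \<and> v < rev v"
proof -
  show "first_one (zeros s @ True # zeros p @ v) = zeros (Suc (s + p)) @ v"
    by (simp add: first_one_eq replicate_add)
  have "no_run (Suc s) v" using assms(2) no_run_infix[of _ "True # zeros p" v "[]"] by simp
  then show "zeros (Suc (s + p)) @ v \<in> asym_bracelets n \<longleftrightarrow> n = Suc (s + p) + length v \<and> v < rev v"
    by (intro block_in_asym_bracelets[OF assms(1)] no_run_mono[of "Suc s" v "Suc (s+p)"]) simp_all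
qed

text \<open>As for the first 1, except that the new zeros stand at the end and join the initial run
  only cyclically; the necklace rotates them to the front.\<close>

lemma last_one_block:
  assumes "one_ended v" "no_run (Suc s) (v @ zeros q @ [True])"
  shows "last_one (zeros s @ v @ zeros q @ [True]) = zeros (Suc (s + q)) @ v"
    and "zeros (Suc (s + q)) @ v \<in> asym_bracelets n \<longleftrightarrow> n = Suc (s + q) + length v \<and> v < rev v"
proof -
  have nr: "no_run (Suc (s + q)) v"
    using assms(2) no_run_infix[of _ "[]" v] no_run_mono[of "Suc s" v "Suc (s+q)"] by simp
  have "zeros s @ v @ zeros q @ [False] = (zeros s @ v) @ zeros (Suc q)" 
    by (simp add: replicate_append_same)
  moreover have "(zeros s @ v) @ zeros (Suc q) \<in> rotations (zeros (Suc q) @ zeros s @ v)"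
    by (rule append_rotations)
  moreover have "zeros (Suc q) @ zeros s @ v = zeros (Suc (s + q)) @ v"
    by (metis add.commute add_Suc append.assoc replicate_add)
  ultimately have "zeros s @ v @ zeros q @ [False] \<in> rotations (zeros (Suc (s+q)) @ v)" by metis
  then show "last_one (zeros s @ v @ zeros q @ [True]) = zeros (Suc (s + q)) @ v"
    using necklace_of_block[OF assms(1) nr] by (simp add: last_one_def butlast_append)
  show "zeros (Suc (s + q)) @ v \<in> asym_bracelets n \<longleftrightarrow> n = Suc (s + q) + length v \<and> v < rev v"
    using block_in_asym_bracelets[OF assms(1) nr] .
qed

section \<open>The last-zero operation\<close>

lemma all_ones:
  assumes "length (filter id u) = length u" shows "u = ones (length u)"
proof -
  have "\<forall>x\<in>set u. x" using assms by (metis filter_id_conv id_apply length_filter_less less_irrefl)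
  then show ?thesis by (metis (full_types) replicate_length_same)
qed

lemma ones_le_imp_eq: "ones (length u) \<le> (u :: bool list) \<Longrightarrow> u = ones (length u)"
  by (induction u) auto

text \<open>Raising the last 0 of a string and some 0 of a string above it preserves the order; the numbers of
  ones must agree because both strings may first differ at that last 0.\<close>
lemma flip_last_zero_le:
  assumes le: "x @ False # ones t \<le> p @ False # r"
    and len: "length (x @ False # ones t) = length (p @ False # r)"
    and cnt: "length (filter id (x @ False # ones t)) = length (filter id (p @ False # r))"
  shows "x @ True # ones t \<le> p @ True # r"
    and "x @ True # ones t = p @ True # r \<Longrightarrow> x @ False # ones t \<noteq> p @ False # r \<Longrightarrow>
      \<exists>a b. t = Suc (a + b) \<and> p = x @ True # ones a \<and> r = ones b"
proof -
  have "x @ True # ones t \<le> p @ True # r \<and> (x @ True # ones t = p @ True # r \<longrightarrow> x @ False # ones t \<noteq> p @ False # r \<longrightarrow>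
      (\<exists>a b. t = Suc (a + b) \<and> p = x @ True # ones a \<and> r = ones b))"
  proof (cases "length p" "length x" rule: linorder_cases)
    case equal
    then show ?thesis using le by (auto simp: lex_append_le)
  next
    \<comment> \<open>The raised 0 of the upper string lies inside \<open>x\<close>; afterwards the
      strings differ at that place or before it.\<close>
    case less
    define x1 c x2 where "x1 = take (length p) x" and "c = x ! length p" and "x2 = drop (Suc (length p)) x"
    have x: "x = x1 @ c # x2" using less unfolding x1_def c_def x2_def by (simp add: id_take_nth_drop)
    have l1: "length x1 = length p" using less by (simp add: x1_def)
    have "x1 < p \<or> x1 = p \<and> \<not> c" using le x l1 by (auto simp: lex_append_le)
    then have "x @ True # ones t < p @ True # r" using x l1 by (auto simp: lex_append_less)
    then show ?thesis by auto
  next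
    case greater
    define p1 c p2 where "p1 = take (length x) p" and "c = p ! length x" and "p2 = drop (Suc (length x)) p"
    have p: "p = p1 @ c # p2" using greater unfolding p1_def c_def p2_def by (simp add: id_take_nth_drop)
    have l1: "length p1 = length x" using greater by (simp add: p1_def)
    have "x < p1 \<or> x = p1 \<and> False # ones t \<le> c # p2 @ False # r" using le p l1 by (auto simp: lex_append_le)
    then show ?thesis
    proof
      assume "x < p1" 
      then have "x @ True # ones t < p @ True # r" using p l1 by (auto simp: lex_append_less)
      then show ?thesis by auto
    next
      \<comment> \<open>\<open>c\<close> must be 1, and then the equal numbers of ones leave the
        displayed 0 as the only 0 of the upper string after \<open>x\<close>. Raising it makes both
        strings equal to \<open>x\<close> followed by ones.\<close>
      assume h: "x = p1 \<and> False # ones t \<le> c # p2 @ False # r"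
      have lt: "t = length (p2 @ False # r)" using len p h by simp
      have c
      proof (rule ccontr)
        assume "\<not> c"
        then have "ones t \<le> p2 @ False # r" using h by simp
        then have "p2 @ False # r = ones t" using ones_le_imp_eq[of "p2 @ False # r"] lt by simp
        then have "False \<in> set (ones t)" by (metis in_set_conv_decomp)
        then show False by simp
      qed
      then have "length (filter id (p2 @ r)) = length (p2 @ r)" using cnt p h lt by auto
      then have e: "p2 @ r = ones (length p2 + length r)" using all_ones[of "p2 @ r"] by simp
      then have e2: "p2 = ones (length p2)" "r = ones (length r)"
        by (auto simp: replicate_add append_eq_append_conv)
      moreover have t: "t = Suc (length p2 + length r)" using lt by simp
      ultimately have "ones t = p2 @ True # r"
        by (metis add_Suc_right replicate_Suc replicate_add)
      then show ?thesis using h p \<open>c\<close> e2 t by auto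
    qed
  qed
  then show "x @ True # ones t \<le> p @ True # r"
    and "x @ True # ones t = p @ True # r \<Longrightarrow> x @ False # ones t \<noteq> p @ False # r \<Longrightarrow>
      \<exists>a b. t = Suc (a + b) \<and> p = x @ True # ones a \<and> r = ones b" by auto
qed

text \<open>Rotating moves the middle letter along, so changing it commutes with rotating. This
  pulls a rotation of the raised string back to one of the original.\<close>

lemma rotations_flip:
  assumes "\<beta> \<in> rotations (x @ c # u)"
  obtains p r where "\<beta> = p @ c # r" "p @ d # r \<in> rotations (x @ d # u)"
proof -
  obtain a b where ab: "x @ c # u = a @ b" "\<beta> = b @ a" using assms by (rule rotations_obtain)
  then consider (l) a' where "a = x @ c # a'" "u = a' @ b" | (r) b' where "b = b' @ c # u" "x = a @ b'"
    by (auto simp: append_eq_append_conv2 Cons_eq_append_conv)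
  then show ?thesis
  proof cases
    case l
    then show ?thesis using that[of "b @ x" a'] ab append_rotations[of b "x @ d # a'"] by simp
  next
    case r
    then show ?thesis using that[of b' "u @ a"] ab append_rotations[of "b' @ d # u" a] by simp
  qed
qed

lemma filter_rotations: "\<beta> \<in> rotations \<alpha> \<Longrightarrow> length (filter P \<beta>) = length (filter P \<alpha>)"
  by (auto elim!: rotations_obtain)

text \<open>Rotations of the raised string and of its reversal arise from those of the original by
  raising one 0, so \<open>flip_last_zero_le\<close> carries the inequalities over. The second
  alternative is its equality case, the only way in which strictness against the reversal is
  lost.\<close>

lemma last_zero_asym:
  assumes A: "x @ False # ones t \<in> asym_bracelets n"
  shows "x @ True # ones t \<in> asym_bracelets n
    \<or> (\<exists>a b. t = Suc (a + b) \<and> x @ True # ones a @ False # ones b \<in> rotations (rev (x @ False # ones t)))"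
proof (rule disjCI)
  let ?a = "x @ False # ones t" and ?b = "x @ True # ones t"
  assume no: "\<not> (\<exists>a b. t = Suc (a + b) \<and> x @ True # ones a @ False # ones b \<in> rotations (rev ?a))"
  have A': "length ?a = n" "\<And>\<beta>. \<beta>\<in>rotations ?a \<Longrightarrow> ?a \<le> \<beta>" "\<And>\<beta>. \<beta>\<in>rotations (rev ?a) \<Longrightarrow> ?a < \<beta>"
    using A by (auto simp: asym_bracelets_iff)
  have 1: "?b \<le> \<beta>" if h: "\<beta> \<in> rotations ?b" for \<beta>
  proof -
    obtain p r where pr: "\<beta> = p @ True # r" "p @ False # r \<in> rotations ?a"
      using rotations_flip[OF h] by metis
    show ?thesis unfolding pr(1)
      by (rule flip_last_zero_le(1)) (use A'(2)[OF pr(2)] rotations_length[OF pr(2)] filter_rotations[OF pr(2), of id] in auto)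
  qed
  have 2: "?b < \<beta>" if h: "\<beta> \<in> rotations (rev ?b)" for \<beta>
  proof -
    have "\<beta> \<in> rotations (rev (ones t) @ True # rev x)" using h by simp
    then obtain p r where pr: "\<beta> = p @ True # r" "p @ False # r \<in> rotations (rev (ones t) @ False # rev x)"
      by (rule rotations_flip[of _ _ _ _ False]) 
    then have pr2: "p @ False # r \<in> rotations (rev ?a)" by simp
    have lt: "?a < p @ False # r" using A'(3)[OF pr2] .
    have len: "length ?a = length (p @ False # r)" using rotations_length[OF pr2] by simp
    have cnt: "length (filter id ?a) = length (filter id (p @ False # r))"
      using filter_rotations[OF pr2, of id] by (simp add: rev_filter[symmetric])
    have "?b \<le> \<beta>" unfolding pr(1) using flip_last_zero_le(1) lt len cnt less_imp_le by blast
    moreover have "?b \<noteq> \<beta>"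
    proof
      assume "?b = \<beta>"
      then obtain a b where "t = Suc (a + b)" "p = x @ True # ones a" "r = ones b"
        using flip_last_zero_le(2)[OF less_imp_le[OF lt] len cnt] pr(1) lt by (metis less_irrefl)
      then show False using no pr2 by auto
    qed
    ultimately show ?thesis by simp
  qed
  show "?b \<in> asym_bracelets n" using 1 2 A'(1) by (auto simp: asym_bracelets_iff)
qed

text \<open>The symmetry is a reflection; it must exchange the two positions in which the string and
  its image differ, which determines its axis.\<close>
lemma adjacent_swap_reflection:
  assumes h: "x @ [True, False, True] \<in> rotations (rev (x @ [False, True, True]))"
    and len: "length x \<ge> 3"
  obtains W where "x = W @ [True]" "rev W = W"
proof -
  let ?a = "x @ [False, True, True]" and ?r = "x @ [True, False, True]"
  define n where "n = length ?a"
  have n: "n = length x + 3" by (simp add: n_def)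
  have "?r \<in> (\<lambda>k. rotate k (rev ?a)) ` {..<n}" using h rotations_image[of "rev ?a"] unfolding n_def by (simp del: rev_append)
  then obtain k where k: "k < n" "?r = rotate k (rev ?a)" by auto
  \<comment> \<open>Reversing and then rotating reflects the positions; \<open>ff\<close> below
    shows that this is an involution.\<close>
  define f where "f i = n - 1 - (i + k) mod n" for i
  have rf: "?r ! i = ?a ! f i" if "i < n" for i
  proof -
    have "?r ! i = rev ?a ! ((i + k) mod n)" using k(2) nth_rotate[of i "rev ?a" k] that n by (simp add: add.commute)
    moreover have "(i + k) mod n < n" using n by simp
    ultimately show ?thesis unfolding f_def using rev_nth[of "(i+k) mod n" ?a] n_def by (simp del: rev_append add: algebra_simps)
  qed
  have flt: "f i < n" for i using n by (simp add: f_def)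
  have ff: "f (f i) = i" if "i < n" for i
  proof (cases "i + k < n")
    case True
    then have "f i = n - 1 - (i + k)" by (simp add: f_def)
    then have "f i + k = n - 1 - i" using True by simp
    then show ?thesis using that unfolding f_def by simp
  next
    case False
    then have "(i + k) mod n = i + k - n" using that k(1) by (simp add: le_mod_geq)
    then have "f i + k = n + (n - 1 - i)" using False that k(1) unfolding f_def by simp
    then have "(f i + k) mod n = (n - 1 - i) mod n" by (metis mod_add_self1)
    then have "(f i + k) mod n = n - 1 - i" using that by simp
    then show ?thesis using that unfolding f_def by simp
  qed
  have a0: "\<not> ?a ! length x" "?r ! length x" by auto
  have same: "?r ! i = ?a ! i" if "i < n" "i \<noteq> length x" "i \<noteq> length x + 1" for i
    using that n by (auto simp: nth_append nth_Cons' numeral_eq_Suc split: if_splits)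
  have "f (length x) = length x + 1"
  proof (rule ccontr)
    assume ne: "f (length x) \<noteq> length x + 1"
    have a1: "?a ! f (length x)" using rf[of "length x"] a0 n by simp
    then have "f (length x) \<noteq> length x" using a0 by metis
    then have "?r ! f (length x)" using same[of "f (length x)"] a1 ne flt by simp
    then have "?a ! f (f (length x))" using rf flt by metis
    then show False using ff[of "length x"] a0 n by simp
  qed
  \<comment> \<open>Since \<open>n = length x + 3\<close>, this congruence leaves 4 as the only
    possible shift.\<close>
  then have "(length x + k) mod n = 1" using n mod_less_divisor[of n "length x + k"] unfolding f_def by linarith
  then have k4: "k = 4"
  proof (cases "length x + k < n")
    case True
    then show ?thesis using \<open>(length x + k) mod n = 1\<close> len by simp
  next
    case False
    then have "(length x + k) mod n = length x + k - n" using k(1) n by (simp add: le_mod_geq)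
    then show ?thesis using \<open>(length x + k) mod n = 1\<close> n False by linarith
  qed
  obtain W c where W: "x = W @ [c]" using len by (cases x rule: rev_cases) auto
  have "rev ?a = [True, True, False, c] @ rev W" using W by simp
  moreover have "length [True, True, False, c] = 4" by simp
  ultimately have "rotate 4 (rev ?a) = rev W @ [True, True, False, c]"
    by (metis rotate_append)
  then have "W @ [c, True, False, True] = rev W @ [True, True, False, c]" using k(2) k4 W by simp
  then have "W = rev W" "c" by auto
  then show ?thesis using that W by auto
qed

text \<open>\<open>lo\<close> gives \<open>p = 1\<close> and \<open>fo\<close> makes
  \<open>x\<close> begin with 11, so the string begins with \<open>zeros s\<close> and 1011,
  followed by a run of \<open>j\<close> zeros. The palindrome \<open>W\<close> repeats
  \<open>zeros s\<close> at its end, again before 1011. Comparing with the rotation that starts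
  there gives \<open>s <= j\<close>, while \<open>fo\<close> gives \<open>j <= 1\<close>. The
  remaining string begins with 0101101 but has a rotation that begins with 0101011.\<close>

lemma no_swap_reflection:
  assumes a: "W @ [True, False, True, True] = zeros s @ True # zeros p @ x @ [True]"
    and W: "rev W = W" "True \<in> set W" and s: "s \<ge> 1" and p: "p \<ge> 1" and x: "one_ended x"
    and nk: "\<And>\<beta>. \<beta> \<in> rotations (W @ [True, False, True, True]) \<Longrightarrow> W @ [True, False, True, True] \<le> \<beta>"
    and fo: "True # rev x \<le> x @ [True]"
    and lo: "rev x @ zeros p @ [True] \<le> True # zeros p @ x"
  shows False
proof -
  obtain s' W' where "W = zeros s' @ True # W'" using W(2) by (rule leading_zeros_decomp)
  moreover have "s' = s"
  proof -
    have "takeWhile Not (W @ [True, False, True, True]) = zeros s'" using calculation by (simp add: takeWhile_append)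
    moreover have "takeWhile Not (zeros s @ True # zeros p @ x @ [True]) = zeros s" by (simp add: takeWhile_append)
    ultimately show ?thesis using a by (metis length_replicate)
  qed
  ultimately have W': "W = zeros s @ True # W'" by simp
  then have e1: "W' @ [True, False, True] = zeros p @ x" using a by simp
  have "rev x @ zeros p = [True, False, True] @ rev W'"
    using arg_cong[OF e1, of rev] by simp
  then have "[True, False, True] @ rev W' @ [True] \<le> True # zeros p @ x" using lo by (metis append.assoc)
  then have p1: "p = 1" using p zeros_less_zeros_append[of 1 p x "rev W' @ [True]"]
    by (cases "p = 1") (auto simp: not_le[symmetric])
  have "W' \<noteq> []" using W(1) W' s by (cases s) auto
  then obtain W'' where W'': "W' = False # W''" "x = W'' @ [True, False, True]" using e1 p1 by (cases W') auto
  have rx: "True # rev x = [True, True, False, True] @ rev W''" using W'' by simp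
  obtain x2 where x2: "x = True # True # x2"
  proof -
    have "length x \<ge> 2" using W''(2) by simp
    then obtain c d x2 where "x = c # d # x2" by (auto simp: numeral_2_eq_2 Suc_le_length_iff)
    then show ?thesis using that x fo rx by (auto simp: one_ended_def)
  qed
  have "True \<in> set (x2 @ [True])" by simp
  then obtain j e where j: "x2 @ [True] = zeros j @ True # e" by (rule leading_zeros_decomp)
  have al: "W @ [True, False, True, True] = (zeros s @ [True, False, True, True]) @ zeros j @ True # e"
    using a p1 x2 j by simp
  \<comment> \<open>The leading zeros of the palindrome \<open>W\<close> do not overlap its trailing
    zeros, since it contains a 1; this yields \<open>u\<close>.\<close>
  have WW: "rev W' @ [True] @ zeros s = zeros s @ True # W'" using W(1) W' by simp
  obtain u where u: "rev W' @ [True] = zeros s @ True # u"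
  proof -
    from WW have "(rev W' @ [True]) @ zeros s = zeros s @ True # W'" by simp
    then obtain us where "rev W' @ [True] = zeros s @ us \<and> us @ zeros s = True # W'
        \<or> (rev W' @ [True]) @ us = zeros s" unfolding append_eq_append_conv2[of "rev W' @ [True]"] by blast
    then consider "rev W' @ [True] = zeros s @ us" "us @ zeros s = True # W'"
      | "(rev W' @ [True]) @ us = zeros s" by blast
    then show ?thesis
    proof cases
      case 1
      then show ?thesis using that s by (cases us; cases s) auto
    next
      case 2
      then have "True \<in> set (zeros s)" by (metis Un_iff list.set_intros(1) set_append)
      then show ?thesis by simp
    qed
  qed
  \<comment> \<open>This rotation starts at the trailing zeros of \<open>W\<close>.\<close>
  have "(zeros s @ [True, False, True, True]) @ (rev W' @ [True]) \<in> rotations ((rev W' @ [True]) @ (zeros s @ [True, False, True, True]))"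
    by (rule append_rotations)
  then have "(zeros s @ [True, False, True, True]) @ (rev W' @ [True]) \<in> rotations (W @ [True, False, True, True])"
    using WW W' by (metis append.assoc)
  from nk[OF this] have "zeros j @ True # e \<le> zeros s @ True # u" unfolding al u by (simp add: lex_append_le)
  then have js: "j \<ge> s" using zeros_less_zeros_append[of j s "True # u" e] by (auto simp: not_le[symmetric])
  have "x @ [True] = True # True # zeros j @ True # e" using x2 j by simp
  then have "[False, True] @ rev W'' \<le> zeros j @ True # e" using fo rx by simp
  then have "j \<le> 1" using zeros_less_zeros_append[of 1 j "True # e" "rev W''"] by (auto simp: not_le[symmetric])
  then have s1: "s = 1" "j = 1" using s js by auto
  then have "W = rev W'' @ [False, True, False]" using W(1) W' W'' by (metis append_Cons append_Nil append.assoc replicate_0 replicate_Suc rev.simps One_nat_def)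
  \<comment> \<open>This rotation starts at the final 010 of \<open>W\<close> and falls below the
    string at the fifth letter.\<close>
  then have "[False, True, False, True, False, True, True] @ rev W'' \<in> rotations (W @ [True, False, True, True])"
    using append_rotations[of "[False, True, False, True, False, True, True]" "rev W''"] by simp
  from nk[OF this] show False unfolding al s1 by simp
qed


text \<open>It excludes the equality case of \<open>last_zero_asym\<close> with
  \<open>b = 0\<close>: the final 0 followed cyclically by \<open>zeros s\<close> is a run too long
  for a rotation of the reversal.\<close>

lemma last_zero_no_wrap:
  assumes A: "\<alpha> \<in> asym_bracelets n" and a: "\<alpha> = zeros s @ True # u"
    and w: "zeros s @ w @ [False] \<in> rotations (rev \<alpha>)"
  shows False
proof -
  have "zeros (Suc s) @ w \<in> rotations (zeros s @ w @ [False])"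
    using append_rotations[of "[False]" "zeros s @ w"] by simp
  then have "zeros (Suc s) @ w \<in> rotations (rev \<alpha>)" using w rotations_trans by blast
  then have "\<alpha> < zeros (Suc s) @ w" using A by (simp add: asym_bracelets_iff)
  then show False using zeros_less_zeros_append[of s "Suc s" w u] a by auto
qed

text \<open>1011 is the shortest string that starts and ends with 1 and precedes its
  reversal.\<close>

definition root_bracelet :: "nat \<Rightarrow> bool list" where
  "root_bracelet n = zeros (n - 4) @ [True, False, True, True]"

lemma last_zero_parent:
  assumes n: "n \<ge> 6" and A: "\<alpha> \<in> asym_bracelets n" and ne: "\<alpha> \<noteq> root_bracelet n"
    and FO: "first_one \<alpha> \<notin> asym_bracelets n" and LO: "last_one \<alpha> \<notin> asym_bracelets n"
  shows "last_zero \<alpha> \<in> asym_bracelets n" "last_one (last_zero \<alpha>) \<in> asym_bracelets n"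
proof -
  obtain s y where y: "\<alpha> = zeros s @ y" "s \<ge> 1" "one_ended y" "no_run (Suc s) y" "y < rev y" "n = s + length y"
    using asym_bracelet_decomp[OF A] by metis
  obtain p q x where x: "y = True # zeros p @ x @ zeros q @ [True]" "one_ended x"
    using one_ended_inner y by metis
  obtain x' where x': "x = True # x'" using x(2) by (cases x) (auto simp: one_ended_def)
  obtain x'' where x'': "rev x = True # x''" using x(2) unfolding one_ended_rev[of x, symmetric]
    by (cases "rev x") (auto simp: one_ended_def)
  have v1: "one_ended (x @ zeros q @ [True])" "one_ended (True # zeros p @ x)"
    using x by (auto simp: one_ended_def)
  have fo: "True # zeros q @ rev x \<le> x @ zeros q @ [True]"
    using FO first_one_block(1)[OF v1(1), of s p] first_one_block(2)[OF v1(1), of s p n] y x(1) by (auto simp: not_less)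
  have lo: "rev x @ zeros p @ [True] \<le> True # zeros p @ x"
    using LO last_one_block(1)[OF v1(2), of s q] last_one_block(2)[OF v1(2), of s q n] y x(1) by (auto simp: not_less)
  have yr: "zeros p @ x @ zeros q @ [True] < zeros q @ rev x @ zeros p @ [True]" using y(5) x(1) by simp
  have "q \<le> p" using yr zeros_less_zeros_append[of p q "rev x @ zeros p @ [True]" "x' @ zeros q @ [True]"] x'
    by (cases "q \<le> p") (auto simp: not_le)
  \<comment> \<open>For \<open>q = p\<close> the inequality \<open>y < rev y\<close> becomes
    \<open>x < rev x\<close>, and \<open>fo\<close> and \<open>lo\<close> then put
    \<open>True # zeros q @ rev x\<close> strictly below itself.\<close>
  moreover have "q \<noteq> p"
  proof
    assume q: "q = p"
    then have l: "x < rev x" using yr by (auto simp: lex_append_less)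
    then have "x @ zeros q @ [True] < rev x @ zeros q @ [True]" by (simp add: lex_append_less)
    moreover have "True # zeros q @ x < True # zeros q @ rev x" using l by (simp add: lex_append_less)
    ultimately show False using fo lo unfolding q by order
  qed
  ultimately have qp: "q < p" by simp
  have a: "\<alpha> = zeros s @ True # zeros p @ x @ zeros q @ [True]" using y x by simp
  \<comment> \<open>Erasing the last of the \<open>Suc t\<close> final ones lengthens the initial
    run by one and leaves the block \<open>Y @ ones t\<close>, so the second claim is the comparison
    \<open>less\<close>.\<close>
  have concl: "last_zero \<alpha> \<in> asym_bracelets n \<and> last_one (last_zero \<alpha>) \<in> asym_bracelets n"
    if t: "\<alpha> = zeros s @ Y @ False # ones t" "t \<ge> 1"
     and B: "zeros s @ Y @ True # ones t \<in> asym_bracelets n" and Y: "hd (Y @ ones t)" "Y \<noteq> []"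
     and less: "Y @ ones t < ones t @ rev Y" for Y t
  proof -
    have lz: "last_zero \<alpha> = zeros s @ Y @ True # ones t" using last_zero_eq[of "zeros s @ Y" t] t by simp
    obtain Y' where Y': "Y = True # Y'" using Y by (cases Y) auto
    have "zeros s @ Y @ True # ones t = zeros s @ True # (Y' @ True # ones t)" using Y' by simp
    then have nr: "no_run (Suc s) (Y @ True # ones t)" using necklace_no_run B unfolding asym_bracelets_iff
      by (metis Y' append_Cons)
    have e: "Y @ True # ones t = (Y @ ones t) @ zeros 0 @ [True]" by (simp add: replicate_append_same)
    have oe: "one_ended (Y @ ones t)" using t Y Y' by (cases t) (auto simp: one_ended_def)
    have "last_one (last_zero \<alpha>) = zeros (Suc s) @ Y @ ones t"
      using last_one_block(1)[OF oe, of s 0] nr lz e by simp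
    moreover have "zeros (Suc s) @ Y @ ones t \<in> asym_bracelets n"
      using last_one_block(2)[OF oe, of s 0 n] nr e less t A by (auto simp: asym_bracelets_iff)
    ultimately show ?thesis using B lz by simp
  qed
  have "last_zero \<alpha> \<in> asym_bracelets n \<and> last_one (last_zero \<alpha>) \<in> asym_bracelets n"
  proof (cases "q = 0")
    case False
    then obtain q' where q': "q = Suc q'" by (cases q) auto
    define Y where "Y = True # zeros p @ x @ zeros q'"
    have t: "\<alpha> = zeros s @ Y @ False # ones 1" using a q' by (simp add: Y_def replicate_append_same)
    have "zeros s @ Y @ True # ones 1 \<in> asym_bracelets n"
    proof (rule ccontr)
      assume "\<not> ?thesis"
      then obtain r c where "1 = Suc (r + c)" "(zeros s @ Y) @ True # ones r @ False # ones c \<in> rotations (rev \<alpha>)"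
        using last_zero_asym[of "zeros s @ Y" 1 n] A t by auto
      then have "zeros s @ (Y @ [True]) @ [False] \<in> rotations (rev \<alpha>)" by simp
      then show False using last_zero_no_wrap[OF A] a by blast
    qed
    \<comment> \<open>The block has fewer zeros before its last 1 than after its first 1, so it
      precedes its reversal.\<close>
    moreover have "Y @ ones 1 < ones 1 @ rev Y"
      using zeros_less_zeros_append[of q' p "x @ zeros q' @ [True]" "x'' @ zeros p @ [True]"] qp q' x''
      by (simp add: Y_def)
    ultimately show ?thesis using concl[OF t] by (simp add: Y_def)
  next
    case True
    have p1: "p \<ge> 1" using qp by simp
    \<comment> \<open>The string ends in 11; a further 1 before that would contradict
      \<open>lo\<close> or \<open>p1\<close>.\<close>
    obtain Y where Y: "True # zeros p @ x = Y @ [False, True]"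
    proof (cases x'')
      case Nil
      then have "x = [True]" using x'' by (metis rev_singleton_conv)
      moreover obtain p' where "p = Suc p'" using p1 by (cases p) auto
      ultimately show ?thesis using that[of "True # zeros p'"] by (simp add: replicate_app_Cons_same)
    next
      case (Cons c x3)
      then have "\<not> c" using lo p1 x'' by (cases p) auto
      then have "x = rev x3 @ [False, True]" using Cons arg_cong[OF x'', of rev] by simp
      then show ?thesis using that[of "True # zeros p @ rev x3"] by simp
    qed
    obtain Y' where Y': "Y = True # Y'" using Y x' by (cases Y) auto
    have t: "\<alpha> = zeros s @ Y @ False # ones 2" using a True Y by (simp add: numeral_2_eq_2)
    have len: "length (zeros s @ Y) = n - 3" using A t by (auto simp: asym_bracelets_iff)
    have B: "zeros s @ Y @ True # ones 2 \<in> asym_bracelets n"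
    proof (rule ccontr)
      assume "\<not> ?thesis"
      then obtain r c where rc: "2 = Suc (r + c)" "(zeros s @ Y) @ True # ones r @ False # ones c \<in> rotations (rev \<alpha>)"
        using last_zero_asym[of "zeros s @ Y" 2 n] A t by auto
      show False
      proof (cases "c = 0")
        case True
        then have "r = 1" using rc(1) by simp
        then have "zeros s @ (Y @ [True, True]) @ [False] \<in> rotations (rev \<alpha>)" using rc(2) True by simp
        then show False using last_zero_no_wrap[OF A] a by blast
      next
        case False
        then have "r = 0" "c = 1" using rc by auto
        then have "(zeros s @ Y) @ [True, False, True] \<in> rotations (rev ((zeros s @ Y) @ [False, True, True]))"
          using rc t by (simp add: numeral_2_eq_2)
        then obtain W where W: "zeros s @ Y = W @ [True]" "rev W = W"
          using n len by (elim adjacent_swap_reflection) auto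
        have aW: "\<alpha> = W @ [True, False, True, True]" using t arg_cong[OF W(1), of "\<lambda>z. z @ [False, True, True]"] by (simp add: numeral_2_eq_2)
        have "True \<in> set W"
        proof (rule ccontr)
          assume "True \<notin> set W"
          then have "W = zeros (length W)" by (metis (full_types) replicate_length_same)
          then show False using ne aW A unfolding root_bracelet_def asym_bracelets_iff by auto
        qed
        then have TW: "True \<in> set W" .
        have nk: "W @ [True, False, True, True] \<le> \<beta>" if "\<beta> \<in> rotations (W @ [True, False, True, True])" for \<beta>
          using A that unfolding aW asym_bracelets_iff by blast
        have aeq: "W @ [True, False, True, True] = zeros s @ True # zeros p @ x @ [True]" using a aW \<open>q = 0\<close> by simp
        show False using no_swap_reflection[OF aeq W(2) TW y(2) p1 x(2) nk] fo lo \<open>q = 0\<close> by simp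
      qed
    qed
    have "Y' \<noteq> []"
    proof
      assume "Y' = []"
      then have "\<alpha> = root_bracelet n" using t Y' len by (auto simp: root_bracelet_def numeral_2_eq_2)
      then show False using ne by simp
    qed
    then obtain Y'' where "Y' = False # Y''" using Y Y' p1 by (cases Y'; cases p) auto
    then have "Y @ ones 2 < ones 2 @ rev Y" using Y' by (simp add: numeral_2_eq_2)
    then show ?thesis using concl[OF t _ B] Y' by simp
  qed
  then show "last_zero \<alpha> \<in> asym_bracelets n" "last_one (last_zero \<alpha>) \<in> asym_bracelets n" by auto
qed

section \<open>Effect of the operations on the initial run of zeros\<close>

definition leading_zeros :: "bool list \<Rightarrow> nat" where
  "leading_zeros \<alpha> = length (takeWhile Not \<alpha>)"

lemma leading_zeros_eq: "leading_zeros (zeros s @ True # u) = s"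
  by (simp add: leading_zeros_def takeWhile_append)

lemma leading_zeros_one_ended: "one_ended v \<Longrightarrow> leading_zeros (zeros s @ v) = s"
  using leading_zeros_eq by (cases v) (auto simp: one_ended_def)

lemma leading_zeros_first_one:
  assumes A: "\<alpha> \<in> asym_bracelets n" shows "leading_zeros \<alpha> < leading_zeros (first_one \<alpha>)"
proof -
  obtain s y where y: "\<alpha> = zeros s @ y" "one_ended y" "no_run (Suc s) y" "y < rev y"
    using asym_bracelet_decomp[OF A] by metis
  obtain p q x where x: "y = True # zeros p @ x @ zeros q @ [True]" "one_ended x"
    using one_ended_inner y by metis
  have v1: "one_ended (x @ zeros q @ [True])" using x by (auto simp: one_ended_def)
  have "first_one \<alpha> = zeros (Suc (s + p)) @ (x @ zeros q @ [True])"
    using first_one_block(1)[OF v1, of s p] y x by simp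
  then show ?thesis using leading_zeros_one_ended[OF v1, of "Suc (s+p)"] leading_zeros_one_ended[OF y(2), of s] y(1) by simp
qed

lemma leading_zeros_last_one:
  assumes A: "\<alpha> \<in> asym_bracelets n" shows "leading_zeros \<alpha> < leading_zeros (last_one \<alpha>)"
proof -
  obtain s y where y: "\<alpha> = zeros s @ y" "one_ended y" "no_run (Suc s) y" "y < rev y"
    using asym_bracelet_decomp[OF A] by metis
  obtain p q x where x: "y = True # zeros p @ x @ zeros q @ [True]" "one_ended x"
    using one_ended_inner y by metis
  have v1: "one_ended (True # zeros p @ x)" using x by (auto simp: one_ended_def)
  have "last_one \<alpha> = zeros (Suc (s + q)) @ (True # zeros p @ x)"
    using last_one_block(1)[OF v1, of s q] y x by simp
  then show ?thesis using leading_zeros_one_ended[OF v1, of "Suc (s+q)"] leading_zeros_one_ended[OF y(2), of s] y(1) by simp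
qed

lemma leading_zeros_last_zero:
  assumes A: "\<alpha> \<in> asym_bracelets n" shows "leading_zeros (last_zero \<alpha>) = leading_zeros \<alpha>"
proof -
  obtain s y where y: "\<alpha> = zeros s @ y" "one_ended y" "y < rev y"
    using asym_bracelet_decomp[OF A] by metis
  have "False \<in> set y"
  proof (rule ccontr)
    assume "False \<notin> set y"
    then have "y = ones (length y)" by (metis (full_types) replicate_length_same)
    then show False using y(3) by (metis less_irrefl rev_replicate)
  qed
  then obtain t z where z: "y = z @ False # ones t" by (rule trailing_ones_decomp)
  then obtain z' where z': "z = True # z'" using y(2) by (cases z) (auto simp: one_ended_def)
  have "last_zero \<alpha> = zeros s @ True # (z' @ True # ones t)" using last_zero_eq[of "zeros s @ z" t] y z z' by simp
  moreover have "\<alpha> = zeros s @ True # (z' @ False # ones t)" using y z z' by simp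
  ultimately show ?thesis by (simp only: leading_zeros_eq)
qed

section \<open>Joining cycles\<close>

definition reaches :: "('a \<Rightarrow> 'a) \<Rightarrow> 'a \<Rightarrow> 'a \<Rightarrow> bool" where
  "reaches f x y \<longleftrightarrow> (\<exists>k. (f ^^ k) x = y)"

lemma reaches_refl: "reaches f x x"
  unfolding reaches_def by (rule exI[of _ 0]) simp

lemma reaches_trans: "reaches f x y \<Longrightarrow> reaches f y z \<Longrightarrow> reaches f x z"
  unfolding reaches_def by (metis funpow_add comp_apply)

lemma reaches_step: "reaches f x y \<Longrightarrow> reaches f x (f y)"
  unfolding reaches_def by (metis funpow.simps(2) comp_apply)

lemma funpow_closed: "f ` X \<subseteq> X \<Longrightarrow> x \<in> X \<Longrightarrow> (f ^^ k) x \<in> X"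
  by (induction k) auto

lemma funpow_inj_on: "inj_on f X \<Longrightarrow> f ` X \<subseteq> X \<Longrightarrow> inj_on (f ^^ k) X"
proof (induction k)
  case (Suc k)
  have "(f ^^ k) ` X \<subseteq> X" using funpow_closed[OF Suc(3)] by auto
  then have "inj_on f ((f ^^ k) ` X)" using Suc(2) inj_on_subset by blast
  then show ?case using comp_inj_on[of "f ^^ k" X f] Suc by (simp add: comp_def)
qed auto

text \<open>Finiteness forces a repetition, and injectivity on \<open>X\<close> cancels the common
  iterations.\<close>

lemma funpow_period:
  assumes "finite X" "inj_on f X" "f ` X \<subseteq> X" "x \<in> X"
  obtains p where "p > 0" "(f ^^ p) x = x"
proof -
  have "\<not> inj_on (\<lambda>k. (f ^^ k) x) (UNIV :: nat set)"
  proof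
    assume "inj_on (\<lambda>k. (f ^^ k) x) (UNIV :: nat set)"
    moreover have "(\<lambda>k. (f ^^ k) x) ` (UNIV :: nat set) \<subseteq> X" using funpow_closed[OF assms(3,4)] by auto
    ultimately have "finite (UNIV :: nat set)" using assms(1) by (metis finite_imageD finite_subset)
    then show False by simp
  qed
  then obtain i j where ij: "i < j" "(f ^^ i) x = (f ^^ j) x"
    unfolding inj_on_def by (metis linorder_neqE_nat)
  then have "(f ^^ i) x = (f ^^ i) ((f ^^ (j - i)) x)"
    by (metis add_diff_inverse_nat comp_apply funpow_add less_imp_not_less)
  then have "(f ^^ (j - i)) x = x"
    using funpow_inj_on[OF assms(2,3)] funpow_closed[OF assms(3,4)] assms(4) by (metis inj_on_def)
  then show ?thesis using that[of "j - i"] ij by simp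
qed

lemma funpow_multiple: "(f ^^ p) x = x \<Longrightarrow> (f ^^ (p * k)) x = x"
  by (induction k) (auto simp: funpow_add)

text \<open>The orbit is a cycle: after the first \<open>k\<close> steps, \<open>p * k - k\<close>
  further ones complete \<open>k\<close> whole rounds.\<close>

lemma reaches_sym:
  assumes "finite X" "inj_on f X" "f ` X \<subseteq> X" "x \<in> X" "reaches f x y"
  shows "reaches f y x"
proof -
  obtain k where k: "(f ^^ k) x = y" using assms(5) by (auto simp: reaches_def)
  obtain p where p: "p > 0" "(f ^^ p) x = x" using funpow_period[OF assms(1-4)] .
  have "k \<le> p * k" using p by simp
  then have "(f ^^ (p * k - k)) y = (f ^^ (p * k)) x"
    unfolding k[symmetric] by (metis comp_apply funpow_add le_add_diff_inverse2)
  then show ?thesis using funpow_multiple[OF p(2)] unfolding reaches_def by metis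
qed

text \<open>Starting from \<open>x'\<close>, the map \<open>h\<close> runs through the whole \<open>f\<close>-cycle of \<open>y'\<close>, and vice versa.\<close>
lemma cycle_join:
  assumes X: "finite X" "inj_on h X" "h ` X \<subseteq> X"
    and PQ: "P \<subseteq> X" "Q \<subseteq> X" "y' \<in> P" "x' \<in> Q" "P \<inter> Q = {}" "f ` P \<subseteq> P" "f ` Q \<subseteq> Q"
    and P: "\<And>z. z \<in> P \<Longrightarrow> reaches f (f y') z" and Q: "\<And>z. z \<in> Q \<Longrightarrow> reaches f (f x') z"
    and h: "h x' = f y'" "h y' = f x'" "\<And>z. z \<in> P \<union> Q \<Longrightarrow> z \<noteq> x' \<Longrightarrow> z \<noteq> y' \<Longrightarrow> h z = f z"
    and uw: "u \<in> P \<union> Q" "w \<in> P \<union> Q"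
  shows "reaches h u w"
proof -
  \<comment> \<open>Away from \<open>y\<close> the two maps agree. When the walk arrives at
    \<open>y\<close>, the next point on the cycle of \<open>f\<close> is \<open>f y\<close>, which
    \<open>h\<close> reaches from \<open>x\<close> in one step.\<close>
  have walk: "reaches h x z" if "z \<in> R" "y \<in> R" "f ` R \<subseteq> R" "\<And>z. z \<in> R \<Longrightarrow> reaches f (f y) z"
      "h x = f y" "\<And>z. z \<in> R \<Longrightarrow> z \<noteq> y \<Longrightarrow> h z = f z" for x y z R
  proof -
    have "reaches h x ((f ^^ k) (f y))" for k
    proof (induction k)
      case 0 then show ?case using that(5) reaches_step[OF reaches_refl, of h x] by simp
    next
      case (Suc k)
      let ?z = "(f ^^ k) (f y)"
      have zR: "?z \<in> R" using that(2,3) funpow_closed by (metis image_subset_iff)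
      show ?case
      proof (cases "?z = y")
        case True
        then show ?thesis using that(5) reaches_step[OF reaches_refl, of h x] by simp
      next
        case False
        then show ?thesis using reaches_step[OF Suc] that(6)[OF zR] by simp
      qed
    qed
    then show ?thesis using that(1,4) unfolding reaches_def by metis
  qed
  have xP: "reaches h x' z" if "z \<in> P" for z
  proof (rule walk[OF that PQ(3) PQ(6) P h(1)])
    show "h z = f z" if "z \<in> P" "z \<noteq> y'" for z using h(3)[of z] that PQ(4,5) by blast
  qed auto
  have yQ: "reaches h y' z" if "z \<in> Q" for z
  proof (rule walk[OF that PQ(4) PQ(7) Q h(2)])
    show "h z = f z" if "z \<in> Q" "z \<noteq> x'" for z using h(3)[of z] that PQ(3,5) by blast
  qed auto
  have x: "reaches h x' z" if "z \<in> P \<union> Q" for z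
    using that xP yQ reaches_trans[OF xP[OF PQ(3)]] by auto
  have "reaches h u x'" using reaches_sym[OF X _ x[OF uw(1)]] PQ by auto
  then show ?thesis using x[OF uw(2)] reaches_trans by metis
qed

section \<open>Universal cycles and orientability\<close>

lemma shift_funpow:
  assumes "length x = n" "k \<le> n"
  shows "\<exists>u. ((\<lambda>x. tl x @ [f x]) ^^ k) x = drop k x @ u \<and> length u = k"
  using assms(2)
proof (induction k)
  case (Suc k)
  then obtain u where u: "((\<lambda>x. tl x @ [f x]) ^^ k) x = drop k x @ u" "length u = k" by auto
  have "drop k x \<noteq> []" using Suc assms by simp
  then show ?case using u by (auto simp: drop_Suc tl_drop)
qed simp

lemma shift_funpow_hd:
  assumes "length x = n" "k < n"
  shows "hd (((\<lambda>x. tl x @ [f x]) ^^ k) x) = x ! k"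
proof -
  obtain u where "((\<lambda>x. tl x @ [f x]) ^^ k) x = drop k x @ u" using shift_funpow[of x n k f] assms by auto
  then show ?thesis using assms by (simp add: hd_drop_conv_nth)
qed

lemma orbit_enumeration:
  assumes X: "finite X" "inj_on f X" "f ` X \<subseteq> X" "x \<in> X" and c: "\<And>y. y \<in> X \<Longrightarrow> reaches f x y"
  shows "bij_betw (\<lambda>i. (f ^^ i) x) {..<card X} X" "(f ^^ card X) x = x"
proof -
  define p where "p = (LEAST p. p > 0 \<and> (f ^^ p) x = x)"
  have "\<exists>p. p > 0 \<and> (f ^^ p) x = x" using funpow_period[OF X] by metis
  then have p: "p > 0" "(f ^^ p) x = x" unfolding p_def by (metis (mono_tags, lifting) LeastI_ex)+
  have least: "p \<le> q" if "q > 0" "(f ^^ q) x = x" for q using that unfolding p_def by (simp add: Least_le)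
  have inj: "inj_on (\<lambda>i. (f ^^ i) x) {..<p}"
  proof (rule linorder_inj_onI')
    fix i j assume ij: "i \<in> {..<p}" "j \<in> {..<p}" "i < j"
    show "(f ^^ i) x \<noteq> (f ^^ j) x"
    proof
      assume "(f ^^ i) x = (f ^^ j) x"
      then have "(f ^^ i) x = (f ^^ i) ((f ^^ (j - i)) x)"
        by (metis add_diff_inverse_nat comp_apply funpow_add less_imp_not_less ij(3))
      then have "(f ^^ (j - i)) x = x"
        using funpow_inj_on[OF X(2,3)] funpow_closed[OF X(3,4)] X(4) by (metis inj_on_def)
      then show False using least[of "j - i"] ij by auto
    qed
  qed
  have img: "(\<lambda>i. (f ^^ i) x) ` {..<p} = X"
  proof
    show "(\<lambda>i. (f ^^ i) x) ` {..<p} \<subseteq> X" using funpow_closed[OF X(3,4)] by auto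
    show "X \<subseteq> (\<lambda>i. (f ^^ i) x) ` {..<p}"
    proof
      fix y assume "y \<in> X"
      then obtain k where k: "(f ^^ k) x = y" using c unfolding reaches_def by blast
      have "(f ^^ (k mod p)) x = y" using funpow_mod_eq[OF p(2)] k by metis
      then show "y \<in> (\<lambda>i. (f ^^ i) x) ` {..<p}" using p(1) by (intro image_eqI[of _ _ "k mod p"]) auto
    qed
  qed
  have "card X = p" using card_image[OF inj] img by simp
  then show "bij_betw (\<lambda>i. (f ^^ i) x) {..<card X} X" "(f ^^ card X) x = x"
    using inj img p(2) by (auto simp: bij_betw_def)
qed

text \<open>The cyclic sequence consists of the first letters of the states in the orbit. Letter
  \<open>k < n\<close> of a state comes to the front after \<open>k\<close> shifts, so the windows
  are the states themselves, even if the sequence is shorter than \<open>n\<close>.\<close>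

lemma universal_cycle_of_orbit:
  assumes n: "n \<ge> 1" and len: "\<And>y. y \<in> X \<Longrightarrow> length y = n"
    and X: "finite X" "inj_on (\<lambda>x. tl x @ [f x]) X" "(\<lambda>x. tl x @ [f x]) ` X \<subseteq> X" "x \<in> X"
    and c: "\<And>y. y \<in> X \<Longrightarrow> reaches (\<lambda>x. tl x @ [f x]) x y"
  obtains s where "universal_cycle n X s" "successor_rule n X s f"
proof -
  let ?F = "\<lambda>x. tl x @ [f x]"
  define N where "N = card X"
  have bij: "bij_betw (\<lambda>i. (?F ^^ i) x) {..<N} X" and per: "(?F ^^ N) x = x"
    using orbit_enumeration[OF X c] unfolding N_def by auto
  have N: "N > 0" using X by (auto simp: N_def card_gt_0_iff)
  define s where "s = map (\<lambda>i. hd ((?F ^^ i) x)) [0..<N]"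
  have ls: "length s = N" by (simp add: s_def)
  have inX: "(?F ^^ i) x \<in> X" for i using funpow_closed[OF X(3,4)] .
  have sn: "s ! (i mod N) = hd ((?F ^^ i) x)" for i
    using N funpow_mod_eq[OF per, of i] by (simp add: s_def)
  have sk: "s ! ((i + k) mod N) = ((?F ^^ i) x) ! k" if "k < n" for i k
  proof -
    have "(?F ^^ (i + k)) x = (?F ^^ k) ((?F ^^ i) x)"
      unfolding add.commute[of i] funpow_add by simp
    then show ?thesis using sn[of "i + k"] shift_funpow_hd[OF len[OF inX[of i]] that, of f] by simp
  qed
  have win: "window n s i = (?F ^^ i) x" for i
    unfolding window_def ls using sk len[OF inX] by (intro nth_equalityI) auto
  have "universal_cycle n X s" unfolding universal_cycle_def
    using ls bij bij_betw_cong[of "{..<N}" "window n s" "\<lambda>i. (?F ^^ i) x" X] win by (simp add: N_def)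
  moreover have "f \<alpha> = s ! ((i + n) mod length s)" if "window n s i = \<alpha>" for \<alpha> i
  proof -
    have "(i + n) = Suc i + (n - 1)" using n by simp
    then have "s ! ((i + n) mod N) = ((?F ^^ Suc i) x) ! (n - 1)" using sk[of "n - 1" "Suc i"] n by simp
    also have "(?F ^^ Suc i) x = ?F \<alpha>" using win[of i] that by simp
    also have "?F \<alpha> ! (n - 1) = f \<alpha>" using that win[of i] len[OF inX[of i]] n by (auto simp: nth_append)
    finally show ?thesis using ls by simp
  qed
  ultimately show ?thesis using that unfolding successor_rule_def by blast
qed

text \<open>The start is -(n + i) modulo \<open>N\<close>; the summand \<open>n * N\<close> prevents
  the subtraction from truncating.\<close>

lemma window_rev:
  assumes N: "length s = N" "N > 0" and i: "i < N"
  shows "window n (rev s) i = rev (window n s ((n * N + N - n - i) mod N))"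
proof (rule nth_equalityI)
  show "length (window n (rev s) i) = length (rev (window n s ((n * N + N - n - i) mod N)))" by (simp add: window_def)
  fix k assume "k < length (window n (rev s) i)"
  then have k: "k < n" by (simp add: window_def)
  define c d where "c = (i + k) mod N" and "d = ((n * N + N - n - i) mod N + (n - 1 - k)) mod N"
  have cd: "c < N" "d < N" using N by (auto simp: c_def d_def)
  have "n \<le> n * N" using N by simp
  then have e: "(i + k) + ((n * N + N - n - i) + (n - 1 - k)) = (N - 1) + n * N"
    using k i N by linarith
  have "(c + d) mod N = ((i + k) + ((n * N + N - n - i) + (n - 1 - k))) mod N"
    unfolding c_def d_def by (simp add: mod_add_eq mod_add_left_eq mod_add_right_eq)
  also have "\<dots> = N - 1" unfolding e mod_mult_self1 using N by simp
  finally have "(c + d) mod N = N - 1" .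
  then have "c + d = N - 1" using cd N by (cases "c + d < N") (auto simp: le_mod_geq)
  then have d: "d = N - 1 - c" by simp
  have "window n (rev s) i ! k = s ! (N - 1 - c)"
    using k cd N by (simp add: window_def c_def rev_nth)
  moreover have "rev (window n s ((n * N + N - n - i) mod N)) ! k = s ! d"
    using k N by (simp add: window_def rev_nth d_def)
  ultimately show "window n (rev s) i ! k = rev (window n s ((n * N + N - n - i) mod N)) ! k" using d by simp
qed

text \<open>The windows of the reversed sequence are the reversals of the forward windows, met in
  another order, so repetitions could only occur between \<open>X\<close> and its reversals.\<close>

lemma orientable_of_universal:
  assumes u: "universal_cycle n X s" and d: "X \<inter> rev ` X = {}"
  shows "orientable_sequence n s"
proof -
  define N where "N = length s"
  have bij: "bij_betw (window n s) {..<N} X" using u unfolding universal_cycle_def N_def by blast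
  define j where "j i = (n * N + N - n - i) mod N" for i
  have w: "window n (rev s) i = rev (window n s (j i))" "j i < N" if "i < N" for i
    using window_rev[of s N i n] that unfolding j_def N_def[symmetric] by simp_all
  have jinj: "inj_on j {..<N}"
  proof (rule linorder_inj_onI')
    fix i i' assume h: "i \<in> {..<N}" "i' \<in> {..<N}" "i < i'"
    show "j i \<noteq> j i'"
    proof
      assume eq: "j i = j i'"
      have "n \<le> n * N" using h by (cases N) auto
      then have "(n * N + N - n - i) - (n * N + N - n - i') = i' - i" "n * N + N - n - i' \<le> n * N + N - n - i"
        using h unfolding lessThan_iff by linarith+
      then have "N dvd i' - i" using eq mod_eq_dvd_iff_nat[of "n * N + N - n - i'" "n * N + N - n - i" N]
        unfolding j_def by metis
      then show False using h by (auto dest: dvd_imp_le)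
    qed
  qed
  have "distinct (map (window n s) [0..<N])" using bij by (simp add: distinct_map bij_betw_def atLeast0LessThan)
  moreover have "distinct (map (window n (rev s)) [0..<N])"
  proof -
    have "inj_on (window n (rev s)) {..<N}"
    proof (rule inj_onI)
      fix i i' assume h: "i \<in> {..<N}" "i' \<in> {..<N}" "window n (rev s) i = window n (rev s) i'"
      then have "window n s (j i) = window n s (j i')" using w by simp
      then have "j i = j i'" using bij w h by (auto simp: bij_betw_def inj_on_def)
      then show "i = i'" using jinj h by (auto simp: inj_on_def)
    qed
    then show ?thesis by (simp add: distinct_map atLeast0LessThan)
  qed
  moreover have "window n s ` {..<N} \<inter> window n (rev s) ` {..<N} = {}"
  proof -
    have X: "window n s i \<in> X" if "i < N" for i using bij that by (auto simp: bij_betw_def)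
    then have "window n (rev s) i \<in> rev ` X" if "i < N" for i using w[OF that] by simp
    then have "window n (rev s) ` {..<N} \<subseteq> rev ` X" by auto
    moreover have "window n s ` {..<N} \<subseteq> X" using X by auto
    ultimately show ?thesis using d by blast
  qed
  ultimately show ?thesis unfolding orientable_sequence_def N_def by (simp add: atLeast0LessThan)
qed

text \<open>If two rotations by less than the length of the aperiodic prefix agree, a shorter prefix
  commutes with the rest of the string. Commuting words are powers of one word, which contradicts
  minimality.\<close>

lemma card_rotations:
  assumes "\<alpha> \<noteq> []"
  shows "card (rotations \<alpha>) = length (aperiodic_prefix \<alpha>)"
proof -
  let ?P = "\<lambda>\<gamma>. \<exists>t\<ge>1. \<alpha> = concat (replicate t \<gamma>)"
  have "?P \<alpha>" by (rule exI[of _ 1]) simp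
  then have m: "?P (aperiodic_prefix \<alpha>)" "\<And>\<gamma>. ?P \<gamma> \<Longrightarrow> length (aperiodic_prefix \<alpha>) \<le> length \<gamma>"
    unfolding aperiodic_prefix_def using arg_min_nat_lemma[of ?P \<alpha> length] by auto
  define \<gamma> where "\<gamma> = aperiodic_prefix \<alpha>"
  obtain t where t: "t \<ge> 1" "\<alpha> = concat (replicate t \<gamma>)" using m \<gamma>_def by auto
  define p where "p = length \<gamma>"
  have p0: "p > 0" using assms t by (auto simp: p_def)
  have "length \<alpha> = t * p" using t by (simp add: p_def length_concat sum_list_replicate)
  then have pn: "p \<le> length \<alpha>" using t by simp
  obtain t' where t': "t = Suc t'" using t by (cases t) auto
  have "rotate p \<alpha> = concat (replicate t' \<gamma>) @ \<gamma>" using t t' by (simp add: p_def rotate_append)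
  also have "\<dots> = \<alpha>" using t t' by (metis concat_append concat.simps replicate_append_same append_Nil2 replicate_Suc)
  finally have rp: "(rotate1 ^^ p) \<alpha> = \<alpha>" by (simp add: rotate_def)
  have "rotations \<alpha> = (\<lambda>k. rotate k \<alpha>) ` {..<p}"
  proof -
    have "rotate k \<alpha> \<in> (\<lambda>k. rotate k \<alpha>) ` {..<p}" for k
      using funpow_mod_eq[OF rp, of k] p0 by (intro image_eqI[of _ _ "k mod p"]) (simp_all add: rotate_def)
    then show ?thesis unfolding rotations_def by blast
  qed
  moreover have "inj_on (\<lambda>k. rotate k \<alpha>) {..<p}"
  proof (rule linorder_inj_onI')
    fix i j assume ij: "i \<in> {..<p}" "j \<in> {..<p}" "i < j"
    show "rotate i \<alpha> \<noteq> rotate j \<alpha>"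
    proof
      assume eq: "rotate i \<alpha> = rotate j \<alpha>"
      have "rotate j \<alpha> = rotate i (rotate (j - i) \<alpha>)" using ij by (simp add: rotate_rotate)
      then have "rotate (length \<alpha> - i) (rotate i \<alpha>) = rotate (length \<alpha> - i) (rotate i (rotate (j - i) \<alpha>))" using eq by simp
      then have r: "rotate (j - i) \<alpha> = \<alpha>" using rotate_undo[of i \<alpha>] rotate_undo[of i "rotate (j - i) \<alpha>"] ij pn by simp
      let ?u = "take (j - i) \<alpha>" and ?v = "drop (j - i) \<alpha>"
      have ji: "0 < j - i" "j - i < p" using ij by auto
      have "?v @ ?u = ?u @ ?v" using r rotate_drop_take[of "j - i" \<alpha>] ji pn by simp
      then obtain a b zs where z: "concat (replicate a zs) = ?u" "concat (replicate b zs) = ?v"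
        by (metis comm_append_are_replicate)
      have "?u \<noteq> []" using ji pn assms by simp
      then have a1: "a \<ge> 1" using z by (cases a) auto
      have "\<alpha> = concat (replicate (a + b) zs)" using z by (simp add: replicate_add)
      moreover have "a + b \<ge> 1" using a1 by simp
      ultimately have "p \<le> length zs" using m(2)[of zs] unfolding p_def \<gamma>_def by blast
      moreover have "length zs \<le> length ?u" unfolding z(1)[symmetric] using a1 by (cases a) auto
      ultimately show False using ji pn by simp
    qed
  qed
  ultimately show ?thesis by (simp add: card_image p_def \<gamma>_def)
qed

section \<open>The tree of rotation classes\<close>

text \<open>The order of the cases is the priority of the three conditions in \<open>g\<close>. For
  \<open>n >= 6\<close> the value at the root lies outside \<open>asym_bracelets n\<close>.\<close>

definition parent :: "nat \<Rightarrow> bool list \<Rightarrow> bool list" where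
  "parent n \<alpha> = (if first_one \<alpha> \<in> asym_bracelets n then first_one \<alpha>
     else if last_one \<alpha> \<in> asym_bracelets n then last_one \<alpha> else last_zero \<alpha>)"

text \<open>\<open>joins n \<alpha> \<gamma>\<close>: the cycle of \<open>\<alpha>\<close> is joined to the cycle of its parent by exchanging the
  successors of \<open>0\<gamma>\<close> and \<open>1\<gamma>\<close>.\<close>
definition joins :: "nat \<Rightarrow> bool list \<Rightarrow> bool list \<Rightarrow> bool" where
  "joins n \<alpha> \<gamma> \<longleftrightarrow> \<alpha> \<in> asym_bracelets n \<and>
     ((\<exists>k w. \<alpha> = zeros k @ True # w \<and> \<gamma> = w @ zeros k) \<and> first_one \<alpha> \<in> asym_bracelets n
    \<or> \<alpha> = \<gamma> @ [True] \<and> last_one \<alpha> \<in> asym_bracelets n \<and> first_one \<alpha> \<notin> asym_bracelets n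
    \<or> (\<exists>j w. \<alpha> = w @ False # ones j \<and> \<gamma> = ones j @ w) \<and> last_zero \<alpha> \<in> asym_bracelets n
       \<and> first_one \<alpha> \<notin> asym_bracelets n \<and> last_one \<alpha> \<notin> asym_bracelets n)"

lemma asym_bracelet_ends: assumes "\<alpha> \<in> asym_bracelets n" obtains w where "\<alpha> = False # w @ [True]"
proof -
  obtain s y where y: "\<alpha> = zeros s @ y" "s \<ge> 1" "one_ended y"
    using asym_bracelet_decomp[OF assms] by metis
  obtain y' where "y = y' @ [True]" using y(3) unfolding one_ended_def by (metis (full_types) append_butlast_last_id)
  then show ?thesis using that y(1,2) by (cases s) auto
qed

text \<open>Each operation flips one letter. \<open>\<gamma>\<close> is the rest, read cyclically
  from the place after that letter, and \<open>b\<close> is the old value of the letter.\<close>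

lemma joins_parent:
  assumes "joins n \<alpha> \<gamma>"
  shows "\<alpha> \<in> asym_bracelets n" "parent n \<alpha> \<in> asym_bracelets n"
    "\<exists>b. b # \<gamma> \<in> rotations \<alpha> \<and> (\<not> b) # \<gamma> \<in> rotations (parent n \<alpha>)"
proof -
  show A: "\<alpha> \<in> asym_bracelets n" using assms by (simp add: joins_def)
  show "parent n \<alpha> \<in> asym_bracelets n" using assms by (auto simp: joins_def parent_def)
  from assms consider
      (F) k w where "\<alpha> = zeros k @ True # w" "\<gamma> = w @ zeros k" "parent n \<alpha> = first_one \<alpha>"
    | (L) "\<alpha> = \<gamma> @ [True]" "parent n \<alpha> = last_one \<alpha>"
    | (Z) j w where "\<alpha> = w @ False # ones j" "\<gamma> = ones j @ w" "parent n \<alpha> = last_zero \<alpha>"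
    unfolding joins_def parent_def by auto
  then show "\<exists>b. b # \<gamma> \<in> rotations \<alpha> \<and> (\<not> b) # \<gamma> \<in> rotations (parent n \<alpha>)"
  proof cases
    case F
    have "True # \<gamma> \<in> rotations \<alpha>" using append_rotations[of "True # w" "zeros k"] F by simp
    moreover have "first_one \<alpha> = zeros k @ False # w" using F first_one_eq[of k w] by (simp add: replicate_app_Cons_same)
    then have "False # \<gamma> \<in> rotations (first_one \<alpha>)" using append_rotations[of "False # w" "zeros k"] F by simp
    ultimately show ?thesis using F by (intro exI[of _ True]) simp
  next
    case L
    have 1: "True # \<gamma> \<in> rotations \<alpha>" using append_rotations[of "[True]" \<gamma>] L by simp
    have "last_one \<alpha> = necklace_of (\<gamma> @ [False])" using L by (simp add: last_one_def)
    moreover have "necklace_of (\<gamma> @ [False]) \<in> rotations (\<gamma> @ [False])"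
      unfolding necklace_of_def using finite_rotations rotations_self by (intro Min_in) auto
    ultimately have "rotations (last_one \<alpha>) = rotations (\<gamma> @ [False])" using rotations_eq by simp
    then have "False # \<gamma> \<in> rotations (last_one \<alpha>)" using append_rotations[of "[False]" \<gamma>] by simp
    then show ?thesis using 1 L by (intro exI[of _ True]) simp
  next
    case Z
    have "False # \<gamma> \<in> rotations \<alpha>" using append_rotations[of "False # ones j" w] Z by simp
    moreover have "True # \<gamma> \<in> rotations (last_zero \<alpha>)"
      using append_rotations[of "True # ones j" w] Z last_zero_eq[of w j] by simp
    ultimately show ?thesis using Z by (intro exI[of _ False]) simp
  qed
qed

lemma joins_ex:
  assumes n: "n \<ge> 6" and A: "\<alpha> \<in> asym_bracelets n" "\<alpha> \<noteq> root_bracelet n"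
  shows "\<exists>\<gamma>. joins n \<alpha> \<gamma>"
proof -
  obtain k w where 1: "\<alpha> = zeros k @ True # w" using leading_zeros_decomp[OF asym_bracelet_not_constant(1)[OF A(1)]] by metis
  obtain \<gamma> where 2: "\<alpha> = \<gamma> @ [True]" using asym_bracelet_ends[OF A(1)] by (metis append_Cons)
  obtain j u where 3: "\<alpha> = u @ False # ones j" using trailing_ones_decomp[OF asym_bracelet_not_constant(2)[OF A(1)]] by metis
  consider "first_one \<alpha> \<in> asym_bracelets n"
    | "first_one \<alpha> \<notin> asym_bracelets n" "last_one \<alpha> \<in> asym_bracelets n"
    | "first_one \<alpha> \<notin> asym_bracelets n" "last_one \<alpha> \<notin> asym_bracelets n" by blast
  then show ?thesis
  proof cases
    case 1
    then have "joins n \<alpha> (w @ zeros k)" unfolding joins_def using A(1) \<open>\<alpha> = zeros k @ True # w\<close> by blast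
    then show ?thesis ..
  next
    case 2
    then have "joins n \<alpha> \<gamma>" unfolding joins_def using A(1) \<open>\<alpha> = \<gamma> @ [True]\<close> by blast
    then show ?thesis ..
  next
    case 3
    then have "joins n \<alpha> (ones j @ u)" unfolding joins_def
      using A(1) \<open>\<alpha> = u @ False # ones j\<close> last_zero_parent(1)[OF n A] by blast
    then show ?thesis ..
  qed
qed

lemma joins_unique:
  assumes "joins n \<alpha> \<gamma>" "joins n \<alpha> \<gamma>'" shows "\<gamma> = \<gamma>'"
proof -
  have 1: "w @ zeros k = w' @ zeros k'" if "zeros k @ True # w = zeros k' @ True # w'" for k w k' w'
  proof -
    have "k = k'" using leading_zeros_eq that by metis
    then show ?thesis using that by simp
  qed
  have 2: "ones j @ w = ones j' @ w'" if "w @ False # ones j = w' @ False # ones j'" for j w j' w'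
  proof -
    have "ones j @ False # rev w = ones j' @ False # rev w'" using arg_cong[OF that, of rev] by simp
    moreover have "takeWhile id (ones i @ False # u) = ones i" for i u by (simp add: takeWhile_append)
    ultimately have "j = j'" by (metis length_replicate)
    then show ?thesis using that by simp
  qed
  show ?thesis using assms 1 2 unfolding joins_def by blast
qed

text \<open>The summand 1 accounts for the last-zero operation, which does not lengthen the initial run of zeros
  but is never applied twice in a row.\<close>
definition height :: "nat \<Rightarrow> bool list \<Rightarrow> nat" where
  "height n \<alpha> = 2 * (n - leading_zeros \<alpha>) +
     (if first_one \<alpha> \<in> asym_bracelets n \<or> last_one \<alpha> \<in> asym_bracelets n then 0 else 1)"

lemma leading_zeros_le: "leading_zeros \<alpha> \<le> length \<alpha>" by (simp add: leading_zeros_def length_takeWhile_le)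

text \<open>The three operations turn the block 1011 into 11, 101 and 1111, all palindromes.\<close>

lemma root_bracelet_no_join: "n \<ge> 6 \<Longrightarrow> \<not> joins n (root_bracelet n) \<gamma>"
proof -
  assume n: "n \<ge> 6"
  define m where "m = n - 4"
  have m: "n = m + 4" "m \<ge> 2" using n by (auto simp: m_def)
  have nr: "no_run m [True, False, True, True]" 
  proof -
    have "no_run 2 [True, False, True, True]" unfolding no_run_def by (auto simp: numeral_2_eq_2 Cons_eq_append_conv)
    then show ?thesis using m no_run_mono by blast
  qed
  have r: "root_bracelet n = zeros m @ [True, False, True, True]" using m by (simp add: root_bracelet_def)
  have F: "first_one (root_bracelet n) \<notin> asym_bracelets n"
    using first_one_block[of "[True, True]" m 1] nr no_run_mono[OF nr, of "Suc m"] r by (auto simp: one_ended_def)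
  have L: "last_one (root_bracelet n) \<notin> asym_bracelets n"
    using last_one_block[of "[True, False, True]" m 0] no_run_mono[OF nr, of "Suc m"] r by (auto simp: one_ended_def)
  have "last_zero (root_bracelet n) = zeros m @ [True, True, True, True]"
    using r last_zero_eq[of "zeros m @ [True]" 2] by (simp add: numeral_2_eq_2)
  moreover have "no_run m [True, True, True, True]"
  proof -
    have "no_run 2 [True, True, True, True]" unfolding no_run_def by (auto simp: numeral_2_eq_2 Cons_eq_append_conv)
    then show ?thesis using m no_run_mono by blast
  qed
  ultimately have Z: "last_zero (root_bracelet n) \<notin> asym_bracelets n"
    using block_in_asym_bracelets[of "[True, True, True, True]" m n] by (auto simp: one_ended_def)
  show ?thesis using F L Z by (simp add: joins_def)
qed

lemma root_bracelet_in: "n \<ge> 6 \<Longrightarrow> root_bracelet n \<in> asym_bracelets n"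
proof -
  assume n: "n \<ge> 6"
  have "no_run 2 [True, False, True, True]" unfolding no_run_def by (auto simp: numeral_2_eq_2 Cons_eq_append_conv)
  then have "no_run (n - 4) [True, False, True, True]" using n no_run_mono by auto
  then show ?thesis using block_in_asym_bracelets[of "[True, False, True, True]" "n - 4" n] n
    by (auto simp: one_ended_def root_bracelet_def)
qed

lemma height_parent:
  assumes n: "n \<ge> 6" and j: "joins n \<alpha> \<gamma>"
  shows "height n (parent n \<alpha>) < height n \<alpha>"
proof -
  have A: "\<alpha> \<in> asym_bracelets n" "parent n \<alpha> \<in> asym_bracelets n" using joins_parent[OF j] by auto
  have ne: "\<alpha> \<noteq> root_bracelet n" using root_bracelet_no_join[OF n] j by auto
  have l: "leading_zeros (parent n \<alpha>) \<le> n" using leading_zeros_le[of "parent n \<alpha>"] A(2) by (auto simp: asym_bracelets_iff)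
  show ?thesis
  proof (cases "first_one \<alpha> \<in> asym_bracelets n \<or> last_one \<alpha> \<in> asym_bracelets n")
    case True
    then have "leading_zeros \<alpha> < leading_zeros (parent n \<alpha>)" using leading_zeros_first_one[OF A(1)] leading_zeros_last_one[OF A(1)] by (auto simp: parent_def)
    \<comment> \<open>Each additional zero counts twice, which outweighs a possible new summand 1;
      \<open>l\<close> ensures that the difference really drops.\<close>
    then show ?thesis using l by (auto simp: height_def)
  next
    case False
    then have p: "parent n \<alpha> = last_zero \<alpha>" by (simp add: parent_def)
    then show ?thesis using last_zero_parent[OF n A(1) ne] False leading_zeros_last_zero[OF A(1)] by (auto simp: height_def)
  qed
qed

lemma asym_bracelet_rotations_eq:
  assumes "\<alpha> \<in> asym_bracelets n" "\<beta> \<in> asym_bracelets n" "x \<in> rotations \<alpha>" "x \<in> rotations \<beta>"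
  shows "\<alpha> = \<beta>"
proof -
  have "rotations \<alpha> = rotations \<beta>" using assms rotations_eq by blast
  then have "\<alpha> \<le> \<beta>" "\<beta> \<le> \<alpha>" using assms rotations_self unfolding asym_bracelets_iff by blast+
  then show ?thesis by simp
qed

text \<open>If both edges flip the letter from the same value, the two bracelets share a class.
  Otherwise each is the parent of the other, which \<open>height\<close> forbids.\<close>

lemma joins_inj:
  assumes n: "n \<ge> 6" and j: "joins n \<alpha> \<gamma>" "joins n \<beta> \<gamma>"
  shows "\<alpha> = \<beta>"
proof (rule ccontr)
  assume ne: "\<alpha> \<noteq> \<beta>"
  obtain b where b: "b # \<gamma> \<in> rotations \<alpha>" "(\<not> b) # \<gamma> \<in> rotations (parent n \<alpha>)" using joins_parent[OF j(1)] by auto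
  obtain c where c: "c # \<gamma> \<in> rotations \<beta>" "(\<not> c) # \<gamma> \<in> rotations (parent n \<beta>)" using joins_parent[OF j(2)] by auto
  have "b \<noteq> c"
  proof
    assume "b = c"
    then show False
      using ne asym_bracelet_rotations_eq[OF joins_parent(1)[OF j(1)] joins_parent(1)[OF j(2)] b(1)] c(1) by simp
  qed
  then have e: "b # \<gamma> \<in> rotations (parent n \<beta>)" "c # \<gamma> \<in> rotations (parent n \<alpha>)"
    using b(2) c(2) by (cases b; cases c; simp)+
  have "\<alpha> = parent n \<beta>"
    by (rule asym_bracelet_rotations_eq[OF joins_parent(1)[OF j(1)] joins_parent(2)[OF j(2)] b(1) e(1)])
  moreover have "\<beta> = parent n \<alpha>"
    by (rule asym_bracelet_rotations_eq[OF joins_parent(1)[OF j(2)] joins_parent(2)[OF j(1)] c(1) e(2)])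
  ultimately show False using height_parent[OF n j(1)] height_parent[OF n j(2)] by simp
qed

section \<open>Growing one cycle along the tree\<close>

definition joined_step :: "nat \<Rightarrow> bool list set \<Rightarrow> bool list \<Rightarrow> bool list" where
  "joined_step n D x = tl x @ [if \<exists>\<alpha>\<in>D. joins n \<alpha> (tl x) then \<not> hd x else hd x]"

definition classes :: "bool list set \<Rightarrow> bool list set" where
  "classes D = (\<Union>\<alpha>\<in>D. rotations \<alpha>)"

text \<open>Such a \<open>D\<close> is a subtree containing the root, so both ends of every exchange
  made by \<open>joined_step n D\<close> lie in its classes.\<close>

definition parent_closed :: "nat \<Rightarrow> bool list set \<Rightarrow> bool" where
  "parent_closed n D \<longleftrightarrow> D \<subseteq> asym_bracelets n \<and> root_bracelet n \<in> D \<and> (\<forall>\<alpha>\<in>D. \<alpha> \<noteq> root_bracelet n \<longrightarrow> parent n \<alpha> \<in> D)"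

lemma finite_asym_bracelets: "finite (asym_bracelets n)"
proof -
  have "asym_bracelets n \<subseteq> {xs. set xs \<subseteq> UNIV \<and> length xs = n}" by (auto simp: asym_bracelets_def)
  then show ?thesis using finite_lists_length_eq[of "UNIV :: bool set" n] finite_subset by auto
qed

lemma classes_length: "D \<subseteq> asym_bracelets n \<Longrightarrow> x \<in> classes D \<Longrightarrow> length x = n"
  unfolding classes_def by (auto simp: asym_bracelets_def dest!: rotations_length)

lemma classes_finite: "D \<subseteq> asym_bracelets n \<Longrightarrow> finite (classes D)"
  unfolding classes_def using finite_rotations finite_subset[OF _ finite_asym_bracelets] by simp

lemma rotate1_in_rotations:
  assumes "x \<noteq> []" "x \<in> rotations \<alpha>" shows "tl x @ [hd x] \<in> rotations \<alpha>"
proof -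
  have "tl x @ [hd x] \<in> rotations ([hd x] @ tl x)" by (rule append_rotations)
  then show ?thesis using assms rotations_trans by (metis append_Cons append_Nil list.collapse)
qed

lemma joined_step_closed:
  assumes n: "n \<ge> 6" and D: "parent_closed n D" and x: "x \<in> classes D"
  shows "joined_step n D x \<in> classes D"
proof -
  have ne: "x \<noteq> []" using classes_length[of D n x] D x n by (auto simp: parent_closed_def)
  show ?thesis
  proof (cases "\<exists>\<alpha>\<in>D. joins n \<alpha> (tl x)")
    case False
    then show ?thesis using x rotate1_in_rotations[OF ne] by (auto simp: joined_step_def classes_def)
  next
    case True
    then obtain \<alpha> where a: "\<alpha> \<in> D" "joins n \<alpha> (tl x)" by auto
    have "parent n \<alpha> \<in> D" using D a root_bracelet_no_join[OF n] by (auto simp: parent_closed_def)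
    moreover obtain c where "c # tl x \<in> rotations \<alpha>" "(\<not> c) # tl x \<in> rotations (parent n \<alpha>)"
      using joins_parent(3)[OF a(2)] by auto
    ultimately have "(\<not> hd x) # tl x \<in> classes D"
      using a(1) unfolding classes_def by (cases "c = (\<not> hd x)") auto
    then obtain \<beta> where "\<beta> \<in> D" "(\<not> hd x) # tl x \<in> rotations \<beta>" unfolding classes_def by blast
    then have "tl x @ [\<not> hd x] \<in> classes D" using rotate1_in_rotations[of "(\<not> hd x) # tl x" \<beta>] by (auto simp: classes_def)
    then show ?thesis using True by (simp add: joined_step_def)
  qed
qed

text \<open>Whether the first letter is complemented depends on the tail alone, and the tail is
  still visible in the result.\<close>

lemma joined_step_inj: "[] \<notin> X \<Longrightarrow> inj_on (joined_step n D) X"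
proof (rule inj_onI)
  fix x y assume X: "[] \<notin> X" "x \<in> X" "y \<in> X" and e: "joined_step n D x = joined_step n D y"
  obtain a u where x: "x = a # u" using X by (cases x) auto
  obtain b v where y: "y = b # v" using X by (cases y) auto
  have uv: "u = v" using e x y by (simp add: joined_step_def)
  show "x = y"
  proof (cases "\<exists>\<alpha>\<in>D. joins n \<alpha> v")
    case True
    then show ?thesis using e x y uv by (simp add: joined_step_def)
  next
    case False
    then show ?thesis using e x y uv by (simp add: joined_step_def)
  qed
qed

lemma rotations_reaches:
  assumes f: "\<And>x. x \<in> rotations \<alpha> \<Longrightarrow> f x = tl x @ [hd x]" and ne: "\<alpha> \<noteq> []"
    and xy: "x \<in> rotations \<alpha>" "y \<in> rotations \<alpha>"
  shows "reaches f x y"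
proof -
  have "(f ^^ k) x = rotate k x \<and> rotate k x \<in> rotations \<alpha>" for k
  proof (induction k)
    case (Suc k)
    have "rotate k x \<noteq> []" using ne rotations_length[OF xy(1)] by auto
    then have "rotate1 (rotate k x) = tl (rotate k x) @ [hd (rotate k x)]" by (cases "rotate k x") auto
    moreover have "rotate (Suc k) x \<in> rotations \<alpha>" using xy(1) rotations_trans unfolding rotations_iff by metis
    ultimately show ?case using Suc f[of "rotate k x"] by simp
  qed (simp add: xy)
  moreover have "y \<in> rotations x" using xy rotations_sym rotations_trans by blast
  ultimately show ?thesis unfolding reaches_def rotations_iff by metis
qed

text \<open>Induction on the size of the subtree. A bracelet of maximal height is nobody's parent,
  so it can be removed, and putting it back adds exactly one exchange.\<close>

lemma joined_step_reaches:
  assumes n: "n \<ge> 6" and D: "parent_closed n D" and xy: "x \<in> classes D" "y \<in> classes D"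
  shows "reaches (joined_step n D) x y"
  using D xy
proof (induction "card D" arbitrary: D x y rule: less_induct)
  case less
  have DA: "D \<subseteq> asym_bracelets n" and rD: "root_bracelet n \<in> D" using less(2) by (auto simp: parent_closed_def)
  have fD: "finite D" using DA finite_asym_bracelets finite_subset by blast
  have nil: "[] \<notin> asym_bracelets n" using n by (auto simp: asym_bracelets_def)
  show ?case
  proof (cases "D = {root_bracelet n}")
    case True
    then have "joined_step n D x = tl x @ [hd x]" for x using root_bracelet_no_join[OF n] by (simp add: joined_step_def)
    moreover have "root_bracelet n \<noteq> []" using nil rD DA by auto
    moreover have "x \<in> rotations (root_bracelet n)" "y \<in> rotations (root_bracelet n)" using less(3,4) True by (auto simp: classes_def)
    ultimately show ?thesis using rotations_reaches[of "root_bracelet n" "joined_step n D" x y] by blast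
  next
    case False
    then have "D - {root_bracelet n} \<noteq> {}" using rD by auto
    then have "Max (height n ` (D - {root_bracelet n})) \<in> height n ` (D - {root_bracelet n})" using fD by (intro Max_in) auto
    then obtain \<delta> where d: "\<delta> \<in> D" "\<delta> \<noteq> root_bracelet n" "height n \<delta> = Max (height n ` (D - {root_bracelet n}))"
      by (metis (no_types, lifting) DiffE imageE singletonI)
    have mx: "height n \<alpha> \<le> height n \<delta>" if "\<alpha> \<in> D" "\<alpha> \<noteq> root_bracelet n" for \<alpha> using that d(3) fD by simp
    define D' where "D' = D - {\<delta>}"
    have D'D: "D = insert \<delta> D'" "\<delta> \<notin> D'" using d by (auto simp: D'_def)
    have jex: "\<exists>\<gamma>. joins n \<alpha> \<gamma>" if "\<alpha> \<in> D" "\<alpha> \<noteq> root_bracelet n" for \<alpha> using that joins_ex[OF n] DA by auto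
    have cl: "parent_closed n D'"
      unfolding parent_closed_def
    proof (intro conjI ballI impI)
      show "D' \<subseteq> asym_bracelets n" "root_bracelet n \<in> D'" using DA rD d by (auto simp: D'_def)
      fix \<alpha> assume a: "\<alpha> \<in> D'" "\<alpha> \<noteq> root_bracelet n"
      then have aD: "\<alpha> \<in> D" by (simp add: D'_def)
      obtain \<gamma> where "joins n \<alpha> \<gamma>" using jex[OF aD a(2)] by auto
      then have "height n (parent n \<alpha>) < height n \<alpha>" using height_parent[OF n] by auto
      then have "parent n \<alpha> \<noteq> \<delta>" using mx[OF aD a(2)] by auto
      then show "parent n \<alpha> \<in> D'" using less(2) aD a(2) by (auto simp: parent_closed_def D'_def)
    qed
    obtain \<gamma> where g: "joins n \<delta> \<gamma>" using jex d by auto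
    obtain b where b: "b # \<gamma> \<in> rotations \<delta>" "(\<not> b) # \<gamma> \<in> rotations (parent n \<delta>)" using joins_parent[OF g] by auto
    have pD': "parent n \<delta> \<in> D'" using less(2) d height_parent[OF n g] by (auto simp: parent_closed_def D'_def)
    let ?f = "joined_step n D'" and ?h = "joined_step n D"
    let ?P = "classes D'" and ?Q = "rotations \<delta>"
    have dA: "\<delta> \<in> asym_bracelets n" using d DA by auto
    have PQ: "?P \<inter> ?Q = {}" using asym_bracelet_rotations_eq[OF dA] D'D DA by (auto simp: classes_def)
    have cD: "classes D = ?P \<union> ?Q" using D'D by (auto simp: classes_def)
    \<comment> \<open>An exchange at the tail of \<open>x\<close> would put \<open>x\<close> into
      the class of an end of an edge in \<open>D'\<close>. So the class of \<open>\<delta>\<close>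
      is still a plain rotation cycle.\<close>
    have fQ: "?f x = tl x @ [hd x]" if x: "x \<in> ?Q" for x
    proof -
      have "\<not> (\<exists>\<alpha>\<in>D'. joins n \<alpha> (tl x))"
      proof
        assume "\<exists>\<alpha>\<in>D'. joins n \<alpha> (tl x)"
        then obtain \<alpha> where a: "\<alpha> \<in> D'" "joins n \<alpha> (tl x)" by auto
        have pa: "parent n \<alpha> \<in> D'" using cl a root_bracelet_no_join[OF n] by (auto simp: parent_closed_def)
        have "x \<noteq> []" using rotations_length[OF x] dA n by (auto simp: asym_bracelets_def)
        then obtain e u where xx: "x = e # u" by (cases x) auto
        obtain c where "c # tl x \<in> rotations \<alpha>" "(\<not> c) # tl x \<in> rotations (parent n \<alpha>)"
          using joins_parent(3)[OF a(2)] by auto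
        then have "x \<in> rotations \<alpha> \<or> x \<in> rotations (parent n \<alpha>)" using xx by (cases c; cases e; simp)
        then have "x \<in> ?P" using a pa by (auto simp: classes_def)
        then show False using PQ x by auto
      qed
      then show ?thesis by (simp add: joined_step_def)
    qed
    have jD: "(\<exists>\<alpha>\<in>D. joins n \<alpha> u) \<longleftrightarrow> u = \<gamma> \<or> (\<exists>\<alpha>\<in>D'. joins n \<alpha> u)" for u
      using D'D g joins_unique by (metis insert_iff)
    \<comment> \<open>No edge already present exchanges at \<open>\<gamma>\<close>, so the new edge
      really changes the map there.\<close>
    have jD': "\<not> (\<exists>\<alpha>\<in>D'. joins n \<alpha> \<gamma>)" using D'D g joins_inj[OF n] by metis
    have IH: "reaches ?f u w" if "u \<in> ?P" "w \<in> ?P" for u w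
    proof -
      have "card D' < card D" using D'D fD by (metis card_insert_disjoint finite_insert lessI)
      then show ?thesis using less(1)[OF _ cl that] by blast
    qed
    have hnil: "[] \<notin> classes D" using classes_length[OF DA] n by force
    show ?thesis
    proof (rule cycle_join[where X = "classes D" and P = ?P and Q = ?Q and f = ?f and x' = "b # \<gamma>" and y' = "(\<not> b) # \<gamma>"])
      show "finite (classes D)" using classes_finite[OF DA] .
      show "inj_on ?h (classes D)" using joined_step_inj[OF hnil] .
      show "?h ` classes D \<subseteq> classes D" using joined_step_closed[OF n less(2)] by auto
      show "?P \<subseteq> classes D" "?Q \<subseteq> classes D" using cD by auto
      show y0: "(\<not> b) # \<gamma> \<in> ?P" using b pD' by (auto simp: classes_def)
      show x0: "b # \<gamma> \<in> ?Q" using b by auto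
      show "?P \<inter> ?Q = {}" by fact
      show fP: "?f ` ?P \<subseteq> ?P" using joined_step_closed[OF n cl] by auto
      have "x \<noteq> []" if "x \<in> ?Q" for x using hnil cD that by auto
      then show fQ': "?f ` ?Q \<subseteq> ?Q" using fQ rotate1_in_rotations by auto
      show "reaches ?f (?f ((\<not> b) # \<gamma>)) z" if "z \<in> ?P" for z using IH that y0 fP by blast
      show "reaches ?f (?f (b # \<gamma>)) z" if "z \<in> ?Q" for z
        by (rule rotations_reaches[of \<delta>]) (use fQ dA nil fQ' x0 that in auto)
      show "?h (b # \<gamma>) = ?f ((\<not> b) # \<gamma>)" "?h ((\<not> b) # \<gamma>) = ?f (b # \<gamma>)"
        using jD[of \<gamma>] jD' by (auto simp: joined_step_def)
      show "?h z = ?f z" if z: "z \<in> ?P \<union> ?Q" "z \<noteq> b # \<gamma>" "z \<noteq> (\<not> b) # \<gamma>" for z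
      proof -
        have "z \<noteq> []" using hnil cD z(1) by auto
        then have "tl z \<noteq> \<gamma>" using z(2,3) by (cases z) auto
        then show ?thesis using jD[of "tl z"] by (simp add: joined_step_def)
      qed
      show "x \<in> ?P \<union> ?Q" "y \<in> ?P \<union> ?Q" using less(3,4) cD by auto
    qed
  qed
qed

section \<open>The successor rule\<close>

text \<open>\<open>beta1\<close> overwrites the first letter by 1 and so is a function of the tail;
  the 1 in the tail keeps the index \<open>i\<close> beyond the first letter.\<close>

lemma beta1_eq: "beta1 (b # w @ True # zeros k) = zeros k @ True # w @ [True]"
proof -
  let ?a = "b # w @ True # zeros k"
  have "(GREATEST i. 1 \<le> i \<and> i \<le> length ?a \<and> ?a ! (i - 1)) = length w + 2"
  proof (rule Greatest_equality)
    show "1 \<le> length w + 2 \<and> length w + 2 \<le> length ?a \<and> ?a ! (length w + 2 - 1)" by (auto simp: nth_append)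
    fix y assume y: "1 \<le> y \<and> y \<le> length ?a \<and> ?a ! (y - 1)"
    show "y \<le> length w + 2"
    proof (rule ccontr)
      assume "\<not> y \<le> length w + 2"
      then have "?a ! (y - 1) = zeros k ! (y - 3 - length w)" using y by (auto simp: nth_append nth_Cons' numeral_eq_Suc)
      moreover have "y - 3 - length w < k" using y \<open>\<not> y \<le> length w + 2\<close> by (auto simp: not_le)
      ultimately show False using y by (metis nth_replicate)
    qed
  qed
  then show ?thesis unfolding beta1_def Let_def by simp
qed

lemma beta3_eq: "beta3 (b # ones j @ False # w) = False # w @ False # ones j"
proof -
  let ?a = "b # ones j @ False # w"
  have "(LEAST i. 1 < i \<and> i \<le> length ?a \<and> \<not> ?a ! (i - 1)) = j + 2"
  proof (rule Least_equality)
    show "1 < j + 2 \<and> j + 2 \<le> length ?a \<and> \<not> ?a ! (j + 2 - 1)" by (auto simp: nth_append)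
    fix y assume y: "1 < y \<and> y \<le> length ?a \<and> \<not> ?a ! (y - 1)"
    show "j + 2 \<le> y"
    proof (rule ccontr)
      assume "\<not> j + 2 \<le> y"
      then have "?a ! (y - 1) = ones j ! (y - 2)" using y by (auto simp: nth_append nth_Cons' numeral_eq_Suc)
      moreover have "y - 2 < j" using y \<open>\<not> j + 2 \<le> y\<close> by (auto simp: not_le)
      ultimately show False using y by (metis nth_replicate)
    qed
  qed
  then show ?thesis unfolding beta3_def Let_def by simp
qed

text \<open>With two letters of each kind, the tail of every rotation still contains a 0 and a 1, so
  the indices in \<open>beta1\<close> and \<open>beta3\<close> exist.\<close>

lemma asym_bracelet_counts:
  assumes "\<alpha> \<in> asym_bracelets n"
  shows "length (filter id \<alpha>) \<ge> 2" "length (filter Not \<alpha>) \<ge> 2"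
proof -
  obtain s y where y: "\<alpha> = zeros s @ y" "s \<ge> 1" "one_ended y" "y < rev y"
    using asym_bracelet_decomp[OF assms] by metis
  obtain p q x where x: "y = True # zeros p @ x @ zeros q @ [True]" using one_ended_inner y by metis
  show "length (filter id \<alpha>) \<ge> 2" using y x by simp
  have "False \<in> set y"
  proof (rule ccontr)
    assume "False \<notin> set y"
    then have "y = ones (length y)" by (metis (full_types) replicate_length_same)
    then show False using y(4) by (metis less_irrefl rev_replicate)
  qed
  then have "filter Not y \<noteq> []" by (auto simp: filter_empty_conv)
  then show "length (filter Not \<alpha>) \<ge> 2" using y by (cases "filter Not y") auto
qed

lemma asym_strings_tail:
  assumes "x \<in> asym_strings n"
  shows "x \<noteq> []" "True \<in> set (tl x)" "False \<in> set (tl x)"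
proof -
  obtain \<alpha> where a: "\<alpha> \<in> asym_bracelets n" "x \<in> rotations \<alpha>" using assms by (auto simp: asym_strings_def)
  have c: "length (filter id x) \<ge> 2" "length (filter Not x) \<ge> 2"
    using filter_rotations[OF a(2)] asym_bracelet_counts[OF a(1)] by metis+
  show ne: "x \<noteq> []" using c by auto
  then obtain b t where x: "x = b # t" by (cases x) auto
  have "filter id t \<noteq> []" "filter Not t \<noteq> []" using c x by (auto split: if_splits)
  then show "True \<in> set (tl x)" "False \<in> set (tl x)" using x by (auto simp: filter_empty_conv)
qed

text \<open>Given the tail, each kind of edge has a single candidate for the child:
  \<open>beta1\<close>, \<open>beta2\<close> and \<open>beta3\<close> recover it by putting back the
  letter that the operation flips.\<close>

lemma g_eq:
  assumes x: "x \<in> asym_strings n"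
  shows "g n x = (if \<exists>\<alpha>\<in>asym_bracelets n. joins n \<alpha> (tl x) then \<not> hd x else hd x)"
proof -
  obtain b t where bt: "x = b # t" using asym_strings_tail(1)[OF x] by (cases x) auto
  have T: "True \<in> set t" "False \<in> set t" using asym_strings_tail[OF x] bt by auto
  let ?A = "asym_bracelets n"
  define C1 where "C1 \<longleftrightarrow> beta1 x \<in> ?A \<and> first_one (beta1 x) \<in> ?A"
  define C2 where "C2 \<longleftrightarrow> beta2 x \<in> ?A \<and> last_one (beta2 x) \<in> ?A \<and> first_one (beta2 x) \<notin> ?A"
  define C3 where "C3 \<longleftrightarrow> beta3 x \<in> ?A \<and> last_zero (beta3 x) \<in> ?A \<and> first_one (beta3 x) \<notin> ?A \<and> last_one (beta3 x) \<notin> ?A"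
  have g: "g n x = (if C1 \<or> C2 \<or> C3 then \<not> hd x else hd x)"
    unfolding g_def Let_def C1_def C2_def C3_def by simp
  obtain k w where w: "t = w @ True # zeros k" using trailing_zeros_decomp[OF T(1)] by metis
  obtain j v where v: "t = ones j @ False # v" using leading_ones_decomp[OF T(2)] by metis
  have b1: "beta1 x = zeros k @ True # w @ [True]" using beta1_eq bt w by simp
  have b3: "beta3 x = False # v @ False # ones j" using beta3_eq bt v by simp
  have b2: "beta2 x = t @ [True]" using bt by (simp add: beta2_def)
  have j1: "joins n (beta1 x) t" if C1
  proof -
    have "beta1 x = zeros k @ True # (w @ [True]) \<and> t = (w @ [True]) @ zeros k" using b1 w by simp
    then show ?thesis using that unfolding joins_def C1_def by blast
  qed
  have j2: "joins n (beta2 x) t" if C2 using that b2 unfolding joins_def C2_def by auto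
  have j3: "joins n (beta3 x) t" if C3
  proof -
    have "beta3 x = (False # v) @ False # ones j \<and> t = ones j @ (False # v)" using b3 v by simp
    then show ?thesis using that unfolding joins_def C3_def by blast
  qed
  have conv: "C1 \<or> C2 \<or> C3" if "joins n \<alpha> t" for \<alpha>
  proof -
    have A: "\<alpha> \<in> ?A" using that by (simp add: joins_def)
    obtain u where u: "\<alpha> = False # u @ [True]" using asym_bracelet_ends[OF A] .
    from that consider
      (F) k w where "\<alpha> = zeros k @ True # w" "t = w @ zeros k" "first_one \<alpha> \<in> ?A"
    | (L) "\<alpha> = t @ [True]" "last_one \<alpha> \<in> ?A" "first_one \<alpha> \<notin> ?A"
    | (Z) j w where "\<alpha> = w @ False # ones j" "t = ones j @ w" "last_zero \<alpha> \<in> ?A" "first_one \<alpha> \<notin> ?A" "last_one \<alpha> \<notin> ?A"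
      unfolding joins_def by blast
    then show ?thesis
    proof cases
      case F
      \<comment> \<open>The bracelet ends in 1, hence \<open>k\<close> counts all trailing zeros of
        the tail and \<open>beta1\<close> cuts at the right place.\<close>
      have "w \<noteq> []" using T F by auto
      moreover have "last \<alpha>" using u by simp
      ultimately have "w = butlast w @ [True]" using F(1) by (metis (full_types) append_butlast_last_id last.simps last_appendR list.distinct(1))
      then have "t = butlast w @ True # zeros k" using F(2) by (metis append.assoc append_Cons append_Nil)
      then have "beta1 x = zeros k @ True # butlast w @ [True]" using beta1_eq bt by simp
      then have "beta1 x = \<alpha>" using F(1) \<open>w = butlast w @ [True]\<close> by simp
      then show ?thesis using F A by (simp add: C1_def)
    next
      case L then show ?thesis using b2 A by (simp add: C2_def)
    next
      case Z
      \<comment> \<open>The bracelet begins with 0, hence \<open>j\<close> counts all leading ones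
        of the tail.\<close>
      have "w \<noteq> []" using T Z by auto
      then obtain w' where "w = False # w'" using Z(1) u by (cases w) auto
      then have "beta3 x = \<alpha>" using beta3_eq[of b j w'] bt Z by simp
      then show ?thesis using Z A by (simp add: C3_def)
    qed
  qed
  have "(C1 \<or> C2 \<or> C3) \<longleftrightarrow> (\<exists>\<alpha>\<in>?A. joins n \<alpha> t)"
    using j1 j2 j3 conv joins_parent(1) by blast
  then show ?thesis using g bt by simp
qed

text \<open>The two bracelets involved would be rotations of each other's reversals, hence each
  strictly smaller than the other.\<close>

lemma asym_strings_rev: "asym_strings n \<inter> rev ` asym_strings n = {}"
proof -
  have False if h: "x \<in> asym_strings n" "rev x \<in> asym_strings n" for x
  proof -
    obtain \<alpha> where a: "\<alpha> \<in> asym_bracelets n" "x \<in> rotations \<alpha>" using h by (auto simp: asym_strings_def)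
    obtain \<beta> where b: "\<beta> \<in> asym_bracelets n" "rev x \<in> rotations \<beta>" using h by (auto simp: asym_strings_def)
    have "rev x \<in> rotations (rev \<alpha>)" using a(2) rev_rotations by auto
    then have 1: "\<beta> \<in> rotations (rev \<alpha>)" using b(2) rotations_sym rotations_trans by blast
    have "x \<in> rotations (rev \<beta>)" using b(2) rev_rotations[of "rev x" \<beta>] by simp
    then have 2: "\<alpha> \<in> rotations (rev \<beta>)" using a(2) rotations_sym rotations_trans by blast
    show False using a(1) b(1) 1 2 unfolding asym_bracelets_iff by force
  qed
  then show ?thesis by auto
qed

lemma card_asym_strings: "n \<ge> 1 \<Longrightarrow> card (asym_strings n) = cycle_length n"
proof -
  assume n: "n \<ge> 1"
  have "card (asym_strings n) = (\<Sum>\<alpha>\<in>asym_bracelets n. card (rotations \<alpha>))"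
    unfolding asym_strings_def using finite_asym_bracelets finite_rotations asym_bracelet_rotations_eq
    by (intro card_UN_disjoint) blast+
  also have "\<dots> = cycle_length n" unfolding cycle_length_def
    using n by (intro sum.cong card_rotations) (auto simp: asym_bracelets_def)
  finally show ?thesis .
qed

lemma orientable_universal_cycle:
  assumes n: "n \<ge> 6"
  shows "\<exists>s. universal_cycle n (asym_strings n) s \<and> successor_rule n (asym_strings n) s (g n)
                  \<and> orientable_sequence n s \<and> length s = cycle_length n"
proof -
  let ?A = "asym_bracelets n" and ?F = "\<lambda>x. tl x @ [g n x]"
  have cl: "parent_closed n ?A" unfolding parent_closed_def using root_bracelet_in[OF n] joins_ex[OF n] joins_parent(2) by blast
  have S: "classes ?A = asym_strings n" by (simp add: classes_def asym_strings_def)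
  have eq: "?F x = joined_step n ?A x" if "x \<in> asym_strings n" for x
    using g_eq[OF that] by (simp add: joined_step_def)
  have r: "root_bracelet n \<in> asym_strings n" using root_bracelet_in[OF n] rotations_self by (auto simp: asym_strings_def)
  have nil: "[] \<notin> asym_strings n" using asym_strings_tail(1) by blast
  \<comment> \<open>\<open>?F\<close> and \<open>joined_step\<close> are known to agree only on
    \<open>asym_strings n\<close>, so the iterates are compared together with the fact that they
    stay there.\<close>
  have pw: "(?F ^^ k) x = (joined_step n ?A ^^ k) x \<and> (?F ^^ k) x \<in> asym_strings n" if "x \<in> asym_strings n" for x k
    using that joined_step_closed[OF n cl] eq by (induction k) (auto simp: S)
  obtain s where s: "universal_cycle n (asym_strings n) s" "successor_rule n (asym_strings n) s (g n)"
  proof (rule universal_cycle_of_orbit[of n "asym_strings n" "g n" "root_bracelet n"])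
    show "1 \<le> n" using n by simp
    show "length y = n" if "y \<in> asym_strings n" for y using classes_length[of ?A n y] that S by simp
    show "finite (asym_strings n)" using classes_finite[of ?A n] S by simp
    show "inj_on ?F (asym_strings n)" using joined_step_inj[OF nil, of n ?A] eq by (simp cong: inj_on_cong)
    show "?F ` asym_strings n \<subseteq> asym_strings n" using joined_step_closed[OF n cl] eq S by auto
    show "root_bracelet n \<in> asym_strings n" by (rule r)
    show "reaches ?F (root_bracelet n) y" if "y \<in> asym_strings n" for y
      using joined_step_reaches[OF n cl, of "root_bracelet n" y] r that S pw[OF r] by (auto simp: reaches_def)
  qed blast
  then show ?thesis using orientable_of_universal[OF s(1) asym_strings_rev] card_asym_strings n
    by (auto simp: universal_cycle_def)
qed

section \<open>Weakest preconditions with running time\<close>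

text \<open>A stuck run has no derivation of \<open>exec\<close>, so this form includes termination
  and the bound checks of the machine.\<close>

definition wp :: "nat \<Rightarrow> com \<Rightarrow> (reg \<Rightarrow> nat) \<Rightarrow> (nat \<Rightarrow> nat) \<Rightarrow> (nat \<Rightarrow> (reg \<Rightarrow> nat) \<Rightarrow> (nat \<Rightarrow> nat) \<Rightarrow> bool) \<Rightarrow> bool" where
  "wp m c R M Q \<longleftrightarrow> (\<exists>t R' M'. exec m c (R, M) t (R', M') \<and> Q t R' M')"

lemma wp_mono:
  assumes "wp m c R M P" "\<And>t R' M'. P t R' M' \<Longrightarrow> Q t R' M'"
  shows "wp m c R M Q"
  using assms unfolding wp_def by blast

lemma wp_Skip: "wp m Skip R M Q \<longleftrightarrow> Q 1 R M"
  unfolding wp_def exec.simps[of m "Skip"] by auto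
lemma wp_Const: "wp m (Const x k) R M Q \<longleftrightarrow> k < m \<and> Q 1 (R(x := k)) M"
  unfolding wp_def exec.simps[of m "Const x k"] by auto
lemma wp_Move: "wp m (Move x y) R M Q \<longleftrightarrow> Q 1 (R(x := R y)) M"
  unfolding wp_def exec.simps[of m "Move x y"] by auto
lemma wp_Add: "wp m (Add x y z) R M Q \<longleftrightarrow> R y + R z < m \<and> Q 1 (R(x := R y + R z)) M"
  unfolding wp_def exec.simps[of m "Add x y z"] by auto
lemma wp_Sub: "wp m (Sub x y z) R M Q \<longleftrightarrow> Q 1 (R(x := R y - R z)) M"
  unfolding wp_def exec.simps[of m "Sub x y z"] by auto
lemma wp_Load: "wp m (Load x y) R M Q \<longleftrightarrow> R y < m \<and> Q 1 (R(x := M (R y))) M"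
  unfolding wp_def exec.simps[of m "Load x y"] by auto
lemma wp_Store: "wp m (Store x y) R M Q \<longleftrightarrow> R x < m \<and> Q 1 R (M(R x := R y))"
  unfolding wp_def exec.simps[of m "Store x y"] by auto
lemma wp_Seq: "wp m (Seq c d) R M Q \<longleftrightarrow> wp m c R M (\<lambda>t R' M'. wp m d R' M' (\<lambda>u. Q (t + u)))"
  unfolding wp_def exec.simps[of m "Seq c d"] by fastforce
lemma wp_Cond:
  "wp m (Cond b c d) R M Q \<longleftrightarrow>
     (if holds b R then wp m c R M (\<lambda>t. Q (1 + t)) else wp m d R M (\<lambda>t. Q (1 + t)))"
  unfolding wp_def exec.simps[of m "Cond b c d"] by auto

lemmas wp_simps = wp_Skip wp_Const wp_Move wp_Add wp_Sub wp_Load wp_Store wp_Seq wp_Cond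

lemma wp_SeqI:
  assumes "wp m c R M P" "\<And>t R' M'. P t R' M' \<Longrightarrow> wp m d R' M' (\<lambda>u. Q (t + u))"
  shows "wp m (Seq c d) R M Q"
  unfolding wp_Seq using assms by (rule wp_mono)

text \<open>The measure bounds the number of rounds, each of at most \<open>K\<close> steps and one
  test; the last 1 is the failing test.\<close>

lemma wp_while:
  assumes "I R M"
    and "\<And>R M. I R M \<Longrightarrow> holds b R \<Longrightarrow> wp m c R M (\<lambda>t R' M'. t \<le> K \<and> I R' M' \<and> \<mu> R' M' < \<mu> R M)"
  shows "wp m (While b c) R M (\<lambda>t R' M'. t \<le> \<mu> R M * Suc K + 1 \<and> I R' M' \<and> \<not> holds b R')"
  using assms(1)
proof (induction "\<mu> R M" arbitrary: R M rule: less_induct)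
  case less
  show ?case
  proof (cases "holds b R")
    case False
    then show ?thesis using less(2) exec.WhileFalse[of b "(R, M)" m c] unfolding wp_def by force
  next
    case True
    obtain t R1 M1 where 1: "exec m c (R, M) t (R1, M1)" "t \<le> K" "I R1 M1" "\<mu> R1 M1 < \<mu> R M"
      using assms(2)[OF less(2) True] unfolding wp_def by blast
    obtain u R2 M2 where 2: "exec m (While b c) (R1, M1) u (R2, M2)" "u \<le> \<mu> R1 M1 * Suc K + 1"
        "I R2 M2" "\<not> holds b R2"
      using less(1)[OF 1(4,3)] unfolding wp_def by blast
    have "exec m (While b c) (R, M) (1 + t + u) (R2, M2)" using True 1(1) 2(1) by (intro exec.WhileTrue) auto
    moreover have "Suc (\<mu> R1 M1) * Suc K \<le> \<mu> R M * Suc K" using 1(4) by (intro mult_right_mono) auto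
    then have "1 + t + u \<le> \<mu> R M * Suc K + 1" using 1(2) 2(2) by simp
    ultimately show ?thesis using 2(3,4) unfolding wp_def by blast
  qed
qed

section \<open>A linear-time program for the successor rule\<close>

text \<open>
  Register 0 holds \<open>n\<close>, register 1 holds 1, register 10 holds 0 and register 16 holds \<open>2n\<close>. The input lies
  at address 0; strings to be tested are built at addresses \<open>n\<close> and \<open>2n\<close>. Register 13 is a scan address or a
  rotation offset, register 8 the result of a test, register 14 records whether a condition for complementing
  the first bit holds, and register 15 keeps that bit. Registers 3 to 7 are scratch.
\<close>

definition buf :: "(nat \<Rightarrow> nat) \<Rightarrow> nat \<Rightarrow> bool list \<Rightarrow> bool" where
  "buf M b x \<longleftrightarrow> (\<forall>i<length x. M (b + i) = of_bool (x ! i))"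

text \<open>There is no bound test: the caller guarantees a cell with a different letter, at which
  the scan stops.\<close>

definition scan_up :: "reg \<Rightarrow> com" where
  "scan_up v = Seq (Load 6 13) (While (Equal 6 v) (Seq (Add 13 13 1) (Load 6 13)))"

definition scan_down :: "reg \<Rightarrow> com" where
  "scan_down v = Seq (Load 6 13) (While (Equal 6 v) (Seq (Sub 13 13 1) (Load 6 13)))"

lemma scan_up_wp:
  assumes v: "v \<noteq> 6" "v \<noteq> 13" and one: "R 1 = 1" and m: "R 13 + k < m"
    and eq: "\<And>i. i < k \<Longrightarrow> M (R 13 + i) = R v" and ne: "M (R 13 + k) \<noteq> R v"
  shows "wp m (scan_up v) R M (\<lambda>t R' M'. t \<le> 3 * k + 2 \<and> M' = M \<and> R' = R(13 := R 13 + k, 6 := M (R 13 + k)))"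
proof -
  define I where "I R' M' \<longleftrightarrow> M' = M \<and> (\<exists>i\<le>k. R' = R(13 := R 13 + i, 6 := M (R 13 + i)))" for R' M'
  define R1 where "R1 = R(6 := M (R 13))"
  have "R1 = R(13 := R 13 + 0, 6 := M (R 13 + 0))" by (simp add: R1_def)
  then have "I R1 M" unfolding I_def by blast
  then have "wp m (While (Equal 6 v) (Seq (Add 13 13 1) (Load 6 13))) R1 M
     (\<lambda>t R' M'. t \<le> (R 13 + k - R1 13) * Suc 2 + 1 \<and> I R' M' \<and> \<not> holds (Equal 6 v) R')"
  proof (rule wp_while[where I = I and \<mu> = "\<lambda>R' M'. R 13 + k - R' 13"])
    fix R' M' assume I: "I R' M'" and h: "holds (Equal 6 v) R'"
    from I obtain i where i: "i \<le> k" "R' = R(13 := R 13 + i, 6 := M (R 13 + i))" "M' = M" by (auto simp: I_def)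
    have "i \<noteq> k" using h i ne v by auto
    then have ik: "i < k" using i by simp
    have up: "R'(13 := Suc (R 13 + i), 6 := M (Suc (R 13 + i))) = R(13 := R 13 + Suc i, 6 := M (R 13 + Suc i))"
      using i by (simp add: fun_eq_iff)
    have "I (R'(13 := Suc (R 13 + i), 6 := M (Suc (R 13 + i)))) M" unfolding I_def up using ik by (auto intro: Suc_leI)
    then show "wp m (Seq (Add 13 13 1) (Load 6 13)) R' M' (\<lambda>t R'' M''. t \<le> 2 \<and> I R'' M'' \<and> R 13 + k - R'' 13 < R 13 + k - R' 13)"
      using m ik i(3) one unfolding wp_simps by (simp add: i(2))
  qed
  then have "wp m (While (Equal 6 v) (Seq (Add 13 13 1) (Load 6 13))) R1 M
     (\<lambda>t R' M'. t \<le> 3 * k + 1 \<and> M' = M \<and> R' = R(13 := R 13 + k, 6 := M (R 13 + k)))"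
  proof (rule wp_mono, elim conjE)
    fix t R' M' assume t: "t \<le> (R 13 + k - R1 13) * Suc 2 + 1" and I: "I R' M'" and h: "\<not> holds (Equal 6 v) R'"
    from I obtain i where i: "i \<le> k" "R' = R(13 := R 13 + i, 6 := M (R 13 + i))" "M' = M" by (auto simp: I_def)
    then have "i = k" using h eq[of i] v by (cases "i = k") auto
    then show "t \<le> 3 * k + 1 \<and> M' = M \<and> R' = R(13 := R 13 + k, 6 := M (R 13 + k))" using t i by (simp add: R1_def)
  qed
  then have "wp m (While (Equal 6 v) (Seq (Add 13 13 1) (Load 6 13))) R1 M
     (\<lambda>t R' M'. 1 + t \<le> 3 * k + 2 \<and> M' = M \<and> R' = R(13 := R 13 + k, 6 := M (R 13 + k)))"
    by (rule wp_mono) auto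
  then show ?thesis unfolding scan_up_def using m by (simp add: wp_simps R1_def)
qed

lemma scan_down_wp:
  assumes v: "v \<noteq> 6" "v \<noteq> 13" and one: "R 1 = 1" and m: "R 13 < m" "k \<le> R 13"
    and eq: "\<And>i. i < k \<Longrightarrow> M (R 13 - i) = R v" and ne: "M (R 13 - k) \<noteq> R v"
  shows "wp m (scan_down v) R M (\<lambda>t R' M'. t \<le> 3 * k + 2 \<and> M' = M \<and> R' = R(13 := R 13 - k, 6 := M (R 13 - k)))"
proof -
  define I where "I R' M' \<longleftrightarrow> M' = M \<and> (\<exists>i\<le>k. R' = R(13 := R 13 - i, 6 := M (R 13 - i)))" for R' M'
  define R1 where "R1 = R(6 := M (R 13))"
  have "R1 = R(13 := R 13 - 0, 6 := M (R 13 - 0))" by (simp add: R1_def)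
  then have "I R1 M" unfolding I_def by blast
  then have "wp m (While (Equal 6 v) (Seq (Sub 13 13 1) (Load 6 13))) R1 M
     (\<lambda>t R' M'. t \<le> (R1 13 - (R 13 - k)) * Suc 2 + 1 \<and> I R' M' \<and> \<not> holds (Equal 6 v) R')"
  proof (rule wp_while[where I = I and \<mu> = "\<lambda>R' M'. R' 13 - (R 13 - k)"])
    fix R' M' assume I: "I R' M'" and h: "holds (Equal 6 v) R'"
    from I obtain i where i: "i \<le> k" "R' = R(13 := R 13 - i, 6 := M (R 13 - i))" "M' = M" by (auto simp: I_def)
    have "i \<noteq> k" using h i ne v by auto
    then have ik: "i < k" using i by simp
    have up: "R'(13 := R 13 - Suc i, 6 := M (R 13 - Suc i)) = R(13 := R 13 - Suc i, 6 := M (R 13 - Suc i))"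
      using i by (simp add: fun_eq_iff)
    have "I (R'(13 := R 13 - Suc i, 6 := M (R 13 - Suc i))) M" unfolding I_def up using ik by (auto intro: Suc_leI)
    then show "wp m (Seq (Sub 13 13 1) (Load 6 13)) R' M' (\<lambda>t R'' M''. t \<le> 2 \<and> I R'' M'' \<and> R'' 13 - (R 13 - k) < R' 13 - (R 13 - k))"
      using m ik i(3) one unfolding wp_simps by (simp add: i(2)) linarith
  qed
  then have "wp m (While (Equal 6 v) (Seq (Sub 13 13 1) (Load 6 13))) R1 M
     (\<lambda>t R' M'. 1 + t \<le> 3 * k + 2 \<and> M' = M \<and> R' = R(13 := R 13 - k, 6 := M (R 13 - k)))"
  proof (rule wp_mono, elim conjE)
    fix t R' M' assume t: "t \<le> (R1 13 - (R 13 - k)) * Suc 2 + 1" and I: "I R' M'" and h: "\<not> holds (Equal 6 v) R'"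
    from I obtain i where i: "i \<le> k" "R' = R(13 := R 13 - i, 6 := M (R 13 - i))" "M' = M" by (auto simp: I_def)
    then have "i = k" using h eq[of i] v by (cases "i = k") auto
    then show "1 + t \<le> 3 * k + 2 \<and> M' = M \<and> R' = R(13 := R 13 - k, 6 := M (R 13 - k))" using t i m by (simp add: R1_def)
  qed
  then show ?thesis unfolding scan_down_def using m by (simp add: wp_simps R1_def)
qed

text \<open>Offset plus counter stays below \<open>2 * n\<close>, so one conditional subtraction
  computes the remainder. The target lies above the source, which therefore stays intact.\<close>

definition copy_rotated :: "reg \<Rightarrow> reg \<Rightarrow> com" where
  "copy_rotated src dst = Seq (Move 4 10) (While (Less 4 0)
     (Seq (Add 5 4 13) (Seq (Cond (Less 5 0) Skip (Sub 5 5 0)) (Seq (Add 5 5 src) (Seq (Load 6 5)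
     (Seq (Add 5 4 dst) (Seq (Store 5 6) (Add 4 4 1))))))))"

lemma copy_rotated_wp:
  assumes regs: "src \<notin> {4,5,6}" "dst \<notin> {4,5,6}" and R: "R 1 = 1" "R 10 = 0" "R 0 = n"
    and x: "length x = n" "buf M (R src) x" and off: "R 13 \<le> n"
    and disj: "R src + n \<le> R dst" and m: "R dst + n < m" "2 * n < m"
  shows "wp m (copy_rotated src dst) R M (\<lambda>t R' M'. t \<le> 10 * n + 2
     \<and> (\<forall>r. r \<notin> {4,5,6} \<longrightarrow> R' r = R r) \<and> (\<forall>a. a < R dst \<longrightarrow> M' a = M a)
     \<and> buf M' (R dst) (rotate (R 13) x))"
proof -
  define I where "I R' M' \<longleftrightarrow> (\<forall>r. r \<notin> {4,5,6} \<longrightarrow> R' r = R r) \<and> R' 4 \<le> n \<and> (\<forall>a. a < R dst \<longrightarrow> M' a = M a)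
     \<and> (\<forall>i<R' 4. M' (R dst + i) = of_bool (rotate (R 13) x ! i))" for R' M'
  define body where "body = (Seq (Add 5 4 13) (Seq (Cond (Less 5 0) Skip (Sub 5 5 0)) (Seq (Add 5 5 src) (Seq (Load 6 5)
     (Seq (Add 5 4 dst) (Seq (Store 5 6) (Add 4 4 1)))))))"
  define R1 where "R1 = R(4 := 0)"
  have "I R1 M" unfolding I_def R1_def by auto
  then have "wp m (While (Less 4 0) body) R1 M
     (\<lambda>t R' M'. t \<le> (n - R1 4) * Suc 9 + 1 \<and> I R' M' \<and> \<not> holds (Less 4 0) R')"
  proof (rule wp_while[where I = I and \<mu> = "\<lambda>R' M'. n - R' 4"])
    fix R' M' assume I: "I R' M'" and h: "holds (Less 4 0) R'"
    have same: "R' 0 = n" "R' 1 = 1" "R' 13 = R 13" "R' src = R src" "R' dst = R dst"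
      using I R regs unfolding I_def by auto
    define k where "k = R' 4"
    have k: "k < n" using h same by (simp add: k_def)
    define idx where "idx = (if k + R 13 < n then k + R 13 else k + R 13 - n)"
    have idx: "idx < n" "idx = (R 13 + k) mod n" using k off by (auto simp: idx_def add.commute le_mod_geq)
    have src: "M' (R src + idx) = of_bool (rotate (R 13) x ! k)"
    proof -
      have "R src + idx < R dst" using idx(1) disj by simp
      then have "M' (R src + idx) = M (R src + idx)" using I unfolding I_def by blast
      also have "\<dots> = of_bool (x ! idx)" using x idx(1) unfolding buf_def by simp
      finally show ?thesis using nth_rotate[of k x "R 13"] k x(1) idx(2) by simp
    qed
    have rest: "wp m (Seq (Add 5 5 src) (Seq (Load 6 5) (Seq (Add 5 4 dst) (Seq (Store 5 6) (Add 4 4 1))))) (R'(5 := idx)) M'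
       (\<lambda>t R'' M''. t \<le> 5 \<and> I R'' M'' \<and> n - R'' 4 < n - R' 4)"
    proof -
      have b: "idx + R src < m" "k + R dst < m" "k + 1 < m" "idx + R src < R dst" using idx(1) k disj m by auto
      have new: "I R'' (M'(k + R dst := M' (idx + R src)))"
        if "R'' 4 = Suc k" "\<And>r. r \<notin> {4,5,6} \<Longrightarrow> R'' r = R' r" for R''
        unfolding I_def
      proof (intro conjI allI impI)
        fix r assume "r \<notin> {4, 5, 6::nat}"
        then show "R'' r = R r" using I that(2) unfolding I_def by simp
      next
        show "R'' 4 \<le> n" using k that by simp
      next
        fix a assume "a < R dst"
        then show "(M'(k + R dst := M' (idx + R src))) a = M a" using I unfolding I_def by auto
      next
        fix i assume "i < R'' 4"
        then show "(M'(k + R dst := M' (idx + R src))) (R dst + i) = of_bool (rotate (R 13) x ! i)"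
          using I src that unfolding I_def k_def by (cases "i = R' 4") (simp_all add: add.commute)
      qed
      show ?thesis unfolding wp_simps
        using b same regs k by (auto simp: k_def[symmetric] intro!: new split: if_splits)
    qed
    have "k + R 13 < m" using k off m by auto
    then show "wp m body R' M' (\<lambda>t R'' M''. t \<le> 9 \<and> I R'' M'' \<and> n - R'' 4 < n - R' 4)"
      unfolding body_def wp_Seq[of m "Add 5 4 13"] wp_Seq[of m "Cond (Less 5 0) Skip (Sub 5 5 0)"] wp_Add wp_Cond wp_Skip wp_Sub
      using same k wp_mono[OF rest, of "\<lambda>t R'' M''. Suc (Suc (Suc t)) \<le> 9 \<and> I R'' M'' \<and> n - R'' 4 < n - R' 4"]
      by (auto simp: k_def[symmetric] idx_def)
  qed
  then have "wp m (While (Less 4 0) body) R1 M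
     (\<lambda>t R' M'. 1 + t \<le> 10 * n + 2 \<and> (\<forall>r. r \<notin> {4,5,6} \<longrightarrow> R' r = R r) \<and> (\<forall>a. a < R dst \<longrightarrow> M' a = M a)
     \<and> buf M' (R dst) (rotate (R 13) x))"
  proof (rule wp_mono, elim conjE)
    fix t R' M' assume t: "t \<le> (n - R1 4) * Suc 9 + 1" and I: "I R' M'" and h: "\<not> holds (Less 4 0) R'"
    have "R' 0 = n" using I R(3) unfolding I_def by auto
    then have "R' 4 = n" using h I unfolding I_def by simp
    then show "1 + t \<le> 10 * n + 2 \<and> (\<forall>r. r \<notin> {4,5,6} \<longrightarrow> R' r = R r) \<and> (\<forall>a. a < R dst \<longrightarrow> M' a = M a)
     \<and> buf M' (R dst) (rotate (R 13) x)" using t I x unfolding I_def buf_def R1_def by auto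
  qed
  then show ?thesis unfolding copy_rotated_def body_def[symmetric] using R by (simp add: wp_simps R1_def)
qed


section \<open>Comparing a string with all rotations in linear time\<close>

lemma mismatch_less:
  fixes u v :: "bool list"
  assumes "length u = length v" "k < length u" "\<And>i. i < k \<Longrightarrow> u ! i = v ! i" "\<not> u ! k" "v ! k"
  shows "u < v"
proof -
  have "take k u = take k v" using assms by (intro nth_equalityI) auto
  moreover have "u = take k u @ u ! k # drop (Suc k) u" "v = take k v @ v ! k # drop (Suc k) v"
    using assms(1,2) by (metis id_take_nth_drop)+
  ultimately have "u = take k v @ False # drop (Suc k) u" "v = take k v @ True # drop (Suc k) v" using assms(4,5) by simp_all
  moreover have "take k v @ False # drop (Suc k) u < take k v @ True # drop (Suc k) v" by (simp add: lex_append_less)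
  ultimately show ?thesis by simp
qed

text \<open>The two passes of the membership test: \<open>rv\<close> selects the comparison with the rotations of the
  reversal, which must be strict.\<close>
definition rot_ok :: "bool \<Rightarrow> bool list \<Rightarrow> nat \<Rightarrow> bool" where
  "rot_ok rv x i \<longleftrightarrow> (if rv then x < rotate i (rev x) else x \<le> rotate i x)"

definition rot_src :: "bool \<Rightarrow> bool list \<Rightarrow> bool list" where
  "rot_src rv x = (if rv then rev x else x)"

lemma rot_ok_alt: "rot_ok rv x i \<longleftrightarrow> (if rv then x < rotate i (rot_src rv x) else x \<le> rotate i (rot_src rv x))"
  by (simp add: rot_ok_def rot_src_def)

context
  fixes x y :: "bool list" and rv :: bool and n j k :: nat
  assumes y: "y = rot_src rv x" and n: "length x = n" and jk: "j < n" "k < n"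
    and eq: "\<forall>i<k. x ! i = y ! ((j + i) mod n)"
    and ok: "\<forall>i<j. rot_ok rv x i"
    and rv: "rv \<longrightarrow> (\<forall>i. x \<le> rotate i x)" and nrv: "\<not> rv \<longrightarrow> j \<ge> 1"
begin

lemma rot_src_length: "length y = n" using y n by (simp add: rot_src_def)

text \<open>The string equals rotation \<open>j\<close>. For the reversal this breaks strictness. In
  the other pass \<open>j >= 1\<close> is a period, so the rotations not yet examined repeat those
  already known to be fine.\<close>

lemma step_full:
  assumes "x ! k = y ! ((j + k) mod n)" "Suc k = n"
  shows "(\<forall>i<n. rot_ok rv x i) \<longleftrightarrow> \<not> rv"
proof -
  have xr: "x = rotate j y"
  proof (rule nth_equalityI)
    show "length x = length (rotate j y)" using n rot_src_length by simp
    fix i assume "i < length x"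
    then have i: "i < n" using n by simp
    then show "x ! i = rotate j y ! i" using eq assms rot_src_length nth_rotate[of i y j] by (cases "i = k") auto
  qed
  show ?thesis
  proof (cases rv)
    case True
    then have "\<not> rot_ok rv x j" using xr y by (simp add: rot_ok_alt)
    then show ?thesis using True jk by auto
  next
    case False
    have "rot_ok rv x i" for i
    proof (induction i rule: less_induct)
      case (less i)
      show ?case
      proof (cases "i < j")
        case True then show ?thesis using ok by simp
      next
        case False
        have yx: "y = x" using \<open>\<not> rv\<close> y by (simp add: rot_src_def)
        have "rotate i x = rotate (i - j) (rotate j x)" using False by (simp add: rotate_rotate)
        also have "\<dots> = rotate (i - j) x" using xr yx by simp
        finally show ?thesis using less[of "i - j"] False nrv \<open>\<not> rv\<close> by (simp add: rot_ok_def)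
      qed
    qed
    then show ?thesis using False by simp
  qed
qed

lemma step_greater:
  assumes "x ! k" "\<not> y ! ((j + k) mod n)"
  shows "\<not> rot_ok rv x j"
proof -
  have "rotate j y < x"
    by (rule mismatch_less[of _ _ k]) (use assms eq n rot_src_length jk in \<open>auto simp: nth_rotate\<close>)
  then show ?thesis using y by (auto simp: rot_ok_alt)
qed

text \<open>A mismatch after \<open>k\<close> steps settles the rotations \<open>j, \<dots>, j + k\<close> at once, since rotation \<open>j + l\<close>
  exceeds rotation \<open>l\<close> of \<open>x\<close>.\<close>
lemma step_less:
  assumes "\<not> x ! k" "y ! ((j + k) mod n)" "i < Suc (j + k)"
  shows "rot_ok rv x i"
proof -
  \<comment> \<open>Dropping \<open>l\<close> agreeing letters on both sides moves the mismatch to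
    place \<open>k - l\<close>.\<close>
  have less: "rotate l x < rotate (j + l) y" if "l \<le> k" for l
  proof (rule mismatch_less[of _ _ "k - l"])
    show "length (rotate l x) = length (rotate (j + l) y)" using n rot_src_length by simp
    show "k - l < length (rotate l x)" using jk n by simp
    show "rotate l x ! i = rotate (j + l) y ! i" if "i < k - l" for i
      using that eq[rule_format, of "l + i"] jk n rot_src_length by (simp add: nth_rotate add.assoc)
    show "\<not> rotate l x ! (k - l)" using that assms(1) jk n by (simp add: nth_rotate)
    show "rotate (j + l) y ! (k - l)" using that assms(2) jk rot_src_length by (simp add: nth_rotate)
  qed
  have "i \<le> j + k \<Longrightarrow> rot_ok rv x i" for i
  proof (induction i rule: less_induct)
    case (less i)
    show ?case
    proof (cases "i < j")
      case True then show ?thesis using ok by simp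
    next
      case False
      then have lt: "rotate (i - j) x < rotate i y" using \<open>\<And>l. l \<le> k \<Longrightarrow> rotate l x < rotate (j + l) y\<close>[of "i - j"] less(2) by simp
      show ?thesis
      proof (cases rv)
        case True
        \<comment> \<open>In the second pass \<open>x\<close> is already known to be a
          necklace.\<close>
        then have "x \<le> rotate (i - j) x" using rv by blast
        then show ?thesis using lt True y by (simp add: rot_ok_alt)
      next
        case nr: False
        \<comment> \<open>In the first pass rotation \<open>i - j\<close> comes earlier, because
          \<open>j >= 1\<close>, and is settled by induction.\<close>
        then have "x \<le> rotate (i - j) x" using less(1)[of "i - j"] less(2) False nr nrv by (simp add: rot_ok_def)
        then show ?thesis using lt nr y by (simp add: rot_ok_alt)
      qed
    qed
  qed
  then show ?thesis using assms(3) by simp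
qed

end

text \<open>Registers 3 and 4 hold the rotation \<open>j\<close> and the number \<open>k\<close> of
  agreeing letters. The reversal is never stored: its letters are found by mirroring the index.
  Setting register 3 to \<open>n\<close> ends the pass.\<close>

definition pass_body :: "reg \<Rightarrow> bool \<Rightarrow> com" where
  "pass_body bs rv =
     Seq (Add 5 3 4) (Seq (Cond (Less 5 0) Skip (Sub 5 5 0))
     (Seq (if rv then Seq (Sub 5 0 5) (Sub 5 5 1) else Skip)
     (Seq (Add 5 5 bs) (Seq (Load 7 5) (Seq (Add 5 4 bs) (Seq (Load 6 5)
     (Cond (Equal 6 7)
        (Seq (Add 4 4 1) (Cond (Equal 4 0) (Seq (Move 3 0) (if rv then Move 8 10 else Skip)) Skip))
        (Cond (Less 6 7) (Seq (Add 3 3 4) (Seq (Add 3 3 1) (Move 4 10)))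
          (Seq (Move 8 10) (Move 3 0))))))))))"

definition pass :: "reg \<Rightarrow> bool \<Rightarrow> com" where
  "pass bs rv = Seq (Move 8 1) (Seq (Move 3 (if rv then 10 else 1)) (Seq (Move 4 10)
     (While (Less 3 0) (pass_body bs rv))))"

text \<open>The second alternative describes a finished pass; skipping rotations may have carried
  register 3 beyond \<open>n\<close>.\<close>

definition pass_inv :: "bool \<Rightarrow> bool list \<Rightarrow> nat \<Rightarrow> (reg \<Rightarrow> nat) \<Rightarrow> bool" where
  "pass_inv rv x n R \<longleftrightarrow>
     R 3 < n \<and> R 4 < n \<and> R 8 = 1 \<and> (\<forall>i<R 4. x ! i = rot_src rv x ! ((R 3 + i) mod n))
       \<and> (\<forall>i<R 3. rot_ok rv x i) \<and> (\<not> rv \<longrightarrow> R 3 \<ge> 1)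
   \<or> n \<le> R 3 \<and> R 8 = of_bool (\<forall>i<n. rot_ok rv x i)"

text \<open>A match increases \<open>k\<close>, and a mismatch in favour of the string turns
  \<open>(j, k)\<close> into \<open>(j + k + 1, 0)\<close>. So \<open>j + k\<close> grows in every
  round, while it is below \<open>2 * n\<close> at the start of each; this is the source of the
  linear bound.\<close>

lemma pass_body_wp:
  assumes bs: "bs \<notin> {3,4,5,6,7,8}" and R: "R 1 = 1" "R 10 = 0" "R 0 = n"
    and x: "length x = n" "buf M (R bs) x" and m: "R bs + n \<le> m" "2 * n < m"
    and rv: "rv \<longrightarrow> (\<forall>i. x \<le> rotate i x)"
    and inv: "pass_inv rv x n R" and run: "R 3 < n"
  shows "wp m (pass_body bs rv) R M (\<lambda>t R' M'. t \<le> 15 \<and> M' = M \<and> (\<forall>r. r \<notin> {3,4,5,6,7,8} \<longrightarrow> R' r = R r)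
     \<and> pass_inv rv x n R' \<and> R 3 + R 4 < R' 3 + R' 4 \<and> R 3 + R 4 < 2 * n)"
proof -
  define j k y where "j = R 3" and "k = R 4" and "y = rot_src rv x"
  have jk: "j < n" "k < n" and f: "R 8 = 1" and eq: "\<forall>i<k. x ! i = y ! ((j + i) mod n)"
    and ok: "\<forall>i<j. rot_ok rv x i" and nrv: "\<not> rv \<longrightarrow> j \<ge> 1"
    using inv run unfolding pass_inv_def j_def k_def y_def by auto
  define idx where "idx = (if j + k < n then j + k else j + k - n)"
  have idx: "idx < n" "idx = (j + k) mod n" using jk by (auto simp: idx_def le_mod_geq)
  define idx' where "idx' = (if rv then n - idx - 1 else idx)"
  have idx': "idx' < n" "x ! idx' = y ! ((j + k) mod n)"
    using idx x(1) by (auto simp: idx'_def y_def rot_src_def rev_nth)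
  have Mx: "M (i + R bs) = of_bool (x ! i)" if "i < n" for i using x that by (simp add: buf_def add.commute)
  note full = step_full[OF y_def x(1) jk eq ok rv nrv]
  note greater = step_greater[OF y_def x(1) jk eq ok rv nrv]
  note less = step_less[OF y_def x(1) jk eq ok rv nrv]
  define fin where "fin t R' M' \<longleftrightarrow> M' = M \<and> (\<forall>r. r \<notin> {3,4,5,6,7,8} \<longrightarrow> R' r = R r)
     \<and> pass_inv rv x n R' \<and> R 3 + R 4 < R' 3 + R' 4 \<and> R 3 + R 4 < 2 * n" for t :: nat and R' M'
  define S where "S = R(7 := of_bool (x ! idx'), 5 := k + R bs, 6 := of_bool (x ! k))"
  have S: "S 0 = n" "S 1 = 1" "S 10 = 0" "S 3 = j" "S 4 = k" "S 8 = 1" "S 6 = of_bool (x ! k)" "S 7 = of_bool (x ! idx')"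
    "\<And>r. r \<notin> {3,4,5,6,7,8} \<Longrightarrow> S r = R r"
    using R f by (auto simp: S_def j_def k_def)
  have tail: "wp m (Cond (Equal 6 7)
        (Seq (Add 4 4 1) (Cond (Equal 4 0) (Seq (Move 3 0) (if rv then Move 8 10 else Skip)) Skip))
        (Cond (Less 6 7) (Seq (Add 3 3 4) (Seq (Add 3 3 1) (Move 4 10)))
          (Seq (Move 8 10) (Move 3 0)))) S M (\<lambda>t R' M'. t \<le> 5 \<and> fin t R' M')"
  proof (cases "x ! k = x ! idx'")
    case True
    then have e: "x ! k = y ! ((j + k) mod n)" using idx' by simp
    show ?thesis
    proof (cases "Suc k = n")
      case T: True
      show ?thesis
      proof (cases rv)
        case True
        have "pass_inv rv x n (S(4 := Suc k, 3 := n, 8 := 0))"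
          using full[OF e T] True unfolding pass_inv_def by simp
        then show ?thesis using S T True \<open>x ! k = x ! idx'\<close> jk m(2)
          unfolding fin_def by (auto simp: wp_simps j_def[symmetric] k_def[symmetric])
      next
        case False
        have "pass_inv rv x n (S(4 := Suc k, 3 := n))"
          using full[OF e T] False S unfolding pass_inv_def by simp
        then show ?thesis using S T False \<open>x ! k = x ! idx'\<close> jk m(2)
          unfolding fin_def by (auto simp: wp_simps j_def[symmetric] k_def[symmetric])
      qed
    next
      case F: False
      have "x ! i = y ! ((j + i) mod n)" if "i < Suc k" for i using that eq e by (cases "i = k") auto
      then have "pass_inv rv x n (S(4 := Suc k))"
        using F S jk ok nrv unfolding pass_inv_def y_def by simp
      then show ?thesis using S F True jk m(2)
        unfolding fin_def by (auto simp: wp_simps j_def[symmetric] k_def[symmetric])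
    qed
  next
    case False
    show ?thesis
    proof (cases "x ! k")
      case True
      then have "\<not> rot_ok rv x j" using greater False idx' by simp
      then have "pass_inv rv x n (S(8 := 0, 3 := n))" using jk unfolding pass_inv_def by auto
      then show ?thesis using S False True jk m(2)
        unfolding fin_def by (auto simp: wp_simps j_def[symmetric] k_def[symmetric])
    next
      case F: False
      then have g: "rot_ok rv x i" if "i < Suc (j + k)" for i using less[OF F _ that] False idx' by simp
      have "pass_inv rv x n (S(3 := Suc (j + k), 4 := 0))"
        using g jk S unfolding pass_inv_def by (cases "Suc (j + k) < n") auto
      then show ?thesis using S False F jk m(2)
        unfolding fin_def by (auto simp: wp_simps j_def[symmetric] k_def[symmetric])
    qed
  qed
  have "R(5 := idx' + R bs, 7 := M (idx' + R bs), 5 := k + R bs, 6 := M (k + R bs)) = S"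
    using Mx[OF idx'(1)] Mx[OF jk(2)] by (simp add: S_def fun_eq_iff)
  then have mid: "wp m (Seq (Add 5 5 bs) (Seq (Load 7 5) (Seq (Add 5 4 bs) (Seq (Load 6 5)
     (Cond (Equal 6 7)
        (Seq (Add 4 4 1) (Cond (Equal 4 0) (Seq (Move 3 0) (if rv then Move 8 10 else Skip)) Skip))
        (Cond (Less 6 7) (Seq (Add 3 3 4) (Seq (Add 3 3 1) (Move 4 10)))
          (Seq (Move 8 10) (Move 3 0)))))))) (R(5 := idx')) M (\<lambda>t R' M'. t \<le> 9 \<and> fin t R' M')"
    using idx'(1) jk m bs wp_mono[OF tail, of "\<lambda>t R' M'. Suc (Suc (Suc (Suc t))) \<le> 9 \<and> fin t R' M'"]
    unfolding wp_Seq[of m "Add 5 5 bs"] wp_Seq[of m "Load 7 5"] wp_Seq[of m "Add 5 4 bs"] wp_Seq[of m "Load 6 5"] wp_Add wp_Load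
    by (auto simp: k_def[symmetric] fin_def)
  have idx0: "wp m (if rv then Seq (Sub 5 0 5) (Sub 5 5 1) else Skip) (R(5 := idx)) M (\<lambda>t R' M'. t \<le> 2 \<and> R' = R(5 := idx') \<and> M' = M)"
    using R by (auto simp: wp_simps idx'_def)
  have idx1: "wp m (Cond (Less 5 0) Skip (Sub 5 5 0)) (R(5 := j + k)) M (\<lambda>t R' M'. t \<le> 2 \<and> R' = R(5 := idx) \<and> M' = M)"
    using R by (auto simp: wp_simps idx_def)
  have idx2: "wp m (Add 5 3 4) R M (\<lambda>t R' M'. t \<le> 1 \<and> R' = R(5 := j + k) \<and> M' = M)"
    using jk m by (simp add: wp_simps j_def k_def)
  have "wp m (pass_body bs rv) R M (\<lambda>t R' M'. t \<le> 15 \<and> fin t R' M')"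
    unfolding pass_body_def
    apply (rule wp_SeqI[OF idx2], elim conjE, hypsubst)
    apply (rule wp_SeqI[OF idx1], elim conjE, hypsubst)
    apply (rule wp_SeqI[OF idx0], elim conjE, hypsubst)
    by (rule wp_mono[OF mid]) (simp add: fin_def)
  then show ?thesis by (rule wp_mono) (simp add: fin_def)
qed

text \<open>At most \<open>2 * n\<close> rounds of 15 steps and a test give \<open>32 * n\<close>;
  the failing test and three initial moves give 4.\<close>

lemma pass_wp:
  assumes bs: "bs \<notin> {3,4,5,6,7,8}" and R: "R 1 = 1" "R 10 = 0" "R 0 = n" and n: "n \<ge> 2"
    and x: "length x = n" "buf M (R bs) x" and m: "R bs + n \<le> m" "2 * n < m"
    and rv: "rv \<longrightarrow> (\<forall>i. x \<le> rotate i x)"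
  shows "wp m (pass bs rv) R M (\<lambda>t R' M'. t \<le> 32 * n + 4 \<and> M' = M \<and> (\<forall>r. r \<notin> {3,4,5,6,7,8} \<longrightarrow> R' r = R r)
     \<and> R' 8 = of_bool (\<forall>i<n. rot_ok rv x i))"
proof -
  define I where "I R' M' \<longleftrightarrow> M' = M \<and> (\<forall>r. r \<notin> {3,4,5,6,7,8} \<longrightarrow> R' r = R r) \<and> pass_inv rv x n R'" for R' M'
  \<comment> \<open>Rotation 0 is the string itself, so the first pass can start at 1, as its period
    argument requires.\<close>
  define j0 :: nat where "j0 = (if rv then 0 else 1)"
  define R1 where "R1 = R(8 := 1, 3 := j0, 4 := 0)"
  have "pass_inv rv x n R1"
    unfolding pass_inv_def by (rule disjI1) (use n in \<open>simp add: R1_def j0_def rot_ok_def\<close>)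
  then have "I R1 M" unfolding I_def by (simp add: R1_def)
  then have "wp m (While (Less 3 0) (pass_body bs rv)) R1 M
     (\<lambda>t R' M'. t \<le> (2 * n - (R1 3 + R1 4)) * Suc 15 + 1 \<and> I R' M' \<and> \<not> holds (Less 3 0) R')"
  proof (rule wp_while[where I = I and \<mu> = "\<lambda>R' M'. 2 * n - (R' 3 + R' 4)"])
    fix R' M' assume I: "I R' M'" and h: "holds (Less 3 0) R'"
    have R': "R' 1 = 1" "R' 10 = 0" "R' 0 = n" "R' bs = R bs" "M' = M" "pass_inv rv x n R'"
      using I R bs unfolding I_def by auto
    have run: "R' 3 < n" using h R' by simp
    have "wp m (pass_body bs rv) R' M' (\<lambda>t R'' M''. t \<le> 15 \<and> M'' = M' \<and> (\<forall>r. r \<notin> {3,4,5,6,7,8} \<longrightarrow> R'' r = R' r)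
     \<and> pass_inv rv x n R'' \<and> R' 3 + R' 4 < R'' 3 + R'' 4 \<and> R' 3 + R' 4 < 2 * n)"
      by (rule pass_body_wp[OF bs R'(1-3) x(1) _ _ m(2) rv R'(6) run]) (use R' x m in auto)
    then show "wp m (pass_body bs rv) R' M' (\<lambda>t R'' M''. t \<le> 15 \<and> I R'' M'' \<and> 2 * n - (R'' 3 + R'' 4) < 2 * n - (R' 3 + R' 4))"
      by (rule wp_mono) (use I in \<open>auto simp: I_def\<close>)
  qed
  then have "wp m (While (Less 3 0) (pass_body bs rv)) R1 M
     (\<lambda>t R' M'. t \<le> 32 * n + 1 \<and> M' = M \<and> (\<forall>r. r \<notin> {3,4,5,6,7,8} \<longrightarrow> R' r = R r)
     \<and> R' 8 = of_bool (\<forall>i<n. rot_ok rv x i))"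
  proof (rule wp_mono, elim conjE)
    fix t R' M' assume t: "t \<le> (2 * n - (R1 3 + R1 4)) * Suc 15 + 1" and I: "I R' M'" and h: "\<not> holds (Less 3 0) R'"
    have "R' 0 = n" using I R(3) unfolding I_def by auto
    then have "n \<le> R' 3" using h by simp
    moreover have "(2 * n - (R1 3 + R1 4)) * Suc 15 \<le> (2 * n) * Suc 15" by (intro mult_right_mono) auto
    ultimately show "t \<le> 32 * n + 1 \<and> M' = M \<and> (\<forall>r. r \<notin> {3,4,5,6,7,8} \<longrightarrow> R' r = R r)
     \<and> R' 8 = of_bool (\<forall>i<n. rot_ok rv x i)" using t I unfolding I_def pass_inv_def by auto
  qed
  then have "wp m (While (Less 3 0) (pass_body bs rv)) R1 M
     (\<lambda>t R' M'. Suc (Suc (Suc t)) \<le> 32 * n + 4 \<and> M' = M \<and> (\<forall>r. r \<notin> {3,4,5,6,7,8} \<longrightarrow> R' r = R r)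
     \<and> R' 8 = of_bool (\<forall>i<n. rot_ok rv x i))" by (rule wp_mono) simp
  moreover have "R1 = R(8 := 1, 3 := (R(8 := 1)) (if rv then 10 else 1), 4 := 0)" using R by (simp add: R1_def j0_def)
  ultimately show ?thesis unfolding pass_def using R by (simp add: wp_simps)
qed

text \<open>The second pass skips rotations on the strength of the string being a necklace, so it
  runs only after the first pass has succeeded.\<close>

definition asym_test :: "reg \<Rightarrow> com" where
  "asym_test bs = Seq (pass bs False) (Cond (Equal 8 1) (pass bs True) Skip)"

lemma rot_ok_asym:
  assumes "length x = n" "n > 0"
  shows "x \<in> asym_bracelets n \<longleftrightarrow> (\<forall>i<n. rot_ok False x i) \<and> (\<forall>i<n. rot_ok True x i)"
proof -
  have "x \<noteq> []" using assms by auto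
  then show ?thesis unfolding asym_bracelets_iff rot_ok_def using assms by (auto simp: rotations_image)
qed

lemma rot_ok_necklace:
  assumes "length x = n" "n > 0" "\<forall>i<n. rot_ok False x i"
  shows "x \<le> rotate i x"
  using assms rotate_conv_mod[of i x] by (simp add: rot_ok_def)

lemma asym_test_wp:
  assumes bs: "bs \<notin> {3,4,5,6,7,8}" and R: "R 1 = 1" "R 10 = 0" "R 0 = n" and n: "n \<ge> 2"
    and x: "length x = n" "buf M (R bs) x" and m: "R bs + n \<le> m" "2 * n < m"
  shows "wp m (asym_test bs) R M (\<lambda>t R' M'. t \<le> 64 * n + 9 \<and> M' = M \<and> (\<forall>r. r \<notin> {3,4,5,6,7,8} \<longrightarrow> R' r = R r)
     \<and> R' 8 = of_bool (x \<in> asym_bracelets n))"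
  unfolding asym_test_def
proof (rule wp_SeqI[OF pass_wp[OF bs R n x m, of False]], simp, elim conjE)
  fix t R' M' assume h: "t \<le> 32 * n + 4" "M' = M" "\<forall>r. r \<notin> {3,4,5,6,7,8} \<longrightarrow> R' r = R r"
    "R' 8 = of_bool (\<forall>i<n. rot_ok False x i)"
  have R': "R' 1 = 1" "R' 10 = 0" "R' 0 = n" "R' bs = R bs" using h R bs by auto
  let ?Q = "\<lambda>u R'' M''. t + u \<le> 64 * n + 9 \<and> M'' = M \<and> (\<forall>r. r \<notin> {3,4,5,6,7,8} \<longrightarrow> R'' r = R r)
     \<and> R'' 8 = of_bool (x \<in> asym_bracelets n)"
  show "wp m (Cond (Equal 8 1) (pass bs True) Skip) R' M' ?Q"
  proof (cases "\<forall>i<n. rot_ok False x i")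
    case False
    then have "x \<notin> asym_bracelets n" using rot_ok_asym[OF x(1)] n by auto
    moreover have "R' 8 = 0" unfolding h(4) using False by simp
    ultimately show ?thesis using h(1-3) R' by (simp add: wp_simps)
  next
    case True
    have all: "True \<longrightarrow> (\<forall>i. x \<le> rotate i x)" using rot_ok_necklace[OF x(1) _ True] n by simp
    have "x \<in> asym_bracelets n \<longleftrightarrow> (\<forall>i<n. rot_ok True x i)" using rot_ok_asym[OF x(1)] n True by auto
    moreover have "wp m (pass bs True) R' M' (\<lambda>t R'' M''. t \<le> 32 * n + 4 \<and> M'' = M' \<and> (\<forall>r. r \<notin> {3,4,5,6,7,8} \<longrightarrow> R'' r = R' r)
     \<and> R'' 8 = of_bool (\<forall>i<n. rot_ok True x i))"
      by (rule pass_wp[OF bs R'(1-3) n x(1) _ _ m(2) all]) (use R' h x m in auto)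
    then have "wp m (pass bs True) R' M' (\<lambda>u. ?Q (1 + u))"
      by (rule wp_mono) (use h calculation in auto)
    moreover have "R' 8 = 1" unfolding h(4) using True by simp
    ultimately show ?thesis using R' by (simp add: wp_simps)
  qed
qed

section \<open>Testing the results of the three operations\<close>

definition agree :: "(reg \<Rightarrow> nat) \<Rightarrow> (reg \<Rightarrow> nat) \<Rightarrow> bool" where
  "agree R R' \<longleftrightarrow> (\<forall>r. r \<notin> {3,4,5,6,7,8,13} \<longrightarrow> R' r = R r)"

definition const_regs :: "nat \<Rightarrow> (reg \<Rightarrow> nat) \<Rightarrow> bool" where
  "const_regs n R \<longleftrightarrow> R 0 = n \<and> R 1 = 1 \<and> R 10 = 0 \<and> R 16 = 2 * n"

lemma agree_const_regs: "agree R R' \<Longrightarrow> const_regs n R \<Longrightarrow> const_regs n R'"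
  by (simp add: agree_def const_regs_def)

lemma agree_trans: "agree R R' \<Longrightarrow> agree R' R'' \<Longrightarrow> agree R R''"
  by (simp add: agree_def)

lemma buf_update: "buf M b x \<Longrightarrow> k < length x \<Longrightarrow> buf (M(b + k := of_bool c)) b (x[k := c])"
  by (auto simp: buf_def nth_list_update)

lemma buf_cong: "buf M b x \<Longrightarrow> (\<And>i. i < length x \<Longrightarrow> M' (b + i) = M (b + i)) \<Longrightarrow> buf M' b x"
  by (simp add: buf_def)

text \<open>The letter is flipped in place and restored afterwards; its address in register 13
  survives the test.\<close>

definition first_one_test :: com where
  "first_one_test = Seq (Move 13 0) (Seq (scan_up 10) (Seq (Store 13 10) (Seq (asym_test 0) (Store 13 1))))"

lemma first_one_test_wp:
  assumes R: "const_regs n R" and n: "n \<ge> 6" and x: "length x = n" "buf M n x" "True \<in> set x"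
  shows "wp (4 * n) first_one_test R M (\<lambda>t R' M'. t \<le> 67 * n + 14 \<and> M' = M \<and> agree R R'
    \<and> R' 8 = of_bool (first_one x \<in> asym_bracelets n))"
proof -
  obtain k u where ku: "x = zeros k @ True # u" using leading_zeros_decomp[OF x(3)] .
  have k: "k < n" using ku x(1) by auto
  have R0: "R 0 = n" "R 1 = 1" "R 10 = 0" "R 16 = 2 * n" using R by (auto simp: const_regs_def)
  have fo: "first_one x = x[k := False]" using ku first_one_eq[of k u] by (simp add: replicate_app_Cons_same list_update_append)
  have Mx: "M (n + i) = of_bool (x ! i)" if "i < n" for i using x that by (simp add: buf_def)
  define R1 where "R1 = R(13 := n)"
  define R2 where "R2 = R1(13 := n + k, 6 := M (n + k))"
  have 1: "wp (4 * n) (Move 13 0) R M (\<lambda>t R' M'. t \<le> 1 \<and> M' = M \<and> R' = R1)" using R0 by (simp add: wp_simps R1_def)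
  have 2: "wp (4 * n) (scan_up 10) R1 M (\<lambda>t R' M'. t \<le> 3 * k + 2 \<and> M' = M \<and> R' = R2)"
  proof -
    have "wp (4 * n) (scan_up 10) R1 M (\<lambda>t R' M'. t \<le> 3 * k + 2 \<and> M' = M \<and> R' = R1(13 := R1 13 + k, 6 := M (R1 13 + k)))"
      by (rule scan_up_wp) (use R0 k Mx ku n in \<open>auto simp: R1_def nth_append\<close>)
    then show ?thesis by (simp add: R1_def R2_def)
  qed
  have 3: "wp (4 * n) (Store 13 10) R2 M (\<lambda>t R' M'. t \<le> 1 \<and> M' = M(n + k := of_bool False) \<and> R' = R2)"
    using R0 k by (simp add: wp_simps R1_def R2_def)
  have 4: "wp (4 * n) (asym_test 0) R2 (M(n + k := of_bool False)) (\<lambda>t R' M'. t \<le> 64 * n + 9 \<and> M' = M(n + k := of_bool False)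
     \<and> (\<forall>r. r \<notin> {3,4,5,6,7,8} \<longrightarrow> R' r = R2 r) \<and> R' 8 = of_bool (x[k := False] \<in> asym_bracelets n))"
    by (rule asym_test_wp) (use R0 n x k buf_update[OF x(2), of k False] in \<open>auto simp: R1_def R2_def\<close>)
  have 5: "wp (4 * n) (Store 13 1) R' (M(n + k := of_bool False)) (\<lambda>t R'' M''. t \<le> 1 \<and> M'' = M \<and> R'' = R')"
    if "\<forall>r. r \<notin> {3,4,5,6,7,8} \<longrightarrow> R' r = R2 r" for R'
  proof -
    have "R' 13 = n + k" "R' 1 = 1" using that R0 by (auto simp: R2_def R1_def)
    then show ?thesis using k Mx[OF k] ku by (auto simp: wp_simps fun_eq_iff nth_append)
  qed
  have ag: "agree R R'" if "\<forall>r. r \<notin> {3,4,5,6,7,8} \<longrightarrow> R' r = R2 r" for R'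
    using that by (auto simp: agree_def R2_def R1_def)
  show ?thesis unfolding first_one_test_def
    apply (rule wp_SeqI[OF 1], elim conjE, hypsubst)
    apply (rule wp_SeqI[OF 2], elim conjE, hypsubst)
    apply (rule wp_SeqI[OF 3], elim conjE, hypsubst)
    apply (rule wp_SeqI[OF 4], elim conjE, hypsubst)
    apply (rule wp_mono[OF 5], assumption)
    using k fo ag by auto
qed

definition last_zero_test :: com where
  "last_zero_test = Seq (Sub 13 16 1) (Seq (scan_down 1) (Seq (Store 13 1) (Seq (asym_test 0) (Store 13 10))))"

lemma last_zero_test_wp:
  assumes R: "const_regs n R" and n: "n \<ge> 6" and x: "length x = n" "buf M n x" "False \<in> set x"
  shows "wp (4 * n) last_zero_test R M (\<lambda>t R' M'. t \<le> 67 * n + 14 \<and> M' = M \<and> agree R R'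
    \<and> R' 8 = of_bool (last_zero x \<in> asym_bracelets n))"
proof -
  obtain t u where tu: "x = u @ False # ones t" using trailing_ones_decomp[OF x(3)] .
  define k where "k = length u"
  have k: "k < n" "n = Suc (k + t)" using tu x(1) by (auto simp: k_def)
  have R0: "R 0 = n" "R 1 = 1" "R 10 = 0" "R 16 = 2 * n" using R by (auto simp: const_regs_def)
  have lz: "last_zero x = x[k := True]" using tu last_zero_eq[of u t] by (simp add: k_def)
  have Mx: "M (n + i) = of_bool (x ! i)" if "i < n" for i using x that by (simp add: buf_def)
  define R1 where "R1 = R(13 := 2 * n - 1)"
  define R2 where "R2 = R1(13 := n + k, 6 := M (n + k))"
  have 1: "wp (4 * n) (Sub 13 16 1) R M (\<lambda>t R' M'. t \<le> 1 \<and> M' = M \<and> R' = R1)" using R0 by (simp add: wp_simps R1_def)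
  have e: "2 * n - 1 - t = n + k" using k by simp
  have 2: "wp (4 * n) (scan_down 1) R1 M (\<lambda>t' R' M'. t' \<le> 3 * t + 2 \<and> M' = M \<and> R' = R2)"
  proof -
    have "wp (4 * n) (scan_down 1) R1 M (\<lambda>t' R' M'. t' \<le> 3 * t + 2 \<and> M' = M \<and> R' = R1(13 := R1 13 - t, 6 := M (R1 13 - t)))"
    proof (rule scan_down_wp)
      show "M (R1 13 - i) = R1 1" if "i < t" for i
      proof -
        have "R1 13 - i = n + (k + (t - i))" using that k by (simp add: R1_def)
        moreover have "x ! (k + (t - i)) = (False # ones t) ! (t - i)"
          unfolding tu k_def by (rule nth_append_length_plus)
        then have "x ! (k + (t - i))" using that by (simp add: nth_Cons')
        ultimately show ?thesis using Mx[of "k + (t - i)"] that k R0 by (simp add: R1_def)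
      qed
      show "M (R1 13 - t) \<noteq> R1 1" using Mx[OF k(1)] tu e R0 by (simp add: R1_def k_def)
    qed (use R0 k n in \<open>auto simp: R1_def\<close>)
    then show ?thesis using e by (simp add: R1_def R2_def)
  qed
  have 3: "wp (4 * n) (Store 13 1) R2 M (\<lambda>t R' M'. t \<le> 1 \<and> M' = M(n + k := of_bool True) \<and> R' = R2)"
    using R0 k by (simp add: wp_simps R1_def R2_def)
  have 4: "wp (4 * n) (asym_test 0) R2 (M(n + k := of_bool True)) (\<lambda>t R' M'. t \<le> 64 * n + 9 \<and> M' = M(n + k := of_bool True)
     \<and> (\<forall>r. r \<notin> {3,4,5,6,7,8} \<longrightarrow> R' r = R2 r) \<and> R' 8 = of_bool (x[k := True] \<in> asym_bracelets n))"
    by (rule asym_test_wp) (use R0 n x k(1) buf_update[OF x(2), of k True] in \<open>auto simp: R1_def R2_def\<close>)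
  have 5: "wp (4 * n) (Store 13 10) R' (M(n + k := of_bool True)) (\<lambda>t R'' M''. t \<le> 1 \<and> M'' = M \<and> R'' = R')"
    if "\<forall>r. r \<notin> {3,4,5,6,7,8} \<longrightarrow> R' r = R2 r" for R'
  proof -
    have "R' 13 = n + k" "R' 10 = 0" using that R0 by (auto simp: R2_def R1_def)
    moreover have "M (n + k) = 0" using Mx[OF k(1)] tu by (simp add: k_def)
    ultimately show ?thesis using k(1) by (auto simp: wp_simps fun_eq_iff)
  qed
  have ag: "agree R R'" if "\<forall>r. r \<notin> {3,4,5,6,7,8} \<longrightarrow> R' r = R2 r" for R'
    using that by (auto simp: agree_def R2_def R1_def)
  show ?thesis unfolding last_zero_test_def
    apply (rule wp_SeqI[OF 1], elim conjE, hypsubst)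
    apply (rule wp_SeqI[OF 2], elim conjE, hypsubst)
    apply (rule wp_SeqI[OF 3], elim conjE, hypsubst)
    apply (rule wp_SeqI[OF 4], elim conjE, hypsubst)
    apply (rule wp_mono[OF 5], assumption)
    using k lz ag by auto
qed

text \<open>The erased 1 and the \<open>q\<close> zeros before it wrap round to the initial run, so
  the necklace is one explicit rotation, which spares a search for the minimum.\<close>

lemma last_one_rotate:
  assumes A: "x \<in> asym_bracelets n"
  obtains u q where "x = u @ True # zeros q @ [True]"
    "last_one x = rotate (Suc (length u)) (x[n - 1 := False])"
proof -
  obtain s y where y: "x = zeros s @ y" "one_ended y" "no_run (Suc s) y" "y < rev y" "n = s + length y"
    using asym_bracelet_decomp[OF A] by metis
  obtain p q z where z: "y = True # zeros p @ z @ zeros q @ [True]" "one_ended z"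
    using one_ended_inner y by metis
  have v1: "one_ended (True # zeros p @ z)" using z by (auto simp: one_ended_def)
  obtain z' where z': "z = z' @ [True]" using z(2) unfolding one_ended_def by (metis (full_types) append_butlast_last_id)
  define u where "u = zeros s @ True # zeros p @ z'"
  have x: "x = u @ True # zeros q @ [True]" using y z z' by (simp add: u_def)
  have "x[n - 1 := False] = (u @ [True]) @ zeros (Suc q)"
  proof -
    have "n - 1 = length (u @ True # zeros q)" using A x by (auto simp: asym_bracelets_def)
    moreover have "x = (u @ True # zeros q) @ True # []" using x by simp
    ultimately have "x[n - 1 := False] = (u @ True # zeros q) @ [False]" using list_update_length by metis
    then show ?thesis by (simp add: replicate_append_same)
  qed
  then have "rotate (Suc (length u)) (x[n - 1 := False]) = zeros (Suc q) @ u @ [True]"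
    using rotate_append[of "u @ [True]" "zeros (Suc q)"] by simp
  also have "\<dots> = zeros (Suc (s + q)) @ True # zeros p @ z"
  proof -
    have "zeros (Suc q) @ zeros s @ (True # zeros p @ z) = zeros (Suc (s + q)) @ (True # zeros p @ z)"
      by (metis add.commute add_Suc append.assoc replicate_add)
    then show ?thesis using z' by (simp add: u_def)
  qed
  also have "\<dots> = last_one x" using last_one_block(1)[OF v1, of s q] y z by simp
  finally show ?thesis using that[OF x] by simp
qed

text \<open>For a bracelet the longest run of zeros after clearing the last 1 is the one around the end of the
  string, so that its necklace starts right after the new last 1.\<close>
definition last_one_test :: com where
  "last_one_test = Seq (Sub 13 16 1) (Seq (Store 13 10) (Seq (scan_down 10) (Seq (Add 13 13 1) (Seq (Sub 13 13 0)
     (Seq (copy_rotated 0 16) (Seq (Sub 13 16 1) (Seq (Store 13 1) (asym_test 16))))))))"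

lemma last_one_test_wp:
  assumes R: "const_regs n R" and n: "n \<ge> 6" and x: "x \<in> asym_bracelets n" "buf M n x"
  shows "wp (4 * n) last_one_test R M (\<lambda>t R' M'. t \<le> 77 * n + 20 \<and> (\<forall>a<2 * n. M' a = M a) \<and> agree R R'
    \<and> R' 8 = of_bool (last_one x \<in> asym_bracelets n))"
proof -
  obtain u q where uq: "x = u @ True # zeros q @ [True]" "last_one x = rotate (Suc (length u)) (x[n - 1 := False])"
    using last_one_rotate[OF x(1)] .
  have len: "length x = n" using x by (simp add: asym_bracelets_def)
  define k where "k = length u"
  have k: "k < n" "n = k + q + 2" using uq(1) len by (auto simp: k_def)
  define x0 where "x0 = x[n - 1 := False]"
  have lx0: "length x0 = n" using len by (simp add: x0_def)
  have x0: "x0 = u @ True # zeros (Suc q)" unfolding x0_def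
    using uq(1) len by (auto simp: list_update_append replicate_append_same)
  have R0: "R 0 = n" "R 1 = 1" "R 10 = 0" "R 16 = 2 * n" using R by (auto simp: const_regs_def)
  define M1 where "M1 = M(2 * n - 1 := 0)"
  have e: "n + (n - 1) = 2 * n - 1" using n by simp
  have b1: "buf M1 n x0" using buf_update[OF x(2), of "n - 1" False] len n e by (simp add: M1_def x0_def)
  have Mx: "M1 (n + i) = of_bool (x0 ! i)" if "i < n" for i using b1 lx0 that by (simp add: buf_def)
  define R1 where "R1 = R(13 := 2 * n - 1)"
  define R2 where "R2 = R1(13 := n + k, 6 := M1 (n + k))"
  define R3 where "R3 = R2(13 := Suc k)"
  have 1: "wp (4 * n) (Sub 13 16 1) R M (\<lambda>t R' M'. t \<le> 1 \<and> M' = M \<and> R' = R1)" using R0 by (simp add: wp_simps R1_def)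
  have 2: "wp (4 * n) (Store 13 10) R1 M (\<lambda>t R' M'. t \<le> 1 \<and> M' = M1 \<and> R' = R1)"
    using R0 n by (simp add: wp_simps R1_def M1_def)
  have e2: "2 * n - 1 - Suc q = n + k" using k by simp
  have 3: "wp (4 * n) (scan_down 10) R1 M1 (\<lambda>t' R' M'. t' \<le> 3 * Suc q + 2 \<and> M' = M1 \<and> R' = R2)"
  proof -
    have "wp (4 * n) (scan_down 10) R1 M1 (\<lambda>t' R' M'. t' \<le> 3 * Suc q + 2 \<and> M' = M1 \<and> R' = R1(13 := R1 13 - Suc q, 6 := M1 (R1 13 - Suc q)))"
    proof (rule scan_down_wp)
      show "M1 (R1 13 - i) = R1 10" if "i < Suc q" for i
      proof -
        have a: "R1 13 - i = n + (k + (Suc q - i))" using that k by (simp add: R1_def)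
        have "x0 ! (k + (Suc q - i)) = (True # zeros (Suc q)) ! (Suc q - i)"
          unfolding x0 k_def by (rule nth_append_length_plus)
        also have "\<dots> = zeros (Suc q) ! (q - i)" using that by (simp add: Suc_diff_le del: replicate.simps)
        finally have "\<not> x0 ! (k + (Suc q - i))" using that by (simp del: replicate.simps)
        then show ?thesis using Mx[of "k + (Suc q - i)"] that k R0 a by (simp add: R1_def)
      qed
      show "M1 (R1 13 - Suc q) \<noteq> R1 10" using Mx[OF k(1)] x0 e2 R0 by (simp add: R1_def k_def)
    qed (use R0 k n in \<open>auto simp: R1_def\<close>)
    then show ?thesis using e2 by (simp add: R1_def R2_def)
  qed
  have 4: "wp (4 * n) (Add 13 13 1) R2 M1 (\<lambda>t R' M'. t \<le> 1 \<and> M' = M1 \<and> R' = R2(13 := Suc (n + k)))"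
    using R0 k by (simp add: wp_simps R1_def R2_def)
  have 5: "wp (4 * n) (Sub 13 13 0) (R2(13 := Suc (n + k))) M1 (\<lambda>t R' M'. t \<le> 1 \<and> M' = M1 \<and> R' = R3)"
    using R0 k by (simp add: wp_simps R1_def R2_def R3_def)
  have R3: "R3 0 = n" "R3 1 = 1" "R3 10 = 0" "R3 16 = 2 * n" "R3 13 = Suc k" using R0 by (auto simp: R3_def R2_def R1_def)
  have 6: "wp (4 * n) (copy_rotated 0 16) R3 M1 (\<lambda>t R' M'. t \<le> 10 * n + 2
     \<and> (\<forall>r. r \<notin> {4,5,6} \<longrightarrow> R' r = R3 r) \<and> (\<forall>a. a < 2 * n \<longrightarrow> M' a = M1 a) \<and> buf M' (2 * n) (last_one x))"
    using copy_rotated_wp[of 0 16 R3 n x0 M1 "4 * n"] R3 lx0 b1 k n uq(2) by (simp add: x0_def k_def)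
  have 7: "wp (4 * n) (Sub 13 16 1) R' M' (\<lambda>t R'' M''. t \<le> 1 \<and> M'' = M' \<and> R'' = R'(13 := 2 * n - 1))"
    if "\<forall>r. r \<notin> {4,5,6} \<longrightarrow> R' r = R3 r" for R' M' using that R3 by (simp add: wp_simps)
  have 8: "wp (4 * n) (Store 13 1) (R'(13 := 2 * n - 1)) M' (\<lambda>t R'' M''. t \<le> 1 \<and> M'' = M'(2 * n - 1 := 1) \<and> R'' = R'(13 := 2 * n - 1))"
    if "\<forall>r. r \<notin> {4,5,6} \<longrightarrow> R' r = R3 r" for R' M' using that R3 n by (simp add: wp_simps)
  have 9: "wp (4 * n) (asym_test 16) (R'(13 := 2 * n - 1)) (M'(2 * n - 1 := 1)) (\<lambda>t R'' M''. t \<le> 64 * n + 9 \<and> M'' = M'(2 * n - 1 := 1)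
     \<and> (\<forall>r. r \<notin> {3,4,5,6,7,8} \<longrightarrow> R'' r = (R'(13 := 2 * n - 1)) r) \<and> R'' 8 = of_bool (last_one x \<in> asym_bracelets n))"
    if r: "\<forall>r. r \<notin> {4,5,6} \<longrightarrow> R' r = R3 r" and b: "buf M' (2 * n) (last_one x)" for R' M'
  proof (rule asym_test_wp)
    show "buf (M'(2 * n - 1 := 1)) ((R'(13 := 2 * n - 1)) 16) (last_one x)"
      using b r R3 n by (auto simp: buf_def)
    show "length (last_one x) = n" using uq(2) len by simp
  qed (use r R3 n in auto)
  \<comment> \<open>Storing 1 restores the last cell, because an asymmetric bracelet ends in
    1.\<close>
  have fin: "(M'(2 * n - 1 := 1)) a = M a" if "\<forall>a. a < 2 * n \<longrightarrow> M' a = M1 a" "a < 2 * n" for M' a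
  proof (cases "a = 2 * n - 1")
    case True
    have "x ! (n - 1)" using uq(1) len k by (auto simp: nth_append nth_Cons')
    then have "M (n + (n - 1)) = 1" using x(2)[unfolded buf_def, rule_format, of "n - 1"] len n by simp
    then show ?thesis using True e by simp
  next
    case False then show ?thesis using that by (simp add: M1_def)
  qed
  have ag: "agree R R''" if "\<forall>r. r \<notin> {4,5,6} \<longrightarrow> R' r = R3 r" "\<forall>r. r \<notin> {3,4,5,6,7,8} \<longrightarrow> R'' r = (R'(13 := 2 * n - 1)) r" for R' R''
    using that by (auto simp: agree_def R1_def R2_def R3_def)
  show ?thesis unfolding last_one_test_def
    apply (rule wp_SeqI[OF 1], elim conjE, hypsubst)
    apply (rule wp_SeqI[OF 2], elim conjE, hypsubst)
    apply (rule wp_SeqI[OF 3], elim conjE, hypsubst)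
    apply (rule wp_SeqI[OF 4], elim conjE, hypsubst)
    apply (rule wp_SeqI[OF 5], elim conjE, hypsubst)
    apply (rule wp_SeqI[OF 6], elim conjE)
    apply (rule wp_SeqI[OF 7], assumption, elim conjE, hypsubst)
    apply (rule wp_SeqI[OF 8], assumption, elim conjE, hypsubst)
    apply (rule wp_mono[OF 9], assumption, assumption)
    using k fin ag by auto
qed


section \<open>The three conditions for complementing the first bit\<close>

definition agree_mod_flag :: "(reg \<Rightarrow> nat) \<Rightarrow> (reg \<Rightarrow> nat) \<Rightarrow> bool" where
  "agree_mod_flag R R' \<longleftrightarrow> (\<forall>r. r \<notin> {3,4,5,6,7,8,13,14} \<longrightarrow> R' r = R r)"

lemma asym_test_buffer_wp:
  assumes R: "const_regs n R" and n: "n \<ge> 6" and x: "length x = n" "buf M n x"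
  shows "wp (4 * n) (asym_test 0) R M (\<lambda>t R' M'. t \<le> 64 * n + 9 \<and> M' = M \<and> agree R R'
     \<and> R' 8 = of_bool (x \<in> asym_bracelets n))"
proof -
  have "wp (4 * n) (asym_test 0) R M (\<lambda>t R' M'. t \<le> 64 * n + 9 \<and> M' = M \<and> (\<forall>r. r \<notin> {3,4,5,6,7,8} \<longrightarrow> R' r = R r)
     \<and> R' 8 = of_bool (x \<in> asym_bracelets n))"
    by (rule asym_test_wp) (use R n x in \<open>auto simp: const_regs_def\<close>)
  then show ?thesis by (rule wp_mono) (auto simp: agree_def)
qed

definition check_first_one :: com where
  "check_first_one = Seq (asym_test 0) (Cond (Equal 8 1) (Seq first_one_test (Cond (Equal 8 1) (Move 14 1) Skip)) Skip)"

text \<open>Membership is tested first because \<open>last_one_test\<close> takes its rotation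
  offset from the shape of a bracelet.\<close>

definition check_last_one :: com where
  "check_last_one = Seq (asym_test 0) (Cond (Equal 8 1)
     (Seq last_one_test (Cond (Equal 8 1) (Seq first_one_test (Cond (Equal 8 1) Skip (Move 14 1))) Skip)) Skip)"

definition check_last_zero :: com where
  "check_last_zero = Seq (asym_test 0) (Cond (Equal 8 1) (Seq last_zero_test (Cond (Equal 8 1)
     (Seq first_one_test (Cond (Equal 8 1) Skip (Seq last_one_test (Cond (Equal 8 1) Skip (Move 14 1))))) Skip)) Skip)"

lemma agree_mod_flag_agree: "agree R R' \<Longrightarrow> agree_mod_flag R R'" by (simp add: agree_def agree_mod_flag_def)

lemma agree_mod_flag_flag: "agree R R' \<Longrightarrow> agree_mod_flag R (R'(14 := c))" by (simp add: agree_def agree_mod_flag_def)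

lemma agree_regs: "agree R R' \<Longrightarrow> R' 14 = R 14" "agree R R' \<Longrightarrow> R' 1 = R 1" by (simp_all add: agree_def)

lemma agree_step:
  assumes "agree R R1" "agree R1 R2" "const_regs n R1"
  shows "R2 1 = 1" "agree R R2" "R2 14 = R 14" "const_regs n R2"
  using assms by (simp_all add: agree_def const_regs_def)

lemma check_first_one_wp:
  assumes R: "const_regs n R" and n: "n \<ge> 6" and x: "length x = n" "buf M n x"
  shows "wp (4 * n) check_first_one R M (\<lambda>t R' M'. t \<le> 131 * n + 30 \<and> M' = M \<and> agree_mod_flag R R'
    \<and> R' 14 = (if x \<in> asym_bracelets n \<and> first_one x \<in> asym_bracelets n then 1 else R 14))"
  unfolding check_first_one_def
proof (rule wp_SeqI[OF asym_test_buffer_wp[OF R n x]], elim conjE)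
  let ?A = "asym_bracelets n"
  fix t1 R1 M1 assume h: "t1 \<le> 64 * n + 9" "M1 = M" "agree R R1" "R1 8 = of_bool (x \<in> ?A)"
  have R1: "const_regs n R1" "R1 1 = 1" using agree_const_regs[OF h(3) R] by (auto simp: const_regs_def)
  let ?Q = "\<lambda>t R' M'. t1 + t \<le> 131 * n + 30 \<and> M' = M \<and> agree_mod_flag R R'
    \<and> R' 14 = (if x \<in> ?A \<and> first_one x \<in> ?A then 1 else R 14)"
  show "wp (4 * n) (Cond (Equal 8 1) (Seq first_one_test (Cond (Equal 8 1) (Move 14 1) Skip)) Skip) R1 M1 ?Q"
  proof (cases "x \<in> ?A")
    case False
    then show ?thesis using h R1 agree_mod_flag_agree agree_regs by (simp add: wp_simps)
  next
    case True
    have "wp (4 * n) (Seq first_one_test (Cond (Equal 8 1) (Move 14 1) Skip)) R1 M1 (\<lambda>t. ?Q (1 + t))"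
    proof (rule wp_SeqI[OF first_one_test_wp[OF R1(1) n x(1) _ asym_bracelet_not_constant(1)[OF True]]], use x h in simp, elim conjE)
      fix t2 R2 M2 assume h2: "t2 \<le> 67 * n + 14" "M2 = M1" "agree R1 R2" "R2 8 = of_bool (first_one x \<in> ?A)"
      have R2: "R2 1 = 1" "agree R R2" "R2 14 = R 14" by (rule agree_step[OF h(3) h2(3) R1(1)])+
      show "wp (4 * n) (Cond (Equal 8 1) (Move 14 1) Skip) R2 M2 (\<lambda>u. ?Q (1 + (t2 + u)))"
        using True h h2 R2 agree_mod_flag_agree agree_mod_flag_flag by (cases "first_one x \<in> ?A") (simp_all add: wp_simps)
    qed
    then show ?thesis using True h R1 by (simp add: wp_Cond)
  qed
qed

lemma check_last_one_wp:
  assumes R: "const_regs n R" and n: "n \<ge> 6" and x: "length x = n" "buf M n x"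
  shows "wp (4 * n) check_last_one R M (\<lambda>t R' M'. t \<le> 208 * n + 60 \<and> (\<forall>a<n. M' a = M a) \<and> agree_mod_flag R R'
    \<and> R' 14 = (if x \<in> asym_bracelets n \<and> last_one x \<in> asym_bracelets n \<and> first_one x \<notin> asym_bracelets n then 1 else R 14))"
  unfolding check_last_one_def
proof (rule wp_SeqI[OF asym_test_buffer_wp[OF R n x]], elim conjE)
  let ?A = "asym_bracelets n"
  fix t1 R1 M1 assume h: "t1 \<le> 64 * n + 9" "M1 = M" "agree R R1" "R1 8 = of_bool (x \<in> ?A)"
  have R1: "const_regs n R1" "R1 1 = 1" using agree_const_regs[OF h(3) R] by (auto simp: const_regs_def)
  let ?Q = "\<lambda>t R' M'. t1 + t \<le> 208 * n + 60 \<and> (\<forall>a<n. M' a = M a) \<and> agree_mod_flag R R'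
    \<and> R' 14 = (if x \<in> ?A \<and> last_one x \<in> ?A \<and> first_one x \<notin> ?A then 1 else R 14)"
  let ?c3 = "Cond (Equal 8 1) Skip (Move 14 1)"
  let ?c2 = "Cond (Equal 8 1) (Seq first_one_test ?c3) Skip"
  show "wp (4 * n) (Cond (Equal 8 1) (Seq last_one_test ?c2) Skip) R1 M1 ?Q"
  proof (cases "x \<in> ?A")
    case False
    then show ?thesis using h R1 agree_mod_flag_agree agree_regs by (simp add: wp_simps)
  next
    case True
    have "wp (4 * n) (Seq last_one_test ?c2) R1 M1 (\<lambda>t. ?Q (1 + t))"
    proof (rule wp_SeqI[OF last_one_test_wp[OF R1(1) n True]], use x h in simp, elim conjE)
      fix t2 R2 M2 assume h2: "t2 \<le> 77 * n + 20" "\<forall>a<2 * n. M2 a = M1 a" "agree R1 R2" "R2 8 = of_bool (last_one x \<in> ?A)"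
      have R2: "R2 1 = 1" "agree R R2" "R2 14 = R 14" "const_regs n R2"
        by (rule agree_step[OF h(3) h2(3) R1(1)])+
      have M2: "\<forall>a<n. M2 a = M a" "buf M2 n x" using h2(2) h(2) buf_cong[OF x(2), of M2] x(1) by auto
      show "wp (4 * n) ?c2 R2 M2 (\<lambda>u. ?Q (1 + (t2 + u)))"
      proof (cases "last_one x \<in> ?A")
        case False
        then show ?thesis using h h2 R2 M2 agree_mod_flag_agree by (simp add: wp_simps)
      next
        case T2: True
        have "wp (4 * n) (Seq first_one_test ?c3) R2 M2 (\<lambda>u. ?Q (1 + (t2 + (1 + u))))"
        proof (rule wp_SeqI[OF first_one_test_wp[OF R2(4) n x(1) M2(2) asym_bracelet_not_constant(1)[OF True]]], elim conjE)
          fix t3 R3 M3 assume h3: "t3 \<le> 67 * n + 14" "M3 = M2" "agree R2 R3" "R3 8 = of_bool (first_one x \<in> ?A)"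
          have R3: "R3 1 = 1" "agree R R3" "R3 14 = R 14" by (rule agree_step[OF R2(2) h3(3) R2(4)])+
          show "wp (4 * n) ?c3 R3 M3 (\<lambda>u. ?Q (1 + (t2 + (1 + (t3 + u)))))"
            using True T2 h h2 h3 R3 M2 agree_mod_flag_agree agree_mod_flag_flag by (cases "first_one x \<in> ?A") (simp_all add: wp_simps)
        qed
        then show ?thesis using T2 h2 R2 by (simp add: wp_Cond)
      qed
    qed
    then show ?thesis using True h R1 by (simp add: wp_Cond)
  qed
qed

lemma check_last_zero_wp:
  assumes R: "const_regs n R" and n: "n \<ge> 6" and x: "length x = n" "buf M n x"
  shows "wp (4 * n) check_last_zero R M (\<lambda>t R' M'. t \<le> 275 * n + 80 \<and> agree_mod_flag R R'
    \<and> R' 14 = (if x \<in> asym_bracelets n \<and> last_zero x \<in> asym_bracelets n \<and> first_one x \<notin> asym_bracelets n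
        \<and> last_one x \<notin> asym_bracelets n then 1 else R 14))"
  unfolding check_last_zero_def
proof (rule wp_SeqI[OF asym_test_buffer_wp[OF R n x]], elim conjE)
  let ?A = "asym_bracelets n"
  fix t1 R1 M1 assume h: "t1 \<le> 64 * n + 9" "M1 = M" "agree R R1" "R1 8 = of_bool (x \<in> ?A)"
  have R1: "const_regs n R1" "R1 1 = 1" using agree_const_regs[OF h(3) R] by (auto simp: const_regs_def)
  let ?Q = "\<lambda>t R' M'. t1 + t \<le> 275 * n + 80 \<and> agree_mod_flag R R'
    \<and> R' 14 = (if x \<in> ?A \<and> last_zero x \<in> ?A \<and> first_one x \<notin> ?A \<and> last_one x \<notin> ?A then 1 else R 14)"
  let ?c4 = "Cond (Equal 8 1) Skip (Move 14 1)"
  let ?c3 = "Cond (Equal 8 1) Skip (Seq last_one_test ?c4)"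
  let ?c2 = "Cond (Equal 8 1) (Seq first_one_test ?c3) Skip"
  show "wp (4 * n) (Cond (Equal 8 1) (Seq last_zero_test ?c2) Skip) R1 M1 ?Q"
  proof (cases "x \<in> ?A")
    case False
    then show ?thesis using h R1 agree_mod_flag_agree agree_regs by (simp add: wp_simps)
  next
    case True
    have "wp (4 * n) (Seq last_zero_test ?c2) R1 M1 (\<lambda>t. ?Q (1 + t))"
    proof (rule wp_SeqI[OF last_zero_test_wp[OF R1(1) n x(1) _ asym_bracelet_not_constant(2)[OF True]]], use x h in simp, elim conjE)
      fix t2 R2 M2 assume h2: "t2 \<le> 67 * n + 14" "M2 = M1" "agree R1 R2" "R2 8 = of_bool (last_zero x \<in> ?A)"
      have R2: "R2 1 = 1" "agree R R2" "R2 14 = R 14" "const_regs n R2"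
        by (rule agree_step[OF h(3) h2(3) R1(1)])+
      have M2: "buf M2 n x" using h2(2) h(2) x(2) by simp
      show "wp (4 * n) ?c2 R2 M2 (\<lambda>u. ?Q (1 + (t2 + u)))"
      proof (cases "last_zero x \<in> ?A")
        case False
        then show ?thesis using h h2 R2 agree_mod_flag_agree by (simp add: wp_simps)
      next
        case T2: True
        have "wp (4 * n) (Seq first_one_test ?c3) R2 M2 (\<lambda>u. ?Q (1 + (t2 + (1 + u))))"
        proof (rule wp_SeqI[OF first_one_test_wp[OF R2(4) n x(1) M2 asym_bracelet_not_constant(1)[OF True]]], elim conjE)
          fix t3 R3 M3 assume h3: "t3 \<le> 67 * n + 14" "M3 = M2" "agree R2 R3" "R3 8 = of_bool (first_one x \<in> ?A)"
          have R3: "R3 1 = 1" "agree R R3" "R3 14 = R 14" "const_regs n R3"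
            by (rule agree_step[OF R2(2) h3(3) R2(4)])+
          have M3: "buf M3 n x" using h3(2) M2 by simp
          show "wp (4 * n) ?c3 R3 M3 (\<lambda>u. ?Q (1 + (t2 + (1 + (t3 + u)))))"
          proof (cases "first_one x \<in> ?A")
            case T3: True
            then show ?thesis using h h2 h3 R3 agree_mod_flag_agree by (simp add: wp_simps)
          next
            case F3: False
            have "wp (4 * n) (Seq last_one_test ?c4) R3 M3 (\<lambda>u. ?Q (1 + (t2 + (1 + (t3 + (1 + u))))))"
            proof (rule wp_SeqI[OF last_one_test_wp[OF R3(4) n True M3]], elim conjE)
              fix t4 R4 M4 assume h4: "t4 \<le> 77 * n + 20" "agree R3 R4" "R4 8 = of_bool (last_one x \<in> ?A)"
              have R4: "R4 1 = 1" "agree R R4" "R4 14 = R 14" by (rule agree_step[OF R3(2) h4(2) R3(4)])+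
              show "wp (4 * n) ?c4 R4 M4 (\<lambda>u. ?Q (1 + (t2 + (1 + (t3 + (1 + (t4 + u)))))))"
                using True T2 F3 h h2 h3 h4 R4 agree_mod_flag_agree agree_mod_flag_flag by (cases "last_one x \<in> ?A") (simp_all add: wp_simps)
            qed
            then show ?thesis using F3 h3 R3 by (simp add: wp_Cond)
          qed
        qed
        then show ?thesis using T2 h2 R2 by (simp add: wp_Cond)
      qed
    qed
    then show ?thesis using True h R1 by (simp add: wp_Cond)
  qed
qed

text \<open>\<open>beta1\<close> and \<open>beta2\<close> are rotations of the tail with a 1 in
  front, \<open>beta3\<close> is one of the tail with a 0 in front. So it suffices to set the first
  input cell and to copy with an offset.\<close>

definition load_beta1 :: com where
  "load_beta1 = Seq (Store 10 1) (Seq (Sub 13 0 1) (Seq (scan_down 10) (Seq (Add 13 13 1) (copy_rotated 10 0))))"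

text \<open>The first cell still holds the 1 stored by \<open>load_beta1\<close>.\<close>

definition load_beta2 :: com where
  "load_beta2 = Seq (Move 13 1) (copy_rotated 10 0)"

definition load_beta3 :: com where
  "load_beta3 = Seq (Store 10 10) (Seq (Move 13 1) (Seq (scan_up 1) (copy_rotated 10 0)))"

lemma copy_input_wp:
  assumes R: "const_regs n R" and x: "length x = n" "buf M 0 x" and off: "R 13 \<le> n" and n: "n \<ge> 6"
  shows "wp (4 * n) (copy_rotated 10 0) R M (\<lambda>t R' M'. t \<le> 10 * n + 2 \<and> agree R R' \<and> buf M' 0 x
    \<and> buf M' n (rotate (R 13) x))"
proof -
  have R0: "R 0 = n" "R 1 = 1" "R 10 = 0" using R by (auto simp: const_regs_def)
  have "wp (4 * n) (copy_rotated 10 0) R M (\<lambda>t R' M'. t \<le> 10 * n + 2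
     \<and> (\<forall>r. r \<notin> {4,5,6} \<longrightarrow> R' r = R r) \<and> (\<forall>a. a < R 0 \<longrightarrow> M' a = M a)
     \<and> buf M' (R 0) (rotate (R 13) x))"
    by (rule copy_rotated_wp) (use R0 x off n in auto)
  then show ?thesis
  proof (rule wp_mono, elim conjE)
    fix t R' M' assume "t \<le> 10 * n + 2" "\<forall>r. r \<notin> {4,5,6} \<longrightarrow> R' r = R r" "\<forall>a. a < R 0 \<longrightarrow> M' a = M a"
      "buf M' (R 0) (rotate (R 13) x)"
    then show "t \<le> 10 * n + 2 \<and> agree R R' \<and> buf M' 0 x \<and> buf M' n (rotate (R 13) x)"
      using R0 x buf_cong[OF x(2), of M'] by (simp add: agree_def)
  qed
qed

lemma load_beta1_wp:
  assumes R: "const_regs n R" and n: "n \<ge> 6" and x: "length (b # \<gamma>) = n" "buf M 0 (b # \<gamma>)" "True \<in> set \<gamma>"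
  shows "wp (4 * n) load_beta1 R M (\<lambda>t R' M'. t \<le> 13 * n + 10 \<and> agree R R' \<and> buf M' 0 (True # \<gamma>) \<and> buf M' n (beta1 (b # \<gamma>)))"
proof -
  obtain w k where wk: "\<gamma> = w @ True # zeros k" using trailing_zeros_decomp[OF x(3)] by metis
  define i where "i = length w + 2"
  have i: "n = i + k" "i \<ge> 2" using x(1) wk by (auto simp: i_def)
  have R0: "R 0 = n" "R 1 = 1" "R 10 = 0" using R by (auto simp: const_regs_def)
  define M1 where "M1 = M(0 := 1)"
  let ?x = "True # \<gamma>"
  have b1: "buf M1 0 ?x" using buf_update[OF x(2), of 0 True] by (simp add: M1_def)
  have lx: "length ?x = n" using x(1) by simp
  have Mx: "M1 a = of_bool (?x ! a)" if "a < n" for a using b1 lx that by (simp add: buf_def)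
  define R1 where "R1 = R(13 := n - 1)"
  define R2 where "R2 = R1(13 := i - 1, 6 := M1 (i - 1))"
  define R3 where "R3 = R2(13 := i)"
  have 1: "wp (4 * n) (Store 10 1) R M (\<lambda>t R' M'. t \<le> 1 \<and> M' = M1 \<and> R' = R)" using R0 n by (simp add: wp_simps M1_def)
  have 2: "wp (4 * n) (Sub 13 0 1) R M1 (\<lambda>t R' M'. t \<le> 1 \<and> M' = M1 \<and> R' = R1)" using R0 by (simp add: wp_simps R1_def)
  have e: "n - 1 - k = i - 1" using i by simp
  have nth: "?x ! (length w + 1 + a) = (True # zeros k) ! a" for a
  proof -
    have "?x ! (length w + 1 + a) = ((True # w) @ (True # zeros k)) ! (length (True # w) + a)" using wk by simp
    then show ?thesis unfolding nth_append_length_plus .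
  qed
  have 3: "wp (4 * n) (scan_down 10) R1 M1 (\<lambda>t R' M'. t \<le> 3 * k + 2 \<and> M' = M1 \<and> R' = R2)"
  proof -
    have "wp (4 * n) (scan_down 10) R1 M1 (\<lambda>t R' M'. t \<le> 3 * k + 2 \<and> M' = M1 \<and> R' = R1(13 := R1 13 - k, 6 := M1 (R1 13 - k)))"
    proof (rule scan_down_wp)
      show "M1 (R1 13 - a) = R1 10" if "a < k" for a
      proof -
        have q: "R1 13 - a = length w + 1 + (k - a)" using that i by (simp add: R1_def i_def)
        have "\<not> ?x ! (length w + 1 + (k - a))" unfolding nth using that by (simp add: nth_Cons')
        then show ?thesis using Mx[of "length w + 1 + (k - a)"] that i R0 q by (simp add: R1_def i_def)
      qed
      have "?x ! (i - 1)" using nth[of 0] by (simp add: i_def)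
      then have "M1 (i - 1) = 1" using Mx[of "i - 1"] i by simp
      then show "M1 (R1 13 - k) \<noteq> R1 10" using e R0 by (simp add: R1_def)
    qed (use R0 i n in \<open>auto simp: R1_def\<close>)
    then show ?thesis using e by (simp add: R1_def R2_def)
  qed
  have 4: "wp (4 * n) (Add 13 13 1) R2 M1 (\<lambda>t R' M'. t \<le> 1 \<and> M' = M1 \<and> R' = R3)"
    using R0 i by (simp add: wp_simps R1_def R2_def R3_def)
  have R3: "const_regs n R3" "R3 13 = i" using R by (auto simp: const_regs_def R1_def R2_def R3_def)
  have "rotate i ?x = beta1 (b # \<gamma>)"
  proof -
    have "?x = (True # w @ [True]) @ zeros k" "length (True # w @ [True]) = i" using wk by (auto simp: i_def)
    then have "rotate i ?x = zeros k @ True # w @ [True]" by (metis rotate_append)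
    then show ?thesis using beta1_eq wk by simp
  qed
  then have 5: "wp (4 * n) (copy_rotated 10 0) R3 M1 (\<lambda>t R' M'. t \<le> 10 * n + 2 \<and> agree R3 R' \<and> buf M' 0 ?x
    \<and> buf M' n (beta1 (b # \<gamma>)))" using copy_input_wp[OF R3(1) lx b1 _ n] R3(2) i by simp
  have ag: "agree R R3" by (simp add: agree_def R1_def R2_def R3_def)
  show ?thesis unfolding load_beta1_def
    apply (rule wp_SeqI[OF 1], elim conjE, hypsubst)
    apply (rule wp_SeqI[OF 2], elim conjE, hypsubst)
    apply (rule wp_SeqI[OF 3], elim conjE, hypsubst)
    apply (rule wp_SeqI[OF 4], elim conjE, hypsubst)
    apply (rule wp_mono[OF 5])
    using i agree_trans[OF ag] by auto
qed

lemma load_beta2_wp: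
  assumes R: "const_regs n R" and n: "n \<ge> 6" and x: "length (True # \<gamma>) = n" "buf M 0 (True # \<gamma>)"
  shows "wp (4 * n) load_beta2 R M (\<lambda>t R' M'. t \<le> 10 * n + 3 \<and> agree R R' \<and> buf M' 0 (True # \<gamma>) \<and> buf M' n (\<gamma> @ [True]))"
proof -
  define R1 where "R1 = R(13 := 1)"
  have 1: "wp (4 * n) (Move 13 1) R M (\<lambda>t R' M'. t \<le> 1 \<and> M' = M \<and> R' = R1)" using R by (simp add: wp_simps R1_def const_regs_def)
  have R1: "const_regs n R1" "R1 13 = 1" using R by (auto simp: const_regs_def R1_def)
  have 2: "wp (4 * n) (copy_rotated 10 0) R1 M (\<lambda>t R' M'. t \<le> 10 * n + 2 \<and> agree R1 R' \<and> buf M' 0 (True # \<gamma>)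
    \<and> buf M' n (\<gamma> @ [True]))" using copy_input_wp[OF R1(1) x _ n] R1(2) n by simp
  have ag: "agree R R1" by (simp add: agree_def R1_def)
  show ?thesis unfolding load_beta2_def
    apply (rule wp_SeqI[OF 1], elim conjE, hypsubst)
    apply (rule wp_mono[OF 2])
    using agree_trans[OF ag] by auto
qed

text \<open>The cell before the tail has been overwritten earlier, so its letter \<open>c\<close>
  may differ from the original letter \<open>b\<close>.\<close>

lemma load_beta3_wp:
  assumes R: "const_regs n R" and n: "n \<ge> 6" and x: "length (c # \<gamma>) = n" "buf M 0 (c # \<gamma>)" "False \<in> set \<gamma>"
  shows "wp (4 * n) load_beta3 R M (\<lambda>t R' M'. t \<le> 13 * n + 10 \<and> agree R R' \<and> buf M' n (beta3 (b # \<gamma>)))"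
proof -
  obtain k w where wk: "\<gamma> = ones k @ False # w" using leading_ones_decomp[OF x(3)] by metis
  have k: "Suc k < n" using x(1) wk by auto
  have R0: "R 0 = n" "R 1 = 1" "R 10 = 0" using R by (auto simp: const_regs_def)
  define M1 where "M1 = M(0 := 0)"
  let ?x = "False # \<gamma>"
  have b1: "buf M1 0 ?x" using buf_update[OF x(2), of 0 False] by (simp add: M1_def)
  have lx: "length ?x = n" using x(1) by simp
  have Mx: "M1 a = of_bool (?x ! a)" if "a < n" for a using b1 lx that by (simp add: buf_def)
  define R1 where "R1 = R(13 := 1)"
  define R2 where "R2 = R1(13 := Suc k, 6 := M1 (Suc k))"
  have 1: "wp (4 * n) (Store 10 10) R M (\<lambda>t R' M'. t \<le> 1 \<and> M' = M1 \<and> R' = R)" using R0 n by (simp add: wp_simps M1_def)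
  have 2: "wp (4 * n) (Move 13 1) R M1 (\<lambda>t R' M'. t \<le> 1 \<and> M' = M1 \<and> R' = R1)" using R0 by (simp add: wp_simps R1_def)
  have 3: "wp (4 * n) (scan_up 1) R1 M1 (\<lambda>t R' M'. t \<le> 3 * k + 2 \<and> M' = M1 \<and> R' = R2)"
  proof -
    have "wp (4 * n) (scan_up 1) R1 M1 (\<lambda>t R' M'. t \<le> 3 * k + 2 \<and> M' = M1 \<and> R' = R1(13 := R1 13 + k, 6 := M1 (R1 13 + k)))"
    proof (rule scan_up_wp)
      show "M1 (R1 13 + a) = R1 1" if "a < k" for a
        using Mx[of "Suc a"] that k R0 wk by (simp add: R1_def nth_append)
      show "M1 (R1 13 + k) \<noteq> R1 1" using Mx[of "Suc k"] k R0 wk by (simp add: R1_def nth_append)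
    qed (use R0 k n in \<open>auto simp: R1_def\<close>)
    then show ?thesis by (simp add: R1_def R2_def)
  qed
  have R2: "const_regs n R2" "R2 13 = Suc k" using R by (auto simp: const_regs_def R1_def R2_def)
  have "rotate (Suc k) ?x = beta3 (b # \<gamma>)"
  proof -
    have "?x = (False # ones k) @ (False # w)" "length (False # ones k) = Suc k" using wk by auto
    then have "rotate (Suc k) ?x = (False # w) @ False # ones k" by (metis rotate_append)
    then show ?thesis using beta3_eq wk by simp
  qed
  then have 4: "wp (4 * n) (copy_rotated 10 0) R2 M1 (\<lambda>t R' M'. t \<le> 10 * n + 2 \<and> agree R2 R' \<and> buf M' 0 ?x
    \<and> buf M' n (beta3 (b # \<gamma>)))" using copy_input_wp[OF R2(1) lx b1 _ n] R2(2) k by simp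
  have ag: "agree R R2" by (simp add: agree_def R1_def R2_def)
  show ?thesis unfolding load_beta3_def
    apply (rule wp_SeqI[OF 1], elim conjE, hypsubst)
    apply (rule wp_SeqI[OF 2], elim conjE, hypsubst)
    apply (rule wp_SeqI[OF 3], elim conjE, hypsubst)
    apply (rule wp_mono[OF 4])
    using k agree_trans[OF ag] by auto
qed

definition successor_program :: com where
  "successor_program = Seq (Const 1 1) (Seq (Add 16 0 0) (Seq (Load 15 10)
     (Seq load_beta1 (Seq check_first_one (Seq load_beta2 (Seq check_last_one (Seq load_beta3 (Seq check_last_zero
     (Cond (Equal 14 1) (Sub 0 1 15) (Move 0 15))))))))))"

lemma agree_mod_flag_step:
  assumes "agree_mod_flag R R1" "agree R1 R2" "const_regs n R1"
  shows "agree_mod_flag R R2" "R2 14 = R1 14" "const_regs n R2"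
  using assms by (simp_all add: agree_mod_flag_def agree_def const_regs_def)

lemma agree_mod_flag_trans:
  assumes "agree_mod_flag R R1" "agree_mod_flag R1 R2" "const_regs n R1"
  shows "agree_mod_flag R R2" "const_regs n R2"
  using assms by (simp_all add: agree_mod_flag_def const_regs_def)

lemma beta1_length: "True \<in> set \<gamma> \<Longrightarrow> length (beta1 (b # \<gamma>)) = Suc (length \<gamma>)"
  by (erule trailing_zeros_decomp) (simp add: beta1_eq)

lemma beta3_length: "False \<in> set \<gamma> \<Longrightarrow> length (beta3 (b # \<gamma>)) = Suc (length \<gamma>)"
  by (erule leading_ones_decomp) (simp add: beta3_eq)

text \<open>The phases add up to at most \<open>650 * n + 198\<close> steps, rounded up here. The
  input and two work strings take \<open>3 * n\<close> cells; since the end address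
  \<open>3 * n\<close> must stay below the number of cells, \<open>4 * n\<close> are
  provided.\<close>

lemma successor_program_computes:
  assumes n: "n \<ge> 6" and \<alpha>: "\<alpha> \<in> asym_strings n"
  shows "computes_bit_within successor_program \<alpha> (g n \<alpha>) (700 * n + 300) (4 * n)"
proof -
  obtain b \<gamma> where bg: "\<alpha> = b # \<gamma>" using asym_strings_tail(1)[OF \<alpha>] by (cases \<alpha>) auto
  have T: "True \<in> set \<gamma>" "False \<in> set \<gamma>" using asym_strings_tail[OF \<alpha>] bg by auto
  have len: "length (b # \<gamma>) = n"
    using \<alpha> rotations_length unfolding bg asym_strings_def asym_bracelets_def by force
  let ?A = "asym_bracelets n"
  define C1 where "C1 \<longleftrightarrow> beta1 \<alpha> \<in> ?A \<and> first_one (beta1 \<alpha>) \<in> ?A"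
  define C2 where "C2 \<longleftrightarrow> beta2 \<alpha> \<in> ?A \<and> last_one (beta2 \<alpha>) \<in> ?A \<and> first_one (beta2 \<alpha>) \<notin> ?A"
  define C3 where "C3 \<longleftrightarrow> beta3 \<alpha> \<in> ?A \<and> last_zero (beta3 \<alpha>) \<in> ?A \<and> first_one (beta3 \<alpha>) \<notin> ?A \<and> last_one (beta3 \<alpha>) \<notin> ?A"
  have g: "g n \<alpha> = (if C1 \<or> C2 \<or> C3 then \<not> b else b)"
    unfolding g_def Let_def C1_def C2_def C3_def bg by simp
  have b2: "beta2 \<alpha> = \<gamma> @ [True]" by (simp add: beta2_def bg)
  define R M where "R = fst (input_state \<alpha>)" and "M = snd (input_state \<alpha>)"
  have R: "R 0 = n" "\<And>r. r \<noteq> 0 \<Longrightarrow> R r = 0" using len bg by (auto simp: R_def input_state_def)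
  have M: "buf M 0 (b # \<gamma>)" unfolding buf_def M_def input_state_def bg by auto
  define R1 where "R1 = R(1 := 1, 16 := 2 * n, 15 := of_bool b)"
  have c1: "const_regs n R1" using R by (simp add: const_regs_def R1_def)
  have R1: "R1 14 = 0" "R1 15 = of_bool b" using R by (auto simp: R1_def)
  have i1: "wp (4 * n) (Const 1 1) R M (\<lambda>t R' M'. t \<le> 1 \<and> R' = R(1 := 1) \<and> M' = M)" using n by (simp add: wp_simps)
  have i2: "wp (4 * n) (Add 16 0 0) (R(1 := 1)) M (\<lambda>t R' M'. t \<le> 1 \<and> R' = R(1 := 1, 16 := 2 * n) \<and> M' = M)"
    using n R by (simp add: wp_simps mult_2)
  have "M 0 = of_bool b" using M by (force simp: buf_def)
  then have i3: "wp (4 * n) (Load 15 10) (R(1 := 1, 16 := 2 * n)) M (\<lambda>t R' M'. t \<le> 1 \<and> R' = R1 \<and> M' = M)"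
    using n R by (simp add: wp_simps R1_def)
  have ag0: "agree_mod_flag R1 R1" by (simp add: agree_mod_flag_def)
  have "wp (4 * n) successor_program R M (\<lambda>t R' M'. t \<le> 700 * n + 300 \<and> R' 0 = of_bool (g n \<alpha>))"
    unfolding successor_program_def
  proof (rule wp_SeqI[OF i1], elim conjE, hypsubst, rule wp_SeqI[OF i2], elim conjE, hypsubst,
      rule wp_SeqI[OF i3], elim conjE, hypsubst,
      rule wp_SeqI[OF load_beta1_wp[OF c1 n len M T(1)]], elim conjE)
    fix u1 u2 u3 :: nat assume u: "u1 \<le> 1" "u2 \<le> 1" "u3 \<le> 1"
    fix t2 R2 M2 assume t2: "t2 \<le> 13 * n + 10" and a2: "agree R1 R2" and M2: "buf M2 0 (True # \<gamma>)" "buf M2 n (beta1 (b # \<gamma>))"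
    note s2 = agree_mod_flag_step[OF ag0 a2 c1]
    have l1: "length (beta1 (b # \<gamma>)) = n" using beta1_length[OF T(1)] len by simp
    have lt: "length (True # \<gamma>) = n" using len by simp
    show "wp (4 * n) (Seq check_first_one (Seq load_beta2 (Seq check_last_one (Seq load_beta3 (Seq check_last_zero
        (Cond (Equal 14 1) (Sub 0 1 15) (Move 0 15))))))) R2 M2
        (\<lambda>u R' M'. u1 + (u2 + (u3 + (t2 + u))) \<le> 700 * n + 300 \<and> R' 0 = of_bool (g n \<alpha>))"
    proof (rule wp_SeqI[OF check_first_one_wp[OF s2(3) n l1 M2(2)]], elim conjE, hypsubst)
      fix t3 R3 assume t3: "t3 \<le> 131 * n + 30" and a3: "agree_mod_flag R2 R3"
        and f3: "R3 14 = (if beta1 (b # \<gamma>) \<in> ?A \<and> first_one (beta1 (b # \<gamma>)) \<in> ?A then 1 else R2 14)"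
      note s3 = agree_mod_flag_trans[OF s2(1) a3 s2(3)]
      show "wp (4 * n) (Seq load_beta2 (Seq check_last_one (Seq load_beta3 (Seq check_last_zero
        (Cond (Equal 14 1) (Sub 0 1 15) (Move 0 15)))))) R3 M2
        (\<lambda>u R' M'. u1 + (u2 + (u3 + (t2 + (t3 + u)))) \<le> 700 * n + 300 \<and> R' 0 = of_bool (g n \<alpha>))"
      proof (rule wp_SeqI[OF load_beta2_wp[OF s3(2) n lt M2(1)]], elim conjE)
        fix t4 R4 M4 assume t4: "t4 \<le> 10 * n + 3" and a4: "agree R3 R4" and M4: "buf M4 0 (True # \<gamma>)" "buf M4 n (\<gamma> @ [True])"
        note s4 = agree_mod_flag_step[OF s3(1) a4 s3(2)]
        have l2: "length (\<gamma> @ [True]) = n" using len by simp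
        show "wp (4 * n) (Seq check_last_one (Seq load_beta3 (Seq check_last_zero
          (Cond (Equal 14 1) (Sub 0 1 15) (Move 0 15))))) R4 M4
          (\<lambda>u R' M'. u1 + (u2 + (u3 + (t2 + (t3 + (t4 + u))))) \<le> 700 * n + 300 \<and> R' 0 = of_bool (g n \<alpha>))"
        proof (rule wp_SeqI[OF check_last_one_wp[OF s4(3) n l2 M4(2)]], elim conjE)
          fix t5 R5 M5 assume t5: "t5 \<le> 208 * n + 60" and M5: "\<forall>a<n. M5 a = M4 a" and a5: "agree_mod_flag R4 R5"
            and f5: "R5 14 = (if \<gamma> @ [True] \<in> ?A \<and> last_one (\<gamma> @ [True]) \<in> ?A \<and> first_one (\<gamma> @ [True]) \<notin> ?A then 1 else R4 14)"
          note s5 = agree_mod_flag_trans[OF s4(1) a5 s4(3)]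
          have M5': "buf M5 0 (True # \<gamma>)" using buf_cong[OF M4(1), of M5] M5 lt by simp
          show "wp (4 * n) (Seq load_beta3 (Seq check_last_zero
            (Cond (Equal 14 1) (Sub 0 1 15) (Move 0 15)))) R5 M5
            (\<lambda>u R' M'. u1 + (u2 + (u3 + (t2 + (t3 + (t4 + (t5 + u)))))) \<le> 700 * n + 300 \<and> R' 0 = of_bool (g n \<alpha>))"
          proof (rule wp_SeqI[OF load_beta3_wp[OF s5(2) n lt M5' T(2), of b]], elim conjE)
            fix t6 R6 M6 assume t6: "t6 \<le> 13 * n + 10" and a6: "agree R5 R6" and M6: "buf M6 n (beta3 (b # \<gamma>))"
            note s6 = agree_mod_flag_step[OF s5(1) a6 s5(2)]
            have l3: "length (beta3 (b # \<gamma>)) = n" using beta3_length[OF T(2)] len by simp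
            show "wp (4 * n) (Seq check_last_zero (Cond (Equal 14 1) (Sub 0 1 15) (Move 0 15))) R6 M6
              (\<lambda>u R' M'. u1 + (u2 + (u3 + (t2 + (t3 + (t4 + (t5 + (t6 + u))))))) \<le> 700 * n + 300 \<and> R' 0 = of_bool (g n \<alpha>))"
            proof (rule wp_SeqI[OF check_last_zero_wp[OF s6(3) n l3 M6]], elim conjE)
              fix t7 R7 M7 assume t7: "t7 \<le> 275 * n + 80" and a7: "agree_mod_flag R6 R7"
                and f7: "R7 14 = (if beta3 (b # \<gamma>) \<in> ?A \<and> last_zero (beta3 (b # \<gamma>)) \<in> ?A \<and> first_one (beta3 (b # \<gamma>)) \<notin> ?A
                  \<and> last_one (beta3 (b # \<gamma>)) \<notin> ?A then 1 else R6 14)"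
              note s7 = agree_mod_flag_trans[OF s6(1) a7 s6(3)]
              have r: "R7 1 = 1" "R7 15 = of_bool b" using s7 R1 by (auto simp: const_regs_def agree_mod_flag_def)
              have "R3 14 = of_bool C1" using f3 s2(2) R1 by (simp add: C1_def bg)
              moreover have "R5 14 = (if C2 then 1 else R3 14)" using f5 s4(2) by (simp add: C2_def b2)
              moreover have "R7 14 = (if C3 then 1 else R5 14)" using f7 s6(2) by (simp add: C3_def bg)
              ultimately have f: "R7 14 = of_bool (C1 \<or> C2 \<or> C3)" by auto
              have t: "u1 + (u2 + (u3 + (t2 + (t3 + (t4 + (t5 + (t6 + (t7 + 2)))))))) \<le> 700 * n + 300"
                using u t2 t3 t4 t5 t6 t7 n by linarith
              show "wp (4 * n) (Cond (Equal 14 1) (Sub 0 1 15) (Move 0 15)) R7 M7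
                (\<lambda>u R' M'. u1 + (u2 + (u3 + (t2 + (t3 + (t4 + (t5 + (t6 + (t7 + u)))))))) \<le> 700 * n + 300 \<and> R' 0 = of_bool (g n \<alpha>))"
                using t r unfolding g by (cases "C1 \<or> C2 \<or> C3"; cases b) (simp_all add: wp_simps f)
            qed
          qed
        qed
      qed
    qed
  qed
  then obtain t R' M' where "exec (4 * n) successor_program (R, M) t (R', M')" "t \<le> 700 * n + 300" "R' 0 = of_bool (g n \<alpha>)"
    unfolding wp_def by blast
  moreover have "(R, M) = input_state \<alpha>" by (simp add: R_def M_def)
  moreover have "length \<alpha> < 4 * n" using len bg n by simp
  ultimately show ?thesis unfolding computes_bit_within_def by metis
qed

theorem theorem3:
  shows "(\<forall>n\<ge>6. \<exists>s. universal_cycle n (asym_strings n) s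
                  \<and> successor_rule n (asym_strings n) s (g n)
                  \<and> orientable_sequence n s
                  \<and> length s = cycle_length n)
       \<and> (\<exists>prog (time :: nat \<Rightarrow> nat) (space :: nat \<Rightarrow> nat).
            (\<lambda>n. real (time n)) \<in> O(\<lambda>n. real n)
          \<and> (\<lambda>n. real (space n)) \<in> O(\<lambda>n. real n)
          \<and> (\<forall>n\<ge>6. \<forall>\<alpha> \<in> asym_strings n.
               computes_bit_within prog \<alpha> (g n \<alpha>) (time n) (space n)))"
proof (rule conjI)
  show "\<forall>n\<ge>6. \<exists>s. universal_cycle n (asym_strings n) s \<and> successor_rule n (asym_strings n) s (g n)
      \<and> orientable_sequence n s \<and> length s = cycle_length n"
    using orientable_universal_cycle by blast
  show "\<exists>prog (time :: nat \<Rightarrow> nat) (space :: nat \<Rightarrow> nat).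
            (\<lambda>n. real (time n)) \<in> O(\<lambda>n. real n)
          \<and> (\<lambda>n. real (space n)) \<in> O(\<lambda>n. real n)
          \<and> (\<forall>n\<ge>6. \<forall>\<alpha> \<in> asym_strings n.
               computes_bit_within prog \<alpha> (g n \<alpha>) (time n) (space n))"
  proof (rule exI[of _ successor_program], rule exI[of _ "\<lambda>n. 700 * n + 300"], rule exI[of _ "\<lambda>n. 4 * n"],
      intro conjI allI impI ballI)
    \<comment> \<open>The factor 1000 is 700 + 300 and works from \<open>n = 1\<close> on.\<close>
    show "(\<lambda>n. real (700 * n + 300)) \<in> O(\<lambda>n. real n)"
      by (rule landau_o.bigI[of 1000]) (auto intro!: eventually_at_top_linorderI[of 1])
    show "(\<lambda>n. real (4 * n)) \<in> O(\<lambda>n. real n)"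
      by (rule landau_o.bigI[of 4]) auto
  qed (rule successor_program_computes)
qed

end
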